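(* Let $\Psi$ be the countable two-branching ultrahomogeneous pseudotree. Then every finite chain in $\Psi$ has finite big Ramsey degree in $\Psi$: for every finite chain $\mathbf{A}$ (a finite substructure of $\Psi$ whose elements are pairwise $\prec$-comparable) there is a positive integer $n$ such that for every coloring of the copies of $\mathbf{A}$ in $\Psi$ into finitely many colors, there is a substructure $\Psi'$ of $\Psi$ isomorphic to $\Psi$ in which the copies of $\mathbf{A}$ take at most $n$ colors.
   Context: The countable two-branching ultrahomogeneous pseudotree is the countable structure $\Psi=(P;\prec,\wedge,<_{\mathrm{lex}})$ (the Fraïssé limit of the class of finite rooted two-branching trees in the language $\{\prec,\wedge,<_{\mathrm{lex}}\}$) satisfying: for each $p\in P$ the set $\{q:q\prec p\}$ is linearly ordered by $\prec$; there is a root $p_0$ with $p_0\preceq p$ for all $p$ (where $p\preceq q$ means $p\prec q$ or $p=q$); if $p_0\prec p$ then $\{q: p_0\prec q\prec p\}$ is a dense linear order without endpoints; any $p,q$ have a meet $p\wedge q$, the $\preceq$-maximum of their common predecessors; $<_{\mathrm{lex}}$ linearly orders each pair of $\preceq$-incomparable nodes; and every node $s$ is two-branching: there are incomparable $p<_{\mathrm{lex}}q$ with $s=p\wedge q$ such that whenever $p<_{\mathrm{lex}}r<_{\mathrm{lex}}q$ and $p\wedge r=r\wedge q=s$, then $p\preceq r$ or $q\preceq r$. A substructure is a subset with the induced relations; a copy of a finite substructure $\mathbf{A}$ in $\Psi$ is a substructure isomorphic to $\mathbf{A}$. A chain is a set of pairwise $\prec$-comparable elements. The big Ramsey degree of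 $\mathbf{A}$ in $\Psi$ is the least $n\ge1$, if it exists, such that every finite coloring of the copies of $\mathbf{A}$ in $\Psi$ admits a substructure $\Psi'\cong\Psi$ on whose copies of $\mathbf{A}$ at most $n$ colors occur; otherwise it is $\infty$. *)

theory Defs
  imports Main "HOL-Library.Extended_Nat" "HOL-Library.Countable_Set"
begin

section \<open>Structures in the language of precedence, meet and lexicographic order\<close>

record 'a pstruct =
  points :: "'a set"
  prec :: "'a \<Rightarrow> 'a \<Rightarrow> bool" (infix "\<prec>\<index>" 50)
  pmeet :: "'a \<Rightarrow> 'a \<Rightarrow> 'a" (infixl "\<sqinter>\<index>" 70)
  plex :: "'a \<Rightarrow> 'a \<Rightarrow> bool" (infix "\<lhd>\<index>" 50)

definition preceq :: "'a pstruct \<Rightarrow> 'a \<Rightarrow> 'a \<Rightarrow> bool" (infix "\<preceq>\<index>" 50)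
  where "preceq S p q \<longleftrightarrow> prec S p q \<or> p = q"

definition incomparable :: "'a pstruct \<Rightarrow> 'a \<Rightarrow> 'a \<Rightarrow> bool"
  where "incomparable S p q \<longleftrightarrow> \<not> p \<preceq>\<^bsub>S\<^esub> q \<and> \<not> q \<preceq>\<^bsub>S\<^esub> p"

definition is_root :: "'a pstruct \<Rightarrow> 'a \<Rightarrow> bool"
  where "is_root S r \<longleftrightarrow> r \<in> points S \<and> (\<forall>p\<in>points S. r \<preceq>\<^bsub>S\<^esub> p)"

definition is_chain :: "'a pstruct \<Rightarrow> 'a set \<Rightarrow> bool"
  where "is_chain S A \<longleftrightarrow> (\<forall>p\<in>A. \<forall>q\<in>A. \<not> incomparable S p q)"

text \<open>The meet is a function symbol, so a substructure is closed under meets.\<close>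

definition substructure :: "'a set \<Rightarrow> 'a pstruct \<Rightarrow> bool"
  where "substructure Q S \<longleftrightarrow> Q \<subseteq> points S \<and> (\<forall>p\<in>Q. \<forall>q\<in>Q. p \<sqinter>\<^bsub>S\<^esub> q \<in> Q)"

definition induced :: "'a pstruct \<Rightarrow> 'a set \<Rightarrow> 'a pstruct"
  where "induced S Q = S\<lparr>points := Q\<rparr>"

definition is_iso :: "('a \<Rightarrow> 'b) \<Rightarrow> 'a pstruct \<Rightarrow> 'b pstruct \<Rightarrow> bool"
  where "is_iso f S T \<longleftrightarrow>
    bij_betw f (points S) (points T) \<and>
    (\<forall>p\<in>points S. \<forall>q\<in>points S.
      (f p \<prec>\<^bsub>T\<^esub> f q \<longleftrightarrow> p \<prec>\<^bsub>S\<^esub> q) \<and>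
      (f p \<lhd>\<^bsub>T\<^esub> f q \<longleftrightarrow> p \<lhd>\<^bsub>S\<^esub> q) \<and>
      f (p \<sqinter>\<^bsub>S\<^esub> q) = f p \<sqinter>\<^bsub>T\<^esub> f q)"

definition isomorphic :: "'a pstruct \<Rightarrow> 'b pstruct \<Rightarrow> bool"
  where "isomorphic S T \<longleftrightarrow> (\<exists>f. is_iso f S T)"


section \<open>Rooted lexicographically ordered pseudotrees\<close>

text \<open>
  The relation \<open>\<lhd>\<close> relates incomparable points only. That it is lexicographic
  means that the order of two incomparable points is inherited by all points above them.
\<close>

definition lex_pseudotree :: "'a pstruct \<Rightarrow> bool"
  where "lex_pseudotree S \<longleftrightarrow>
    (\<forall>p\<in>points S. \<not> p \<prec>\<^bsub>S\<^esub> p) \<and>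
    (\<forall>p\<in>points S. \<forall>q\<in>points S. \<forall>r\<in>points S. p \<prec>\<^bsub>S\<^esub> q \<longrightarrow> q \<prec>\<^bsub>S\<^esub> r \<longrightarrow> p \<prec>\<^bsub>S\<^esub> r) \<and>
    (\<forall>p\<in>points S. is_chain S {q \<in> points S. q \<prec>\<^bsub>S\<^esub> p}) \<and>
    (\<exists>r. is_root S r) \<and>
    (\<forall>p\<in>points S. \<forall>q\<in>points S.
      p \<sqinter>\<^bsub>S\<^esub> q \<in> points S \<and> p \<sqinter>\<^bsub>S\<^esub> q \<preceq>\<^bsub>S\<^esub> p \<and> p \<sqinter>\<^bsub>S\<^esub> q \<preceq>\<^bsub>S\<^esub> q \<and>
      (\<forall>r\<in>points S. r \<preceq>\<^bsub>S\<^esub> p \<longrightarrow> r \<preceq>\<^bsub>S\<^esub> q \<longrightarrow> r \<preceq>\<^bsub>S\<^esub> p \<sqinter>\<^bsub>S\<^esub> q)) \<and>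
    (\<forall>p\<in>points S. \<forall>q\<in>points S. p \<lhd>\<^bsub>S\<^esub> q \<longrightarrow> incomparable S p q \<and> \<not> q \<lhd>\<^bsub>S\<^esub> p) \<and>
    (\<forall>p\<in>points S. \<forall>q\<in>points S. incomparable S p q \<longrightarrow> p \<lhd>\<^bsub>S\<^esub> q \<or> q \<lhd>\<^bsub>S\<^esub> p) \<and>
    (\<forall>p\<in>points S. \<forall>q\<in>points S. \<forall>r\<in>points S. p \<lhd>\<^bsub>S\<^esub> q \<longrightarrow> q \<lhd>\<^bsub>S\<^esub> r \<longrightarrow> p \<lhd>\<^bsub>S\<^esub> r) \<and>
    (\<forall>p\<in>points S. \<forall>q\<in>points S. \<forall>p'\<in>points S. \<forall>q'\<in>points S.
      p \<lhd>\<^bsub>S\<^esub> q \<longrightarrow> p \<preceq>\<^bsub>S\<^esub> p' \<longrightarrow> q \<preceq>\<^bsub>S\<^esub> q' \<longrightarrow> p' \<lhd>\<^bsub>S\<^esub> q')"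


section \<open>Finite rooted two-branching trees and their limit\<close>

definition immediate_succs :: "'a pstruct \<Rightarrow> 'a \<Rightarrow> 'a set"
  where "immediate_succs S s =
    {t \<in> points S. s \<prec>\<^bsub>S\<^esub> t \<and> \<not> (\<exists>u\<in>points S. s \<prec>\<^bsub>S\<^esub> u \<and> u \<prec>\<^bsub>S\<^esub> t)}"

definition finite_two_branching_tree :: "'a pstruct \<Rightarrow> bool"
  where "finite_two_branching_tree T \<longleftrightarrow>
    finite (points T) \<and> lex_pseudotree T \<and>
    (\<forall>s\<in>points T. immediate_succs T s = {} \<or> card (immediate_succs T s) = 2)"

text \<open>
  Substructures of \<open>S\<close> that are finite two-branching trees with the same root as \<open>S\<close>.
\<close>

definition rooted_subtree :: "'a set \<Rightarrow> 'a pstruct \<Rightarrow> bool"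
  where "rooted_subtree Q S \<longleftrightarrow>
    substructure Q S \<and> finite_two_branching_tree (induced S Q) \<and> (\<forall>r. is_root S r \<longrightarrow> r \<in> Q)"

text \<open>
  The Fraisse limit of the finite rooted two-branching trees, with root-preserving embeddings.
  Every branching node of such a tree has exactly two immediate successors, and the class is not
  hereditary: a chain \<open>p \<prec> q\<close> does not record on which side of \<open>p\<close> the point \<open>q\<close> lies, so an
  isomorphism between two chains need not extend to an automorphism. Accordingly the limit is
  the union of its rooted subtrees, and homogeneity concerns isomorphisms between rooted subtrees.
  Trees on \<^typ>\<open>nat\<close> represent all isomorphism types of finite trees.
\<close>

definition is_Fraisse_limit :: "'a pstruct \<Rightarrow> bool"
  where "is_Fraisse_limit S \<longleftrightarrow>
    countable (points S) \<and>
    (\<forall>F. finite F \<and> F \<subseteq> points S \<longrightarrow> (\<exists>Q. rooted_subtree Q S \<and> F \<subseteq> Q)) \<and>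
    (\<forall>T :: nat pstruct. finite_two_branching_tree T \<longrightarrow>
      (\<exists>Q. rooted_subtree Q S \<and> isomorphic T (induced S Q))) \<and>
    (\<forall>Q R f. rooted_subtree Q S \<and> rooted_subtree R S \<and> is_iso f (induced S Q) (induced S R) \<longrightarrow>
      (\<exists>g. is_iso g S S \<and> (\<forall>q\<in>Q. g q = f q)))"

definition dense_without_endpoints :: "'a pstruct \<Rightarrow> 'a set \<Rightarrow> bool"
  where "dense_without_endpoints S D \<longleftrightarrow>
    D \<noteq> {} \<and> is_chain S D \<and>
    (\<forall>x\<in>D. (\<exists>y\<in>D. y \<prec>\<^bsub>S\<^esub> x) \<and> (\<exists>y\<in>D. x \<prec>\<^bsub>S\<^esub> y)) \<and>
    (\<forall>x\<in>D. \<forall>y\<in>D. x \<prec>\<^bsub>S\<^esub> y \<longrightarrow> (\<exists>z\<in>D. x \<prec>\<^bsub>S\<^esub> z \<and> z \<prec>\<^bsub>S\<^esub> y))"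

text \<open>
  The explicit conditions alone do not determine the structure up to isomorphism; together with
  the last conjunct they do.
\<close>

definition two_branching_ultrahomogeneous_pseudotree :: "'a pstruct \<Rightarrow> bool"
  where "two_branching_ultrahomogeneous_pseudotree S \<longleftrightarrow>
    countable (points S) \<and> lex_pseudotree S \<and>
    (\<forall>r p. is_root S r \<and> p \<in> points S \<and> r \<prec>\<^bsub>S\<^esub> p \<longrightarrow>
      dense_without_endpoints S {q \<in> points S. r \<prec>\<^bsub>S\<^esub> q \<and> q \<prec>\<^bsub>S\<^esub> p}) \<and>
    (\<forall>s\<in>points S. \<exists>p\<in>points S. \<exists>q\<in>points S.
      incomparable S p q \<and> p \<lhd>\<^bsub>S\<^esub> q \<and> s = p \<sqinter>\<^bsub>S\<^esub> q \<and>
      (\<forall>r\<in>points S. p \<lhd>\<^bsub>S\<^esub> r \<and> r \<lhd>\<^bsub>S\<^esub> q \<and> p \<sqinter>\<^bsub>S\<^esub> r = s \<and> r \<sqinter>\<^bsub>S\<^esub> q = s \<longrightarrow>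
        p \<preceq>\<^bsub>S\<^esub> r \<or> q \<preceq>\<^bsub>S\<^esub> r)) \<and>
    is_Fraisse_limit S"


section \<open>Big Ramsey degrees\<close>

definition copies :: "'b pstruct \<Rightarrow> 'a pstruct \<Rightarrow> 'a set set"
  where "copies A S = {B. substructure B S \<and> isomorphic A (induced S B)}"

definition Ramsey_bound :: "'b pstruct \<Rightarrow> 'a pstruct \<Rightarrow> nat \<Rightarrow> bool"
  where "Ramsey_bound A S n \<longleftrightarrow>
    (\<forall>\<chi> :: 'a set \<Rightarrow> nat. finite (\<chi> ` copies A S) \<longrightarrow>
      (\<exists>Q. substructure Q S \<and> isomorphic S (induced S Q) \<and>
        card (\<chi> ` copies A (induced S Q)) \<le> n))"

definition big_Ramsey_degree :: "'b pstruct \<Rightarrow> 'a pstruct \<Rightarrow> enat"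
  where "big_Ramsey_degree A S =
    (if \<exists>n\<ge>1. Ramsey_bound A S n then enat (LEAST n. n \<ge> 1 \<and> Ramsey_bound A S n) else \<infinity>)"

end

theory Submission
  imports Defs "HOL-Library.List_Lexorder"
begin

text \<open>
  Idea. Points of the pseudotree are coded by words that walk through a system of trunks: two
  letters lead down and up in the current trunk, two letters leave it into a side cone. Level by
  level, the elements of a chain form finitely many threads, and every thread except the topmost
  stays in its trunk once it has split off. Hence the following pigeonhole principle suffices: above
  finitely many threads, of which only the topmost may exit, every finite colouring is constant on
  the image of an embedding of the tree of words that moves all threads simultaneously. It follows,
  as does the infinite Hales-Jewett theorem, from minimal idempotent ultrafilters on free monoids.
  Letting two threads exit would make it false, which is why antichains behave differently.

  By fusion the colour of a chain comes to depend only on the bounded sequence of its events: levels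
  at which a thread stops or splits, or at which the topmost thread exits for the first time after
  such a level. So the number of colours is bounded independently of the colouring. The theorem is
  transferred by an embedding of the pseudotree into the words, which reads off positions from an
  enumeration of the points, and an embedding in the other direction, which exists because every
  interval contains points from which its upper end lies on the left, and on the right.
\<close>

section \<open>Ultrafilters on free monoids\<close>

text \<open>The obstacle is a trunk letter followed by an exit. An embedding inserts padding after
  every letter, but after a trunk letter the padding must consist of trunk letters, or points of a
  trunk would be moved out of it. Among ultrafilters this shows as follows: the one of "letter
  \<open>a\<close> with its padding" absorbs that of \<open>b\<close> on its right unless
  \<open>a\<close> is a trunk letter and \<open>b\<close> an exit. It is also why the first exit of
  the top thread after an event must count as an event, while later ones need not. The colour is
  made to depend on less by induction on the number of events still to come. If the next event
  happens at the present level, the colour is a function of the finished points, the present threads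
  and the list of events, and postponing the event does not change this function. A filter
  \<open>F\<close> stands for the closed set of ultrafilters below \<open>F\<close>; compactness
  becomes the statement that some filter is not \<open>bot\<close>.\<close>

lemma minimal_filter_exists:
  fixes F0 :: "'a filter"
  assumes "Q F0" "F0 \<noteq> bot"
    and Inf_Q: "\<And>C. C \<noteq> {} \<Longrightarrow> (\<And>F. F \<in> C \<Longrightarrow> Q F \<and> F \<noteq> bot) \<Longrightarrow> Q (Inf C)"
  shows "\<exists>F\<le>F0. F \<noteq> bot \<and> Q F \<and> (\<forall>G\<le>F. G \<noteq> bot \<longrightarrow> Q G \<longrightarrow> G = F)"
proof -
  define A where "A = {F. F \<le> F0 \<and> F \<noteq> bot \<and> Q F}"
  have "\<exists>m\<in>A. \<forall>a\<in>A. a \<le> m \<longrightarrow> a = m"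
  proof (rule predicate_Zorn[where P = "\<lambda>a u. u \<le> a"])
    show "partial_order_on A (relation_of (\<lambda>a u. u \<le> a) A)"
      by (rule partial_order_on_relation_ofI) auto
  next
    fix C assume C: "C \<in> Chains (relation_of (\<lambda>a u. u \<le> a) A)"
    then have CA: "C \<subseteq> A" and tot: "\<And>x y. x \<in> C \<Longrightarrow> y \<in> C \<Longrightarrow> x \<le> y \<or> y \<le> x"
      unfolding Chains_def relation_of_def by auto
    show "\<exists>u\<in>A. \<forall>a\<in>C. u \<le> a"
    proof (cases "C = {}")
      case True
      then show ?thesis using assms(1,2) by (auto simp: A_def)
    next
      case False
      \<comment> \<open>Compactness: a property holds eventually for the infimum of a chain only if
        it does so for a member, hence the infimum is proper.\<close>
      have ev: "eventually P (Inf C) \<longleftrightarrow> (\<exists>b\<in>C. eventually P b)" for P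
        by (rule eventually_Inf_base[OF False]) (metis tot inf.absorb1 inf.absorb2 order_refl)
      have "Inf C \<noteq> bot"
        using ev[of "\<lambda>_. False"] CA by (auto simp: A_def eventually_False)
      moreover have "Q (Inf C)" using False CA by (intro Inf_Q) (auto simp: A_def)
      moreover have "Inf C \<le> F0"
        using False CA by (auto simp: A_def intro: Inf_lower2)
      ultimately show ?thesis by (auto simp: A_def Inf_lower)
    qed
  qed
  then show ?thesis unfolding A_def by (metis (mono_tags, lifting) mem_Collect_eq order_trans)
qed

section \<open>Ultrafilters as minimal proper filters\<close>

definition ultra :: "'a filter \<Rightarrow> bool"
  where "ultra F \<longleftrightarrow> F \<noteq> bot \<and> (\<forall>P. eventually P F \<or> eventually (\<lambda>x. \<not> P x) F)"

lemma ultra_not: "ultra F \<Longrightarrow> eventually (\<lambda>x. \<not> P x) F \<longleftrightarrow> \<not> eventually P F"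
  unfolding ultra_def using eventually_conj[of P F "\<lambda>x. \<not> P x"]
  by (auto simp: eventually_False)

lemma ultra_nonbot: "ultra F \<Longrightarrow> F \<noteq> bot"
  by (simp add: ultra_def)

text \<open>A minimal proper filter decides every \<open>P\<close>: restricting it to
  \<open>P\<close> gives either \<open>bot\<close> or the same filter.\<close>

lemma ultra_below:
  assumes "F \<noteq> bot"
  obtains U where "ultra U" "U \<le> F"
proof -
  obtain U where U: "U \<le> F" "U \<noteq> bot" and min: "\<And>G. G \<le> U \<Longrightarrow> G \<noteq> bot \<Longrightarrow> G = U"
    using minimal_filter_exists[of "\<lambda>_. True" F] assms by auto
  have "eventually P U \<or> eventually (\<lambda>x. \<not> P x) U" for P
  proof (rule ccontr)
    assume *: "\<not> ?thesis"
    have "inf U (principal (Collect P)) \<noteq> bot"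
      using * by (simp add: trivial_limit_def eventually_inf_principal)
    then have "inf U (principal (Collect P)) = U"
      using min by simp
    moreover have "eventually P (inf U (principal (Collect P)))"
      by (simp add: eventually_inf_principal)
    ultimately have "eventually P U" by simp
    with * show False by simp
  qed
  with U that show thesis by (auto simp: ultra_def)
qed

lemma ultra_eqI: "ultra r \<Longrightarrow> z \<noteq> bot \<Longrightarrow> z \<le> r \<Longrightarrow> z = r"
proof (rule antisym)
  assume r: "ultra r" and z: "z \<noteq> bot" "z \<le> r"
  show "r \<le> z"
  proof (rule filter_leI)
    fix P assume P: "eventually P z"
    show "eventually P r"
    proof (rule ccontr)
      assume "\<not> eventually P r"
      then have "eventually (\<lambda>x. \<not> P x) z" using r z(2) by (auto simp: ultra_def intro: filter_leD)
      with P have "eventually (\<lambda>x. False) z" by eventually_elim simp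
      with z show False by (simp add: eventually_False)
    qed
  qed
qed simp

lemma ultra_filtermap: "ultra F \<Longrightarrow> ultra (filtermap f F)"
  by (auto simp: ultra_def eventually_filtermap filtermap_bot_iff)

lemma ultra_principal: "ultra (principal {x})"
  by (auto simp: ultra_def eventually_principal principal_eq_bot_iff)

text \<open>The product of the semigroup of ultrafilters, extended to all filters. It is continuous
  in the left factor: for an ultrafilter \<open>p\<close> the closed set \<open>F \<odot> p\<close>
  is the image of the closed set \<open>F\<close>, which is \<open>below_fmul\<close>.\<close>

definition fmul :: "'a list filter \<Rightarrow> 'a list filter \<Rightarrow> 'a list filter" (infixl "\<odot>" 70)
  where "F \<odot> G = Abs_filter (\<lambda>P. \<forall>\<^sub>F s in F. \<forall>\<^sub>F t in G. P (s @ t))"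

lemma eventually_fmul: "eventually P (F \<odot> G) \<longleftrightarrow> (\<forall>\<^sub>F s in F. \<forall>\<^sub>F t in G. P (s @ t))"
  unfolding fmul_def
proof (rule eventually_Abs_filter, rule is_filter.intro)
  fix P Q
  assume "\<forall>\<^sub>F s in F. \<forall>\<^sub>F t in G. P (s @ t)" "\<forall>\<^sub>F s in F. \<forall>\<^sub>F t in G. Q (s @ t)"
  then show "\<forall>\<^sub>F s in F. \<forall>\<^sub>F t in G. P (s @ t) \<and> Q (s @ t)"
    by eventually_elim (rule eventually_conj)
next
  fix P Q :: "'a list \<Rightarrow> bool"
  assume PQ: "\<forall>x. P x \<longrightarrow> Q x" and "\<forall>\<^sub>F s in F. \<forall>\<^sub>F t in G. P (s @ t)"
  then show "\<forall>\<^sub>F s in F. \<forall>\<^sub>F t in G. Q (s @ t)"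
    by (auto elim!: eventually_mono)
qed simp

lemma fmul_assoc: "F \<odot> G \<odot> H = F \<odot> (G \<odot> H)"
  by (simp add: filter_eq_iff eventually_fmul)

abbreviation pt :: "'a list \<Rightarrow> 'a list filter"
  where "pt s \<equiv> principal {s}"

lemma fmul_unit [simp]: "pt [] \<odot> F = F" "F \<odot> pt [] = F"
  by (simp_all add: filter_eq_iff eventually_fmul eventually_principal)

lemma fmul_bot_iff [simp]: "F \<odot> G = bot \<longleftrightarrow> F = bot \<or> G = bot"
  by (cases "G = bot") (simp_all add: trivial_limit_def eventually_fmul)

lemma ultra_fmul: "ultra F \<Longrightarrow> ultra G \<Longrightarrow> ultra (F \<odot> G)"
  unfolding ultra_def[of "F \<odot> G"] by (simp add: eventually_fmul ultra_not ultra_nonbot)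

lemma fmul_mono: "F \<le> F' \<Longrightarrow> G \<le> G' \<Longrightarrow> F \<odot> G \<le> F' \<odot> G'"
  unfolding le_filter_def eventually_fmul by (meson eventually_mono)

lemma filtermap_fmul:
  "filtermap (map f) (F \<odot> G) = filtermap (map f) F \<odot> filtermap (map f) G"
  by (simp add: filter_eq_iff eventually_fmul eventually_filtermap)

text \<open>The filter whose ultrafilters are the \<open>z\<close> with \<open>z \<odot> p = r\<close>.\<close>

definition fdiv :: "'a list filter \<Rightarrow> 'a list filter \<Rightarrow> 'a list filter"
  where "fdiv r p = Abs_filter (\<lambda>P. \<exists>A. eventually A r \<and> (\<forall>s. (\<forall>\<^sub>F t in p. A (s @ t)) \<longrightarrow> P s))"

lemma eventually_fdiv:
  "eventually P (fdiv r p) \<longleftrightarrow> (\<exists>A. eventually A r \<and> (\<forall>s. (\<forall>\<^sub>F t in p. A (s @ t)) \<longrightarrow> P s))"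
  unfolding fdiv_def
proof (rule eventually_Abs_filter, rule is_filter.intro)
  fix P Q
  assume "\<exists>A. eventually A r \<and> (\<forall>s. (\<forall>\<^sub>F t in p. A (s @ t)) \<longrightarrow> P s)"
    "\<exists>A. eventually A r \<and> (\<forall>s. (\<forall>\<^sub>F t in p. A (s @ t)) \<longrightarrow> Q s)"
  then obtain A B where "eventually A r" "\<forall>s. (\<forall>\<^sub>F t in p. A (s @ t)) \<longrightarrow> P s"
    "eventually B r" "\<forall>s. (\<forall>\<^sub>F t in p. B (s @ t)) \<longrightarrow> Q s" by auto
  then show "\<exists>A. eventually A r \<and> (\<forall>s. (\<forall>\<^sub>F t in p. A (s @ t)) \<longrightarrow> P s \<and> Q s)"
    by (intro exI[of _ "\<lambda>x. A x \<and> B x"]) (auto simp: eventually_conj_iff)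
qed (auto intro: exI[of _ "\<lambda>_. True"])

lemma le_fdiv_iff:
  assumes "ultra z" "ultra p" "ultra r"
  shows "z \<le> fdiv r p \<longleftrightarrow> z \<odot> p = r"
proof
  assume z: "z \<le> fdiv r p"
  have "z \<odot> p \<le> r"
    by (rule filter_leI) (auto simp: eventually_fmul eventually_fdiv intro!: filter_leD[OF z])
  then show "z \<odot> p = r"
    using assms by (intro ultra_eqI) (auto simp: ultra_nonbot)
next
  assume "z \<odot> p = r"
  then show "z \<le> fdiv r p"
    unfolding le_filter_def eventually_fdiv by (metis (mono_tags, lifting) eventually_fmul eventually_mono)
qed

text \<open>If \<open>F\<close> and \<open>fdiv r p\<close> were incompatible, some \<open>A\<close>
  in \<open>r\<close> would fail to hold along \<open>p\<close> for \<open>F\<close>-almost all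
  \<open>s\<close>; as \<open>p\<close> is an ultrafilter, the negation of \<open>A\<close> would
  then lie in \<open>F \<odot> p\<close>, hence in \<open>r\<close>.\<close>

lemma below_fmul:
  assumes "ultra r" "ultra p" "r \<le> F \<odot> p"
  obtains z where "ultra z" "z \<le> F" "z \<odot> p = r"
proof -
  have "inf F (fdiv r p) \<noteq> bot"
  proof
    assume "inf F (fdiv r p) = bot"
    then obtain P A where P: "eventually P F" and A: "eventually A r"
      and PA: "\<And>s. P s \<Longrightarrow> \<not> (\<forall>\<^sub>F t in p. A (s @ t))"
      by (auto simp: trivial_limit_def eventually_inf eventually_fdiv)
    from P have "\<forall>\<^sub>F s in F. \<forall>\<^sub>F t in p. \<not> A (s @ t)"
      by eventually_elim (use PA assms(2) in \<open>simp add: ultra_not\<close>)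
    then have "eventually (\<lambda>x. \<not> A x) r"
      using assms(3) by (auto simp: eventually_fmul le_filter_def)
    with A assms(1) show False by (simp add: ultra_not)
  qed
  then obtain z where z: "ultra z" "z \<le> inf F (fdiv r p)" by (rule ultra_below)
  then show thesis using that assms le_fdiv_iff by auto
qed

subsection \<open>Idempotents\<close>

text \<open>The Ellis-Numakura argument. A minimal closed subsemigroup \<open>N\<close> equals
  \<open>N \<odot> p\<close> for \<open>p\<close> in it, so \<open>p\<close> has a left unit
  \<open>z0\<close> in \<open>N\<close>. The left units of \<open>p\<close> in \<open>N\<close> form
  a closed subsemigroup again, hence all of \<open>N\<close>, and \<open>p\<close> is one of
  them.\<close>

lemma Ellis:
  fixes F :: "'a list filter"
  assumes "F \<noteq> bot" and closed: "\<And>p q. ultra p \<Longrightarrow> ultra q \<Longrightarrow> p \<le> F \<Longrightarrow> q \<le> F \<Longrightarrow> p \<odot> q \<le> F"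
  obtains e where "ultra e" "e \<le> F" "e \<odot> e = e"
proof -
  define Q where "Q G \<longleftrightarrow> (\<forall>p q. ultra p \<longrightarrow> ultra q \<longrightarrow> p \<le> G \<longrightarrow> q \<le> G \<longrightarrow> p \<odot> q \<le> G)"
    for G :: "'a list filter"
  have "Q F" using closed by (auto simp: Q_def)
  moreover have "Q (Inf C)" if "\<And>F. F \<in> C \<Longrightarrow> Q F \<and> F \<noteq> bot" for C
    using that by (auto simp: Q_def le_Inf_iff)
  ultimately obtain N where N: "N \<le> F" "N \<noteq> bot" "Q N"
    and min: "\<And>G. G \<le> N \<Longrightarrow> G \<noteq> bot \<Longrightarrow> Q G \<Longrightarrow> G = N"
    using minimal_filter_exists[of Q F] assms(1) by metis
  obtain p where p: "ultra p" "p \<le> N" using N(2) by (rule ultra_below)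
  have Np: "N \<odot> p = N"
  proof (rule min)
    have le: "r \<le> N" if "ultra r" "r \<le> N \<odot> p" for r
      using below_fmul[OF that(1) p(1) that(2)] p N(3) unfolding Q_def by metis
    show "N \<odot> p \<le> N"
    proof (rule filter_leI, rule ccontr)
      fix P assume P: "eventually P N" "\<not> eventually P (N \<odot> p)"
      then have "inf (N \<odot> p) (principal {x. \<not> P x}) \<noteq> bot"
        by (simp add: trivial_limit_def eventually_inf_principal)
      then obtain r where r: "ultra r" "r \<le> inf (N \<odot> p) (principal {x. \<not> P x})"
        by (rule ultra_below)
      then have "r \<le> N" "r \<le> principal {x. \<not> P x}" using le by auto
      then have "eventually P r" "eventually (\<lambda>x. \<not> P x) r"
        using P(1) by (auto intro: filter_leD simp: le_principal)
      with r(1) show False by (simp add: ultra_not)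
    qed
    show "Q (N \<odot> p)"
      unfolding Q_def
    proof (intro allI impI)
      fix a b assume a: "ultra a" "ultra b" "a \<le> N \<odot> p" "b \<le> N \<odot> p"
      obtain z where z: "ultra z" "z \<le> N" "z \<odot> p = b" using below_fmul[OF a(2) p(1) a(4)] .
      have "a \<odot> z \<le> N" using N(3) a z le unfolding Q_def by auto
      then show "a \<odot> b \<le> N \<odot> p"
        using fmul_mono[of "a \<odot> z" N p p] z by (simp add: fmul_assoc)
    qed
  qed (use N p in \<open>auto simp: ultra_nonbot\<close>)
  obtain z0 where z0: "ultra z0" "z0 \<le> N" "z0 \<odot> p = p"
    using below_fmul[of p p N] Np p by auto
  have "inf N (fdiv p p) = N"
  proof (rule min)
    have "z0 \<le> inf N (fdiv p p)" using z0 le_fdiv_iff[OF z0(1) p(1) p(1)] by simp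
    then show "inf N (fdiv p p) \<noteq> bot" using ultra_nonbot[OF z0(1)] by (metis bot.extremum_uniqueI)
    show "Q (inf N (fdiv p p))"
      unfolding Q_def
    proof (intro allI impI)
      fix a b assume *: "ultra a" "ultra b" "a \<le> inf N (fdiv p p)" "b \<le> inf N (fdiv p p)"
      then have "a \<odot> p = p" "b \<odot> p = p"
        using le_fdiv_iff[OF *(1) p(1) p(1)] le_fdiv_iff[OF *(2) p(1) p(1)] by simp_all
      then have "a \<odot> b \<odot> p = p" by (simp add: fmul_assoc)
      then have "a \<odot> b \<le> fdiv p p"
        using le_fdiv_iff[OF ultra_fmul[OF *(1,2)] p(1) p(1)] by simp
      then show "a \<odot> b \<le> inf N (fdiv p p)" using * N(3) by (auto simp: Q_def)
    qed
  qed simp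
  then have "p \<le> fdiv p p" using p by (metis le_inf_iff)
  then have "p \<odot> p = p" using le_fdiv_iff[OF p(1) p(1) p(1)] by simp
  then show thesis using that p N(1) by (meson order_trans)
qed

text \<open>Invariance under left translation by single words is enough: the set is closed, so it
  absorbs arbitrary filters from the left (\<open>left_ideal_fmul_le\<close>).\<close>

definition left_ideal :: "'a list filter \<Rightarrow> bool"
  where "left_ideal F \<longleftrightarrow> F \<noteq> bot \<and> (\<forall>P s. eventually P F \<longrightarrow> (\<forall>\<^sub>F t in F. P (s @ t)))"

lemma left_ideal_fmul_le: "left_ideal F \<Longrightarrow> p \<le> F \<Longrightarrow> z \<odot> p \<le> F"
  by (auto simp: left_ideal_def le_filter_def eventually_fmul)

lemma minimal_left_ideal:
  obtains F :: "'a list filter" where "left_ideal F"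
    and "\<And>p r. ultra p \<Longrightarrow> ultra r \<Longrightarrow> p \<le> F \<Longrightarrow> r \<le> F \<Longrightarrow> \<exists>z. ultra z \<and> z \<le> F \<and> z \<odot> p = r"
proof -
  define Q where "Q F \<longleftrightarrow> (\<forall>P s. eventually P F \<longrightarrow> (\<forall>\<^sub>F t in F. P (s @ t)))"
    for F :: "'a list filter"
  have Q: "Q F \<longleftrightarrow> (\<forall>s. filtermap ((@) s) F \<le> F)" for F
    by (auto simp: Q_def le_filter_def eventually_filtermap)
  have "Q (Inf C)" if "\<And>F. F \<in> C \<Longrightarrow> Q F \<and> F \<noteq> bot" for C
    unfolding Q
  proof (intro allI Inf_greatest)
    fix s F assume "F \<in> C"
    then have "filtermap ((@) s) (Inf C) \<le> filtermap ((@) s) F"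
      by (intro filtermap_mono Inf_lower)
    also have "\<dots> \<le> F" using that[OF \<open>F \<in> C\<close>] by (simp add: Q)
    finally show "filtermap ((@) s) (Inf C) \<le> F" .
  qed
  moreover have "Q top" by (simp add: Q_def eventually_top)
  moreover have top_nonbot: "(top :: 'a list filter) \<noteq> bot"
    by (simp add: trivial_limit_def eventually_top)
  ultimately obtain F where "F \<noteq> bot" "Q F"
    and min': "\<And>G. G \<le> F \<Longrightarrow> G \<noteq> bot \<Longrightarrow> Q G \<Longrightarrow> G = F"
    using minimal_filter_exists[of Q top] top_nonbot by blast
  then have F: "left_ideal F" and min: "\<And>G. G \<le> F \<Longrightarrow> left_ideal G \<Longrightarrow> G = F"
    by (auto simp: left_ideal_def Q_def)
  \<comment> \<open>\<open>F \<odot> p\<close> is a left ideal inside the minimal one; once it is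
    all of \<open>F\<close>, \<open>below_fmul\<close> solves
    \<open>z \<odot> p = r\<close>.\<close>
  have "F \<odot> p = F" if "ultra p" "p \<le> F" for p
  proof (rule min)
    show "F \<odot> p \<le> F" using F that left_ideal_fmul_le by auto
    show "left_ideal (F \<odot> p)"
      using F that ultra_nonbot
      by (fastforce simp: left_ideal_def eventually_fmul)
  qed
  then show thesis
    using that[OF F] below_fmul by metis
qed

text \<open>For an idempotent \<open>e\<close> of a minimal left ideal, \<open>x \<odot> e\<close>
  lies in that ideal, so some \<open>z\<close> satisfies \<open>z \<odot> (x \<odot> e) = e\<close>.
  This cancels the inner factors in the square of \<open>x \<odot> e \<odot> z\<close>.\<close>

lemma right_factor_idempotent:
  fixes x :: "'a list filter"
  assumes "ultra x"
  obtains Z where "ultra Z" "x \<odot> Z \<odot> (x \<odot> Z) = x \<odot> Z"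
proof -
  obtain F :: "'a list filter" where F: "left_ideal F"
    and trans: "\<And>p r. ultra p \<Longrightarrow> ultra r \<Longrightarrow> p \<le> F \<Longrightarrow> r \<le> F \<Longrightarrow> \<exists>z. ultra z \<and> z \<le> F \<and> z \<odot> p = r"
    using minimal_left_ideal by blast
  obtain e where e: "ultra e" "e \<le> F" "e \<odot> e = e"
    using Ellis[of F] F left_ideal_fmul_le by (metis left_ideal_def)
  obtain z where z: "ultra z" "z \<odot> (x \<odot> e) = e"
    using trans[of "x \<odot> e" e] e F left_ideal_fmul_le ultra_fmul assms by metis
  have "x \<odot> (e \<odot> z) \<odot> (x \<odot> (e \<odot> z)) = x \<odot> e \<odot> (z \<odot> (x \<odot> e)) \<odot> z"
    by (simp add: fmul_assoc)
  also have "\<dots> = x \<odot> (e \<odot> e) \<odot> z" using z by (simp add: fmul_assoc)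
  finally have "x \<odot> (e \<odot> z) \<odot> (x \<odot> (e \<odot> z)) = x \<odot> (e \<odot> z)" using e by (simp add: fmul_assoc)
  then show thesis using that[of "e \<odot> z"] e z ultra_fmul by auto
qed

text \<open>Any idempotent \<open>q\<close> of a minimal left ideal will do. If
  \<open>q \<odot> f = f\<close>, then \<open>f \<odot> q\<close> is idempotent; solving
  \<open>z \<odot> (f \<odot> q) = q\<close> shows that it is a right unit of \<open>q\<close>, so
  \<open>q \<odot> f \<odot> q\<close> equals both \<open>q\<close> and
  \<open>f \<odot> q\<close>.\<close>

lemma minimal_idempotent:
  obtains q :: "'a list filter" where "ultra q" "q \<odot> q = q"
    and "\<And>f. ultra f \<Longrightarrow> f \<odot> f = f \<Longrightarrow> q \<odot> f = f \<Longrightarrow> f \<odot> q = q"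
proof -
  obtain F :: "'a list filter" where F: "left_ideal F"
    and trans: "\<And>p r. ultra p \<Longrightarrow> ultra r \<Longrightarrow> p \<le> F \<Longrightarrow> r \<le> F \<Longrightarrow> \<exists>z. ultra z \<and> z \<le> F \<and> z \<odot> p = r"
    using minimal_left_ideal by blast
  obtain q where q: "ultra q" "q \<le> F" "q \<odot> q = q"
    using Ellis[of F] F left_ideal_fmul_le by (metis left_ideal_def)
  have "f \<odot> q = q" if f: "ultra f" "f \<odot> f = f" "q \<odot> f = f" for f
  proof -
    obtain z where z: "z \<odot> (f \<odot> q) = q"
      using trans[of "f \<odot> q" q] q f F left_ideal_fmul_le ultra_fmul by metis
    have fq: "f \<odot> q \<odot> (f \<odot> q) = f \<odot> q"
      using f by (metis fmul_assoc)
    have "q \<odot> (f \<odot> q) = q"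
      by (metis z fq fmul_assoc)
    then show ?thesis using f by (metis fmul_assoc)
  qed
  with q that show thesis by blast
qed

text \<open>
  The ultrafilter form of the infinite Hales-Jewett theorem for left variable words. In
  \<^typ>\<open>'q option\<close> the value \<^const>\<open>None\<close> is the variable. The ultrafilter \<open>\<mu>\<close> may be chosen freely
  and need not absorb anything.
\<close>

lemma left_variable_ultrafilter:
  obtains q :: "'q list filter" where "ultra q" "q \<odot> q = q"
    and "\<And>\<mu>. ultra \<mu> \<Longrightarrow> \<exists>Z. ultra Z \<and>
      (\<forall>c. q \<odot> \<mu> \<odot> pt [c] \<odot> filtermap (map (case_option c id)) Z \<odot> q = q)"
proof -
  obtain q :: "'q list filter" where q: "ultra q" "q \<odot> q = q"
    and min: "\<And>f. ultra f \<Longrightarrow> f \<odot> f = f \<Longrightarrow> q \<odot> f = f \<Longrightarrow> f \<odot> q = q"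
    using minimal_idempotent by blast
  have "\<exists>Z. ultra Z \<and> (\<forall>c. q \<odot> \<mu> \<odot> pt [c] \<odot> filtermap (map (case_option c id)) Z \<odot> q = q)"
    if \<mu>: "ultra \<mu>" for \<mu>
  proof -
    \<comment> \<open>The beginning of a left variable word. \<open>Z\<close> completes it to an
      idempotent; substituting a letter for the variable is a homomorphism, so each \<open>f\<close>
      below is idempotent, and as it starts with \<open>q\<close> it satisfies
      \<open>q \<odot> f = f\<close>.\<close>
    define x where "x = filtermap (map Some) q \<odot> filtermap (map Some) \<mu> \<odot> pt [None]"
    have "ultra x" unfolding x_def
      by (intro ultra_fmul ultra_filtermap ultra_principal q \<mu>)
    then obtain Z where Z: "ultra Z" "x \<odot> Z \<odot> (x \<odot> Z) = x \<odot> Z"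
      by (rule right_factor_idempotent)
    have "q \<odot> \<mu> \<odot> pt [c] \<odot> filtermap (map (case_option c id)) Z \<odot> q = q" for c
    proof -
      define f where "f = filtermap (map (case_option c id)) (x \<odot> Z)"
      have f: "f = q \<odot> \<mu> \<odot> pt [c] \<odot> filtermap (map (case_option c id)) Z"
        by (simp add: f_def x_def filtermap_fmul filtermap_filtermap filtermap_ident comp_def
            filtermap_principal)
      have "f \<odot> q = q"
      proof (rule min)
        show "ultra f" unfolding f_def using \<open>ultra x\<close> Z by (intro ultra_filtermap ultra_fmul)
        show "f \<odot> f = f" unfolding f_def by (metis Z(2) filtermap_fmul)
        show "q \<odot> f = f" unfolding f using q by (metis fmul_assoc)
      qed
      then show ?thesis by (simp add: f)
    qed
    with Z show ?thesis by blast
  qed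
  with q that show thesis by blast
qed

section \<open>Words\<close>

text \<open>
  A word is a path in a system of trunks: \<open>Tr False\<close> and \<open>Tr True\<close> go down and up in the current
  trunk, \<open>Ex d\<close> leaves it at a point from which the side cone lies in direction \<open>d\<close>.
\<close>

datatype letter = Tr bool | Ex bool

type_synonym word = "letter list"

fun is_Tr :: "letter \<Rightarrow> bool"
  where "is_Tr (Tr b) = True" | "is_Tr (Ex d) = False"

lemma UNIV_letter: "UNIV = {Tr False, Tr True, Ex False, Ex True}"
proof -
  have "x \<in> {Tr False, Tr True, Ex False, Ex True}" for x by (cases x) auto
  then show ?thesis by blast
qed

instance letter :: finite
  by standard (simp add: UNIV_letter)

text \<open>The order of positions along a trunk: the part below, the exit to the left, the exit to
  the right, the part above. Of two threads at the same level the lexicographically larger one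
  leaves their common segment further up.\<close>

fun letter_rank :: "letter \<Rightarrow> nat"
  where "letter_rank (Tr b) = (if b then 3 else 0)" | "letter_rank (Ex d) = (if d then 2 else 1)"

lemma letter_rank_inject: "letter_rank a = letter_rank b \<longleftrightarrow> a = b"
  by (cases a; cases b) auto

instantiation letter :: linorder
begin

definition "a < b \<longleftrightarrow> letter_rank a < letter_rank b" for a b :: letter
definition "a \<le> b \<longleftrightarrow> letter_rank a \<le> letter_rank b" for a b :: letter

instance
  by standard (auto simp: less_letter_def less_eq_letter_def letter_rank_inject)

end

section \<open>A pigeonhole principle for substitutions\<close>

text \<open>
  A block is a word over \<^typ>\<open>('l \<times> bool \<times> letter) option\<close>. Its entry \<open>Some (l, \<tau>, \<sigma>)\<close> moves the trunk
  threads by \<open>l\<close> and the distinguished thread by \<open>Tr \<tau>\<close> or by \<open>\<sigma>\<close>, according to whether the last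
  letter of that thread was in a trunk or an exit; so exits never occur unless an exit was just made.
\<close>

type_synonym 'l blk = "('l \<times> bool \<times> letter) option list"

fun sub :: "'l \<times> letter \<Rightarrow> ('l \<times> bool \<times> letter) option \<Rightarrow> 'l \<times> letter"
  where
    "sub a None = a"
  | "sub a (Some (l, \<tau>, \<sigma>)) = (l, if is_Tr (snd a) then Tr \<tau> else \<sigma>)"

fun walk :: "(nat \<Rightarrow> 'l blk) \<Rightarrow> nat \<Rightarrow> ('l \<times> letter) list \<Rightarrow> ('l \<times> letter) list"
  where
    "walk Y n [] = []"
  | "walk Y n (a # as) = a # map (sub a) (Y n) @ walk Y (Suc n) as"

lemma walk_snoc: "walk Y n (as @ [a]) = walk Y n as @ a # map (sub a) (Y (n + length as))"
  by (induction as arbitrary: n) auto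

text \<open>One idempotent \<open>q\<close> over triples is read in two ways: \<open>p1\<close>
  keeps the trunk letter, \<open>p2\<close> the unrestricted one. As \<open>\<delta>\<close> makes
  the two readings agree, \<open>\<mu>\<close> contributes the trunk reading \<open>m\<close> to
  both. Then \<open>m\<close> absorbs trunk letters with their padding, and
  \<open>w = w2 \<odot> m\<close> absorbs all letters with theirs.\<close>

lemma walk_ultrafilters:
  obtains w :: "('l \<times> letter) list filter" and Y :: "'l blk filter"
  where "ultra w" "ultra Y"
    and "\<And>a. w \<odot> (pt [a] \<odot> filtermap (map (sub a)) Y) = w"
    and "\<And>a b. is_Tr (snd b) \<or> \<not> is_Tr (snd a) \<Longrightarrow>
      (pt [a] \<odot> filtermap (map (sub a)) Y) \<odot> (pt [b] \<odot> filtermap (map (sub b)) Y) =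
      pt [a] \<odot> filtermap (map (sub a)) Y"
proof -
  obtain q :: "('l \<times> bool \<times> letter) list filter" where q: "ultra q" "q \<odot> q = q"
    and qZ: "\<And>\<mu>. ultra \<mu> \<Longrightarrow> \<exists>Z. ultra Z \<and>
      (\<forall>c. q \<odot> \<mu> \<odot> pt [c] \<odot> filtermap (map (case_option c id)) Z \<odot> q = q)"
    using left_variable_ultrafilter by blast
  define p1 :: "('l \<times> bool \<times> letter) \<Rightarrow> 'l \<times> letter" where "p1 = (\<lambda>(l, \<tau>, \<sigma>). (l, Tr \<tau>))"
  define p2 :: "('l \<times> bool \<times> letter) \<Rightarrow> 'l \<times> letter" where "p2 = (\<lambda>(l, \<tau>, \<sigma>). (l, \<sigma>))"
  define \<delta> :: "('l \<times> bool \<times> letter) \<Rightarrow> ('l \<times> bool \<times> letter)" where "\<delta> = (\<lambda>(l, \<tau>, \<sigma>). (l, \<tau>, Tr \<tau>))"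
  define m where "m = filtermap (map p1) q"
  define w2 where "w2 = filtermap (map p2) q"
  define \<mu> where "\<mu> = filtermap (map \<delta>) q"
  have "p1 \<circ> \<delta> = p1" "p2 \<circ> \<delta> = p1" by (auto simp: p1_def p2_def \<delta>_def)
  then have \<mu>: "filtermap (map p1) \<mu> = m" "filtermap (map p2) \<mu> = m"
    by (simp_all add: \<mu>_def m_def filtermap_filtermap)
  have mm: "m \<odot> m = m" by (metis m_def q(2) filtermap_fmul)
  obtain Z where Z: "ultra Z"
    and R: "\<And>c. q \<odot> \<mu> \<odot> pt [c] \<odot> filtermap (map (case_option c id)) Z \<odot> q = q"
    using qZ[of \<mu>] q by (auto simp: \<mu>_def ultra_filtermap)
  \<comment> \<open>The appended part makes padding end in \<open>m\<close> after a trunk letter and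
    in \<open>w\<close> after an exit. Hence the latter absorbs everything, the former only trunk
    letters with their padding.\<close>
  define Y where "Y = Z \<odot> filtermap (map Some) (q \<odot> \<mu>)"
  define w where "w = w2 \<odot> m"
  define h where "h a = filtermap (map (sub a)) Z" for a
  have subT: "sub a = p1 \<circ> case_option (fst a, \<tau>, \<sigma>) id" if "snd a = Tr \<tau>" for a :: "'l \<times> letter" and \<tau> \<sigma>
    using that by (cases a) (auto simp: fun_eq_iff p1_def split: option.splits)
  have subX: "sub a = p2 \<circ> case_option (fst a, \<tau>, snd a) id" if "\<not> is_Tr (snd a)" for a :: "'l \<times> letter" and \<tau>
    using that by (cases a) (auto simp: fun_eq_iff p2_def split: option.splits)
  have YT: "filtermap (map (sub a)) Y = h a \<odot> m" if "is_Tr (snd a)" for a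
  proof -
    obtain \<tau> where "snd a = Tr \<tau>" using \<open>is_Tr (snd a)\<close> by (cases "snd a") auto
    then have "sub a \<circ> Some = p1" by (auto simp: fun_eq_iff p1_def)

    then have "filtermap (map (sub a)) (filtermap (map Some) (q \<odot> \<mu>)) = filtermap (map p1) (q \<odot> \<mu>)"
      by (simp add: filtermap_filtermap)
    then show ?thesis by (simp add: Y_def h_def filtermap_fmul \<mu> mm flip: m_def)
  qed
  have YX: "filtermap (map (sub a)) Y = h a \<odot> w" if "\<not> is_Tr (snd a)" for a
  proof -
    have "sub a \<circ> Some = p2" using that by (auto simp: fun_eq_iff p2_def)
    then have "filtermap (map (sub a)) (filtermap (map Some) (q \<odot> \<mu>)) = filtermap (map p2) (q \<odot> \<mu>)"
      by (simp add: filtermap_filtermap)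
    then show ?thesis by (simp add: Y_def h_def w_def filtermap_fmul \<mu> flip: w2_def)
  qed
  have RT: "m \<odot> (pt [a] \<odot> (h a \<odot> m)) = m" if "is_Tr (snd a)" for a
  proof -
    obtain \<tau> where \<tau>: "snd a = Tr \<tau>" using \<open>is_Tr (snd a)\<close> by (cases "snd a") auto
    define c where "c = (fst a, \<tau>, Tr \<tau>)"
    have "p1 c = a" using \<tau> by (cases a) (auto simp: c_def p1_def)
    moreover have "sub a = p1 \<circ> case_option c id" using subT[OF \<tau>] by (simp add: c_def)
    then have "filtermap (map p1) (filtermap (map (case_option c id)) Z) = h a"
      by (simp add: h_def filtermap_filtermap)
    ultimately show ?thesis
      using arg_cong[OF R[of c], of "filtermap (map p1)"]
      by (simp add: filtermap_fmul filtermap_principal \<mu> mm fmul_assoc flip: m_def)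
        (metis mm fmul_assoc)
  qed
  \<comment> \<open>Here the free choice of \<open>\<mu>\<close> pays: it places \<open>m\<close>
    behind \<open>w2\<close>, so that \<open>w\<close> and not merely \<open>w2\<close> stands
    before the letter.\<close>
  have RX: "w \<odot> (pt [a] \<odot> (h a \<odot> w2)) = w2" if "\<not> is_Tr (snd a)" for a
  proof -
    define c where "c = (fst a, False, snd a)"
    have "p2 c = a" by (cases a) (auto simp: c_def p2_def)
    moreover have "sub a = p2 \<circ> case_option c id" using subX[OF that] by (simp add: c_def)
    then have "filtermap (map p2) (filtermap (map (case_option c id)) Z) = h a"
      by (simp add: h_def filtermap_filtermap)
    ultimately show ?thesis
      using arg_cong[OF R[of c], of "filtermap (map p2)"]
      by (simp add: filtermap_fmul filtermap_principal \<mu> w_def fmul_assoc flip: w2_def)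
  qed
  have wY: "w \<odot> (pt [a] \<odot> filtermap (map (sub a)) Y) = w" for a
  proof (cases "is_Tr (snd a)")
    case True
    then show ?thesis using RT[OF True] by (simp add: YT w_def fmul_assoc)
  next
    case False
    then show ?thesis using RX[OF False] by (simp add: YX) (metis w_def fmul_assoc)
  qed
  show thesis
  proof (rule that[of w Y])
    show "ultra w" "ultra Y" unfolding w_def Y_def m_def w2_def \<mu>_def
      by (intro ultra_fmul ultra_filtermap q Z)+
    show "w \<odot> (pt [a] \<odot> filtermap (map (sub a)) Y) = w" for a by (rule wY)
    show "(pt [a] \<odot> filtermap (map (sub a)) Y) \<odot> (pt [b] \<odot> filtermap (map (sub b)) Y) =
      pt [a] \<odot> filtermap (map (sub a)) Y" if "is_Tr (snd b) \<or> \<not> is_Tr (snd a)" for a b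
    proof (cases "is_Tr (snd a)")
      case True
      then show ?thesis using that RT[of b] by (simp add: YT fmul_assoc)
    next
      case False
      then show ?thesis using wY[of b] by (simp add: YX fmul_assoc)
    qed
  qed
qed

lemma walk_pigeonhole:
  fixes \<kappa> :: "('l \<times> letter) list \<Rightarrow> 'c" and A :: "('l \<times> letter) set"
  assumes "finite A" "finite (range \<kappa>)"
  shows "\<exists>w0 Y k. \<forall>as. set as \<subseteq> A \<longrightarrow> \<kappa> (w0 @ walk Y 0 as) = k"
proof -
  obtain w :: "('l \<times> letter) list filter" and Y :: "'l blk filter"
    where wY: "ultra w" "ultra Y"
      and w\<theta>: "\<And>a. w \<odot> (pt [a] \<odot> filtermap (map (sub a)) Y) = w"
      and \<theta>\<theta>: "\<And>a b. is_Tr (snd b) \<or> \<not> is_Tr (snd a) \<Longrightarrow>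
        (pt [a] \<odot> filtermap (map (sub a)) Y) \<odot> (pt [b] \<odot> filtermap (map (sub b)) Y) =
        pt [a] \<odot> filtermap (map (sub a)) Y"
    using walk_ultrafilters by blast
  define \<theta> where "\<theta> a = pt [a] \<odot> filtermap (map (sub a)) Y" for a
  \<comment> \<open>Two factors suffice for closure under left multiplication by
    \<open>\<theta> a\<close>: \<open>\<theta> a \<odot> \<theta> b\<close> can differ from
    \<open>\<theta> a\<close> only if \<open>b\<close> is an exit, and then
    \<open>\<theta> b\<close> absorbs its successor.\<close>
  define \<Omega> where "\<Omega> = insert (pt []) (\<theta> ` A \<union> (\<lambda>(a, b). \<theta> a \<odot> \<theta> b) ` (A \<times> A))"
  have ev\<theta>: "eventually P (\<theta> a) \<longleftrightarrow> (\<forall>\<^sub>F y in Y. P (a # map (sub a) y))" for P a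
    by (simp add: \<theta>_def eventually_fmul eventually_filtermap eventually_principal)
  have fin\<Omega>: "finite \<Omega>" using assms(1) by (simp add: \<Omega>_def)
  have w\<Omega>: "w \<odot> \<omega> = w" if "\<omega> \<in> \<Omega>" for \<omega>
    using that w\<theta> by (auto simp: \<Omega>_def \<theta>_def simp flip: fmul_assoc)
  have \<theta>\<Omega>: "\<theta> a \<odot> \<omega> \<in> \<Omega>" if a: "a \<in> A" and "\<omega> \<in> \<Omega>" for a \<omega>
  proof -
    consider "\<omega> = pt []" | b where "b \<in> A" "\<omega> = \<theta> b" | b c where "b \<in> A" "c \<in> A" "\<omega> = \<theta> b \<odot> \<theta> c"
      using \<open>\<omega> \<in> \<Omega>\<close> by (auto simp: \<Omega>_def)
    then show ?thesis
    proof cases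
      case (3 b c)
      have "\<theta> a \<odot> \<theta> b = \<theta> a \<or> \<theta> b \<odot> \<theta> c = \<theta> b"
        using \<theta>\<theta>[of b a] \<theta>\<theta>[of c b] by (auto simp: \<theta>_def)
      then have "\<theta> a \<odot> \<omega> = \<theta> a \<odot> \<theta> c \<or> \<theta> a \<odot> \<omega> = \<theta> a \<odot> \<theta> b"
        using 3 by (metis fmul_assoc)
      then show ?thesis using 3 a by (auto simp: \<Omega>_def)
    qed (use a in \<open>auto simp: \<Omega>_def\<close>)
  qed
  have "\<exists>k. \<forall>\<^sub>F z in w. \<kappa> z = k"
  proof (rule ccontr)
    assume "\<not> ?thesis"
    then have "\<forall>\<^sub>F z in w. \<forall>k\<in>range \<kappa>. \<kappa> z \<noteq> k"
      using assms(2) wY(1) by (subst eventually_ball_finite_distrib) (auto simp: ultra_not)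
    then have "\<forall>\<^sub>F z in w. False" by (rule eventually_mono) auto
    then show False using ultra_nonbot[OF wY(1)] by (simp add: eventually_False)
  qed
  then obtain k where k: "\<forall>\<^sub>F z in w. \<kappa> z = k" by blast
  \<comment> \<open>Besides having colour \<open>k\<close> itself, the word has to stay promising
    for all continuations in \<open>\<Omega>\<close>. As \<open>\<theta> a \<odot> \<omega>\<close>
    is again in \<open>\<Omega>\<close>, this survives appending \<open>a\<close> with a generic
    block.\<close>
  define good where "good z \<longleftrightarrow> (\<forall>\<omega>\<in>\<Omega>. \<forall>\<^sub>F t in \<omega>. \<kappa> (z @ t) = k)" for z
  have good_\<kappa>: "\<kappa> z = k" if "good z" for z
    using that by (auto simp: good_def \<Omega>_def eventually_principal)
  have "\<forall>\<^sub>F z in w. good z"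
    unfolding good_def
  proof (rule eventually_ball_finite[OF fin\<Omega>], rule ballI)
    fix \<omega> assume "\<omega> \<in> \<Omega>"
    then have "eventually (\<lambda>z. \<kappa> z = k) (w \<odot> \<omega>)" using k w\<Omega>[of \<omega>] by simp
    then show "\<forall>\<^sub>F z in w. \<forall>\<^sub>F t in \<omega>. \<kappa> (z @ t) = k" by (simp only: eventually_fmul)
  qed
  then obtain w0 where w0: "good w0"
    using eventually_happens'[OF ultra_nonbot[OF wY(1)]] by blast
  have step: "\<exists>y. \<forall>z\<in>F. \<forall>a\<in>A. good (z @ a # map (sub a) y)"
    if F: "finite F" "\<forall>z\<in>F. good z" for F
  proof -
    have "\<forall>\<^sub>F y in Y. \<forall>z\<in>F. \<forall>a\<in>A. good (z @ a # map (sub a) y)"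
      unfolding good_def
    proof (intro eventually_ball_finite ballI F(1) assms(1) fin\<Omega>)
      fix z a \<omega> assume *: "z \<in> F" "a \<in> A" "\<omega> \<in> \<Omega>"
      then have "\<forall>\<^sub>F t in \<theta> a \<odot> \<omega>. \<kappa> (z @ t) = k"
        using F \<theta>\<Omega> by (auto simp: good_def)
      then show "\<forall>\<^sub>F y in Y. \<forall>\<^sub>F t in \<omega>. \<kappa> ((z @ a # map (sub a) y) @ t) = k"
        by (simp add: eventually_fmul ev\<theta>)
    qed
    then show ?thesis
      using eventually_happens'[OF ultra_nonbot[OF wY(2)]] by blast
  qed
  \<comment> \<open>One block must serve all words reached so far and all next letters at once;
    there are only finitely many of both.\<close>
  define nxt where "nxt F = (SOME y. \<forall>z\<in>F. \<forall>a\<in>A. good (z @ a # map (sub a) y))" for F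
  define Fs where "Fs = rec_nat {w0} (\<lambda>n F. (\<lambda>(z, a). z @ a # map (sub a) (nxt F)) ` (F \<times> A))"
  have Fs: "finite (Fs n) \<and> (\<forall>z\<in>Fs n. good z)" for n
  proof (induction n)
    case 0
    then show ?case using w0 by (simp add: Fs_def)
  next
    case (Suc n)
    then have "\<forall>z\<in>Fs n. \<forall>a\<in>A. good (z @ a # map (sub a) (nxt (Fs n)))"
      unfolding nxt_def by (intro someI_ex[of "\<lambda>y. \<forall>z\<in>Fs n. \<forall>a\<in>A. good (z @ a # map (sub a) y)"] step) auto
    then show ?case using Suc assms(1) by (auto simp: Fs_def)
  qed
  define Ys where "Ys n = nxt (Fs n)" for n
  have Fs_rec: "Fs 0 = {w0}" "Fs (Suc n) = (\<lambda>(z, a). z @ a # map (sub a) (Ys n)) ` (Fs n \<times> A)" for n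
    by (simp_all add: Fs_def Ys_def)
  have "w0 @ walk Ys 0 as \<in> Fs (length as)" if "set as \<subseteq> A" for as
    using that
  proof (induction as rule: rev_induct)
    case (snoc a as)
    then have "((w0 @ walk Ys 0 as), a) \<in> Fs (length as) \<times> A" by auto
    from imageI[OF this, of "\<lambda>(z, a). z @ a # map (sub a) (Ys (length as))"]
    show ?case by (simp add: Fs_rec walk_snoc)
  qed (simp add: Fs_rec)
  with Fs good_\<kappa> have "\<kappa> (w0 @ walk Ys 0 as) = k" if "set as \<subseteq> A" for as
    using that by blast
  then show ?thesis by blast
qed

section \<open>Embeddings of the tree of words\<close>

text \<open>Padding whose length depends on the level only keeps threads at equal levels; trunk
  padding after trunk letters keeps points inside their trunk. Padding after an exit and the image
  of the empty word are unrestricted.\<close>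

definition good :: "(word \<Rightarrow> word) \<Rightarrow> bool"
  where "good f \<longleftrightarrow> (\<exists>e l. \<forall>t a. f (t @ [a]) = f t @ a # e t a \<and>
    length (e t a) = l (length t) \<and> (is_Tr a \<longrightarrow> list_all is_Tr (e t a)))"

lemma goodI:
  assumes "\<And>t a. f (t @ [a]) = f t @ a # e t a" "\<And>t a. length (e t a) = l (length t)"
    "\<And>t a. is_Tr a \<Longrightarrow> list_all is_Tr (e t a)"
  shows "good f"
  unfolding good_def using assms by blast

lemma good_snocE:
  assumes "good f"
  obtains e where "f (t @ [a]) = f t @ a # e" "is_Tr a \<longrightarrow> list_all is_Tr e"
  using assms unfolding good_def by blast

lemma good_append:
  assumes "good f"
  obtains z where "f (t @ a # y) = f t @ a # z"
    "list_all is_Tr (a # y) \<longrightarrow> list_all is_Tr z"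
proof -
  have "\<exists>z. f (t @ a # y) = f t @ a # z \<and> (list_all is_Tr (a # y) \<longrightarrow> list_all is_Tr z)"
  proof (induction y rule: rev_induct)
    case Nil
    show ?case using good_snocE[OF assms, of t a] by auto
  next
    case (snoc b y)
    then obtain z where z: "f (t @ a # y) = f t @ a # z" "list_all is_Tr (a # y) \<longrightarrow> list_all is_Tr z"
      by blast
    obtain e where "f ((t @ a # y) @ [b]) = f (t @ a # y) @ b # e" "is_Tr b \<longrightarrow> list_all is_Tr e"
      using good_snocE[OF assms] by blast
    with z show ?case by auto
  qed
  with that show thesis by blast
qed

lemma good_length:
  assumes "good f" "length s = length t"
  shows "length (f s) = length (f t)"
proof -
  obtain e l where "\<And>t a. f (t @ [a]) = f t @ a # e t a" "\<And>t a. length (e t a) = l (length t)"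
    using assms(1) unfolding good_def by blast
  then show ?thesis using assms(2)
  proof (induction s arbitrary: t rule: rev_induct)
    case (snoc a s)
    then obtain b t' where "t = t' @ [b]" "length s = length t'"
      by (cases t rule: rev_cases) auto
    then show ?case using snoc by auto
  qed simp
qed

lemma good_id: "good id"
  by (rule goodI[where e = "\<lambda>_ _. []" and l = "\<lambda>_. 0"]) auto

lemma good_comp:
  assumes f: "good f" and g: "good g"
  shows "good (f \<circ> g)"
proof -
  obtain e l where e: "\<And>t a. g (t @ [a]) = g t @ a # e t a"
    "\<And>t a. length (e t a) = l (length t)" "\<And>t a. is_Tr a \<Longrightarrow> list_all is_Tr (e t a)"
    using g unfolding good_def by blast
  have "\<exists>z. f (g t @ a # e t a) = f (g t) @ a # z \<and> (is_Tr a \<longrightarrow> list_all is_Tr z)" for t a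
    by (rule good_append[OF f, of "g t" a "e t a"]) (use e(3) in auto)
  then obtain z where z: "\<And>t a. f (g t @ a # e t a) = f (g t) @ a # z t a"
    "\<And>t a. is_Tr a \<Longrightarrow> list_all is_Tr (z t a)" by metis
  have len: "length (z t a) = length (z t' a')" if "length t = length t'" for t t' a a'
  proof -
    have "length (g t @ a # e t a) = length (g t' @ a' # e t' a')"
      using e(2) that good_length[OF g that] by simp
    then have "length (f (g t) @ a # z t a) = length (f (g t') @ a' # z t' a')"
      using good_length[OF f] z(1) by metis
    moreover have "length (f (g t)) = length (f (g t'))"
      using good_length[OF f good_length[OF g that]] .
    ultimately show ?thesis by simp
  qed
  show ?thesis
  proof (rule goodI[where e = z and l = "\<lambda>n. length (z (replicate n (Tr False)) (Tr False))"])
    show "length (z t a) = length (z (replicate (length t) (Tr False)) (Tr False))" for t a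
      by (rule len) simp
  qed (auto simp: e z)
qed

text \<open>A nonempty word stands for a point, which is determined by where and how its last letter is read.\<close>

definition point_map :: "(word \<Rightarrow> word) \<Rightarrow> word \<Rightarrow> word"
  where "point_map f p = f (butlast p) @ [last p]"

lemma point_map_comp: "point_map (f \<circ> g) p = point_map f (point_map g p)"
  by (simp add: point_map_def)

section \<open>The step theorem\<close>

definition threads_ok :: "nat \<Rightarrow> word set \<Rightarrow> bool"
  where "threads_ok i U \<longleftrightarrow> U \<subseteq> {u. length u = i} \<and> (\<forall>u\<in>U. u \<noteq> Max U \<longrightarrow> u \<noteq> [] \<and> is_Tr (last u))"

text \<open>The threads whose padding may contain exits: the top one, directly after an exit or
  before its first letter. Behind a trunk letter a good map inserts trunk letters only.\<close>

definition free :: "word set \<Rightarrow> word \<Rightarrow> bool"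
  where "free U u \<longleftrightarrow> u = Max U \<and> (u = [] \<or> \<not> is_Tr (last u))"

definition valid :: "word set \<Rightarrow> (word \<Rightarrow> word) \<Rightarrow> nat \<Rightarrow> bool"
  where "valid U y m \<longleftrightarrow> (\<forall>u\<in>U. length (y u) = m \<and> (list_all is_Tr (y u) \<or> free U u))"

lemma finite_words: "finite {u :: word. length u = n}"
  using finite_lists_length_eq[of "UNIV :: letter set" n] by simp

lemma threads_ok_finite: "threads_ok i U \<Longrightarrow> finite U"
  using finite_subset finite_words unfolding threads_ok_def by metis

subsection \<open>One set of threads\<close>

text \<open>The counterpart of \<open>sub\<close> for a single thread \<open>u\<close>. The trunk
  moves of all threads are packed into one function \<open>l\<close>, of which \<open>u\<close> sees
  only \<open>l u\<close>; a free thread reads \<open>\<tau>\<close> and \<open>\<sigma>\<close>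
  instead. Because of this locality (\<open>thread_proj_sub\<close>) a map defined on single words
  moves all threads in parallel.\<close>

fun read_letter :: "bool \<Rightarrow> word \<Rightarrow> letter \<Rightarrow> ((word \<Rightarrow> bool) \<times> bool \<times> letter) option \<Rightarrow> letter"
  where
    "read_letter fr u a None = a"
  | "read_letter fr u a (Some (l, \<tau>, \<sigma>)) = (if fr then if is_Tr a then Tr \<tau> else \<sigma> else Tr (l u))"

fun thread_proj :: "bool \<Rightarrow> word \<Rightarrow> (word \<Rightarrow> bool) \<times> letter \<Rightarrow> letter"
  where "thread_proj fr u (l, \<sigma>) = (if fr then \<sigma> else Tr (l u))"

fun read_walk :: "bool \<Rightarrow> word \<Rightarrow> (nat \<Rightarrow> (word \<Rightarrow> bool) blk) \<Rightarrow> nat \<Rightarrow> word \<Rightarrow> word"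
  where
    "read_walk fr u Y n [] = []"
  | "read_walk fr u Y n (a # y) = a # map (read_letter fr u a) (Y n) @ read_walk fr u Y (Suc n) y"

lemma read_walk_snoc: "read_walk fr u Y n (y @ [a]) = read_walk fr u Y n y @ a # map (read_letter fr u a) (Y (n + length y))"
  by (induction y arbitrary: n) auto

lemma thread_proj_sub: "thread_proj fr u (sub a b) = read_letter fr u (thread_proj fr u a) b"
  by (cases a; cases b) auto

lemma read_walk_thread_proj: "read_walk fr u Y n (map (thread_proj fr u) as) = map (thread_proj fr u) (walk Y n as)"
  by (induction as arbitrary: n) (auto simp: thread_proj_sub)

lemma read_letter_Tr: "is_Tr a \<Longrightarrow> is_Tr (read_letter fr u a b)"
  by (cases b) auto

lemma one_thread_set:
  fixes c :: "word set \<Rightarrow> 'c"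
  assumes U: "threads_ok i U" and fin: "finite (range c)"
  obtains h where "good h" "\<And>t. length t < i \<Longrightarrow> h t = t"
    "\<And>y m. valid U y m \<Longrightarrow> c (h ` (\<lambda>u. u @ y u) ` U) = c (h ` U)"
proof -
  have lenU: "length u = i" if "u \<in> U" for u using U that by (auto simp: threads_ok_def)
  define fr where "fr u \<longleftrightarrow> u \<in> U \<and> free U u" for u
  define \<kappa> where "\<kappa> z = c ((\<lambda>u. u @ map (thread_proj (fr u) u) z) ` U)" for z
  \<comment> \<open>Fixing \<open>l\<close> to \<open>False\<close> off \<open>U\<close> leaves
    finitely many joint moves.\<close>
  define A where "A = {l :: word \<Rightarrow> bool. \<forall>u. u \<notin> U \<longrightarrow> \<not> l u} \<times> (UNIV :: letter set)"
  have "{l :: word \<Rightarrow> bool. \<forall>u. u \<notin> U \<longrightarrow> \<not> l u} = {l. \<forall>u. (u \<in> U \<longrightarrow> l u \<in> UNIV) \<and> (u \<notin> U \<longrightarrow> l u = False)}"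
    by auto
  then have "finite {l :: word \<Rightarrow> bool. \<forall>u. u \<notin> U \<longrightarrow> \<not> l u}"
    using finite_set_of_finite_funs[OF threads_ok_finite[OF U], of "UNIV :: bool set" False] by simp
  then have "finite A" by (simp add: A_def)
  moreover have "finite (range \<kappa>)" by (rule finite_subset[OF _ fin]) (auto simp: \<kappa>_def)
  ultimately obtain w0 Y k where k: "\<And>as. set as \<subseteq> A \<Longrightarrow> \<kappa> (w0 @ walk Y 0 as) = k"
    using walk_pigeonhole by blast
  define ww where "ww u = map (thread_proj (fr u) u) w0" for u
  \<comment> \<open>Below level \<open>i\<close> nothing changes, which makes fusion possible. At
    level \<open>i\<close> the projection of \<open>w0\<close> becomes padding; from there on every
    letter is followed by its own reading of the current block.\<close>
  define h where "h t = (if length t < i then t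
    else take i t @ ww (take i t) @ read_walk (fr (take i t)) (take i t) Y 0 (drop i t))" for t
  have h_root: "h (u @ y) = u @ ww u @ read_walk (fr u) u Y 0 y" if "length u = i" for u y
    using that by (simp add: h_def)
  have hU: "c (h ` (\<lambda>u. u @ y u) ` U) = k" if v: "valid U y m" for y m
  proof -
    \<comment> \<open>The extensions of all threads, read in parallel, are one word over
      \<open>A\<close>. \<open>Tr False\<close> is a dummy in case no thread is free.\<close>
    define as where "as = map (\<lambda>n. (\<lambda>u. u \<in> U \<and> y u ! n = Tr True,
      if fr (Max U) then y (Max U) ! n else Tr False)) [0..<m]"
    have as: "map (thread_proj (fr u) u) as = y u" if u: "u \<in> U" for u
    proof (rule nth_equalityI)
      show "length (map (thread_proj (fr u) u) as) = length (y u)"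
        using v u by (auto simp: as_def valid_def)
      fix n assume "n < length (map (thread_proj (fr u) u) as)"
      then have n: "n < m" by (simp add: as_def)
      show "map (thread_proj (fr u) u) as ! n = y u ! n"
      proof (cases "fr u")
        case True
        then have "u = Max U" by (simp add: fr_def free_def)
        with n True show ?thesis by (simp add: as_def)
      next
        case False
        with v u have "length (y u) = m" "list_all is_Tr (y u)" by (auto simp: valid_def fr_def)
        with n have "is_Tr (y u ! n)" by (simp add: list_all_length)
        then obtain b where "y u ! n = Tr b" by (cases "y u ! n") auto
        with n False u show ?thesis by (simp add: as_def)
      qed
    qed
    have "set as \<subseteq> A" by (auto simp: as_def A_def)
    then have "\<kappa> (w0 @ walk Y 0 as) = k" by (rule k)
    moreover have "h (u @ y u) = u @ map (thread_proj (fr u) u) (w0 @ walk Y 0 as)" if u: "u \<in> U" for u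
      by (simp add: h_root[OF lenU[OF u]] ww_def as[OF u] flip: read_walk_thread_proj)
    then have "h ` (\<lambda>u. u @ y u) ` U = (\<lambda>u. u @ map (thread_proj (fr u) u) (w0 @ walk Y 0 as)) ` U"
      by (simp add: image_image)
    ultimately show ?thesis by (simp add: \<kappa>_def)
  qed
  show thesis
  proof (rule that)
    have "valid U (\<lambda>_. []) 0" by (simp add: valid_def)
    from hU[OF this] show "c (h ` (\<lambda>u. u @ y u) ` U) = c (h ` U)" if "valid U y m" for y m
      using hU[OF that] by simp
    show "h t = t" if "length t < i" for t using that by (simp add: h_def)
    define e where "e t a = (if Suc (length t) < i then []
      else if Suc (length t) = i then ww (t @ [a])
      else map (read_letter (fr (take i t)) (take i t) a) (Y (length t - i)))" for t a
    define l where "l n = (if Suc n < i then 0 else if Suc n = i then length w0 else length (Y (n - i)))" for n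
    show "good h"
    proof (rule goodI[where e = e and l = l])
      show "h (t @ [a]) = h t @ a # e t a" for t a
        by (auto simp: h_def e_def read_walk_snoc)
      show "length (e t a) = l (length t)" for t a
        by (auto simp: e_def l_def ww_def)
      show "list_all is_Tr (e t a)" if "is_Tr a" for t a
      proof -
        \<comment> \<open>A thread that arrives at level \<open>i\<close> by a trunk letter is not
          free, so its projection of \<open>w0\<close> consists of trunk letters.\<close>
        have "\<not> fr (t @ [a])" using that by (auto simp: fr_def free_def)
        then show ?thesis using that read_letter_Tr
          by (auto simp: e_def ww_def list_all_iff split: if_splits)
      qed
    qed
  qed
qed

subsection \<open>Fusion\<close>

text \<open>Since \<open>h\<close> fixes the words shorter than \<open>i\<close>, it keeps each
  thread of \<open>U\<close> and pads behind it, with exits only behind a free one. Hence stability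
  survives composition with \<open>h\<close>.\<close>

lemma good_valid:
  assumes U: "threads_ok i U" and h: "good h" and fix_h: "\<And>t. length t < i \<Longrightarrow> h t = t"
    and v: "valid U y m"
  obtains y' m' where "valid U y' m'" "h ` (\<lambda>u. u @ y u) ` U = (\<lambda>u. u @ y' u) ` U"
proof -
  have "\<exists>z. h (u @ y u) = u @ z \<and> (list_all is_Tr z \<or> free U u)" if u: "u \<in> U" for u
  proof -
    have len: "length u = i" using U u by (auto simp: threads_ok_def)
    have "\<exists>z. h u = u @ z \<and> (list_all is_Tr z \<or> free U u)"
    proof (cases u rule: rev_cases)
      case Nil
      with U u have "free U u" by (auto simp: threads_ok_def free_def)
      then show ?thesis using Nil by simp
    next
      case (snoc t a)
      with len fix_h have "h t = t" by simp
      with good_snocE[OF h, of t a] obtain e where "h u = u @ e" "is_Tr a \<longrightarrow> list_all is_Tr e"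
        unfolding snoc by (metis append.assoc append_Cons append_Nil)
      moreover have "is_Tr a \<or> free U u" using U u snoc by (auto simp: threads_ok_def free_def)
      ultimately show ?thesis by auto
    qed
    then obtain z where z: "h u = u @ z" "list_all is_Tr z \<or> free U u" by blast
    show ?thesis
    proof (cases "y u")
      case (Cons a y')
      obtain z' where "h (u @ a # y') = h u @ a # z'" "list_all is_Tr (a # y') \<longrightarrow> list_all is_Tr z'"
        by (rule good_append[OF h])
      then show ?thesis using Cons z v u by (auto simp: valid_def)
    qed (use z in simp)
  qed
  then obtain z where z: "\<And>u. u \<in> U \<Longrightarrow> h (u @ y u) = u @ z u"
    "\<And>u. u \<in> U \<Longrightarrow> list_all is_Tr (z u) \<or> free U u" by metis
  have "length (z u) = length (z u')" if "u \<in> U" "u' \<in> U" for u u'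
  proof -
    have *: "length u = length u'" using U that by (auto simp: threads_ok_def)
    then have "length (u @ y u) = length (u' @ y u')" using v that by (simp add: valid_def)
    from good_length[OF h this] show ?thesis using z(1)[OF that(1)] z(1)[OF that(2)] * by simp
  qed
  then obtain m' where "\<And>u. u \<in> U \<Longrightarrow> length (z u) = m'" by metis
  then show thesis using z by (intro that[of z m']) (auto simp: valid_def image_image)
qed

text \<open>The two arguments of \<open>c\<close> are transported differently: \<open>V\<close>
  holds finished points, whose last letter gets no padding, whereas \<open>U\<close> holds prefixes
  that are still to be continued.\<close>

definition stable_above :: "(word set \<Rightarrow> word set \<Rightarrow> 'c) \<Rightarrow> (word \<Rightarrow> word) \<Rightarrow> word set \<Rightarrow> word set \<Rightarrow> bool"
  where "stable_above c g V U \<longleftrightarrow> (\<forall>y m. valid U y m \<longrightarrow>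
    c (point_map g ` V) (g ` (\<lambda>u. u @ y u) ` U) = c (point_map g ` V) (g ` U))"

definition params_ok :: "nat \<Rightarrow> word set \<Rightarrow> bool"
  where "params_ok i V \<longleftrightarrow> V \<subseteq> {p. p \<noteq> [] \<and> length p \<le> i}"

text \<open>\<open>point_map\<close> applies the map to \<open>butlast p\<close> only, so points of
  length up to \<open>i\<close> are allowed although the maps agree only below
  \<open>i\<close>.\<close>

lemma point_map_cong_params:
  assumes "params_ok i V" "\<And>t. length t < i \<Longrightarrow> f t = g t"
  shows "point_map f ` V = point_map g ` V"
proof (rule image_cong)
  fix p assume "p \<in> V"
  then have "length (butlast p) < i" using assms(1) by (cases p rule: rev_cases) (auto simp: params_ok_def)
  then show "point_map f p = point_map g p" using assms(2) by (simp add: point_map_def)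
qed simp

lemma stable_comp:
  assumes st: "stable_above c g V U" and V: "params_ok i V" and U: "threads_ok i U"
    and h: "good h" and fix_h: "\<And>t. length t < i \<Longrightarrow> h t = t"
  shows "stable_above c (g \<circ> h) V U"
  unfolding stable_above_def
proof (intro allI impI)
  fix y m assume v: "valid U y m"
  have pm: "point_map (g \<circ> h) ` V = point_map g ` V"
    using V by (rule point_map_cong_params) (simp add: fix_h)
  have *: "c (point_map g ` V) (g ` h ` (\<lambda>u. u @ y u) ` U) = c (point_map g ` V) (g ` U)"
    if "valid U y m" for y m
    using good_valid[OF U h fix_h that] st unfolding stable_above_def by metis
  have "valid U (\<lambda>_. []) 0" by (simp add: valid_def)
  from *[OF this] *[OF v]
  show "c (point_map (g \<circ> h) ` V) ((g \<circ> h) ` (\<lambda>u. u @ y u) ` U) = c (point_map (g \<circ> h) ` V) ((g \<circ> h) ` U)"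
    unfolding pm by (simp add: image_comp comp_def)
qed

text \<open>Only finitely many pairs \<open>(V, U)\<close> belong to level \<open>i\<close>. They
  are made stable one after another, and \<open>stable_comp\<close> protects those already
  treated.\<close>

lemma one_level:
  fixes c :: "word set \<Rightarrow> word set \<Rightarrow> 'c"
  assumes fin: "finite (range (\<lambda>(V, U). c V U))"
  obtains h where "good h" "\<And>t. length t < i \<Longrightarrow> h t = t"
    "\<And>V U. params_ok i V \<Longrightarrow> threads_ok i U \<Longrightarrow> stable_above c (g \<circ> h) V U"
proof -
  define S where "S = {(V, U). params_ok i V \<and> threads_ok i U}"
  have "S \<subseteq> Pow {p. length p \<le> i} \<times> Pow {u. length u = i}"
    by (auto simp: S_def params_ok_def threads_ok_def)
  moreover have "finite {p :: word. length p \<le> i}"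
    using finite_lists_length_le[of "UNIV :: letter set" i] by simp
  ultimately have "finite S"
    using finite_words[of i] by (auto intro: finite_subset)
  have "\<exists>h. good h \<and> (\<forall>t. length t < i \<longrightarrow> h t = t) \<and> (\<forall>(V, U)\<in>R. stable_above c (g \<circ> h) V U)"
    if "finite R" "R \<subseteq> S" for R
    using that
  proof (induction R rule: finite_induct)
    case empty
    show ?case by (intro exI[of _ id] conjI good_id) auto
  next
    case (insert x R)
    obtain V U where x: "x = (V, U)" "params_ok i V" "threads_ok i U"
      using insert.prems by (auto simp: S_def)
    obtain h where h: "good h" "\<forall>t. length t < i \<longrightarrow> h t = t" "\<forall>(V, U)\<in>R. stable_above c (g \<circ> h) V U"
      using insert.IH insert.prems by blast
    have "finite (range (\<lambda>X. c (point_map g ` V) (g ` h ` X)))"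
      by (rule finite_subset[OF _ fin]) auto
    from one_thread_set[OF x(3) this] obtain h' where h': "good h'" "\<And>t. length t < i \<Longrightarrow> h' t = t"
      and st: "\<And>y m. valid U y m \<Longrightarrow> c (point_map g ` V) (g ` h ` h' ` (\<lambda>u. u @ y u) ` U)
        = c (point_map g ` V) (g ` h ` h' ` U)" by blast
    have pm: "point_map (g \<circ> (h \<circ> h')) ` V = point_map g ` V"
      using x(2) by (rule point_map_cong_params) (use h h' in simp)
    have "stable_above c (g \<circ> (h \<circ> h')) V U"
      unfolding stable_above_def pm using st by (simp add: image_comp comp_def)
    moreover have "stable_above c (g \<circ> (h \<circ> h')) V' U'" if "(V', U') \<in> R" for V' U'
    proof -
      have "params_ok i V'" "threads_ok i U'" using insert.prems that by (auto simp: S_def)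
      then show ?thesis using stable_comp[OF _ _ _ h'] h(3) that by (fastforce simp: comp_assoc)
    qed
    ultimately show ?case
      unfolding x(1) using h(2) h'(2)
      by (intro exI[of _ "h \<circ> h'"] conjI good_comp h(1) h'(1)) (simp, blast)
  qed
  from this[OF \<open>finite S\<close>] show thesis using that by (auto simp: S_def)
qed

theorem step_theorem:
  fixes c :: "word set \<Rightarrow> word set \<Rightarrow> 'c"
  assumes fin: "finite (range (\<lambda>(V, U). c V U))"
  obtains f where "good f"
    "\<And>i V U. params_ok i V \<Longrightarrow> threads_ok i U \<Longrightarrow> stable_above c f V U"
proof -
  have "\<exists>h. good h \<and> (\<forall>t. length t < i \<longrightarrow> h t = t) \<and>
    (\<forall>V U. params_ok i V \<longrightarrow> threads_ok i U \<longrightarrow> stable_above c (g \<circ> h) V U)" for i g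
    using one_level[OF fin, of i g] by metis
  then obtain H where H: "\<And>i g. good (H i g)" "\<And>i g t. length t < i \<Longrightarrow> H i g t = t"
    "\<And>i g V U. params_ok i V \<Longrightarrow> threads_ok i U \<Longrightarrow> stable_above c (g \<circ> H i g) V U" by metis
  \<comment> \<open>\<open>H i\<close> fixes words shorter than \<open>i\<close>, so
    \<open>G n t\<close> no longer changes from \<open>n = Suc (length t)\<close> on; the fusion
    \<open>f\<close> takes this value.\<close>
  define G where "G = rec_nat id (\<lambda>i g. g \<circ> H i g)"
  have G: "G 0 = id" "G (Suc i) = G i \<circ> H i (G i)" for i by (simp_all add: G_def)
  have goodG: "good (G i)" for i
    by (induction i) (simp only: G good_id, simp only: G(2) good_comp H(1))
  have G_mono: "G n t = G i t" if "i \<le> n" "length t < i" for n i t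
    using that by (induction n rule: dec_induct) (auto simp: G H(2))
  define f where "f t = G (Suc (length t)) t" for t
  have fG: "f t = G n t" if "length t < n" for n t
    using G_mono[of "Suc (length t)" n t] that by (simp add: f_def)
  show thesis
  proof (rule that)
    have "\<exists>e. f (t @ [a]) = f t @ a # e \<and> (is_Tr a \<longrightarrow> list_all is_Tr e)" for t a
      using good_snocE[OF goodG[of "Suc (Suc (length t))"], of t a] fG[of t "Suc (Suc (length t))"]
        fG[of "t @ [a]" "Suc (Suc (length t))"] by auto
    then obtain e where e: "\<And>t a. f (t @ [a]) = f t @ a # e t a" "\<And>t a. is_Tr a \<Longrightarrow> list_all is_Tr (e t a)"
      by metis
    have len: "length (f s) = length (f t)" if "length s = length t" for s t
      using good_length[OF goodG that] that by (simp add: f_def)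
    have len_e: "length (e t a) = length (e t' a')" if "length t = length t'" for t t' a a'
      using len[OF that] len[of "t @ [a]" "t' @ [a']"] that by (simp add: e)
    show "good f"
    proof (rule goodI[where e = e and l = "\<lambda>n. length (e (replicate n (Tr False)) (Tr False))"])
      show "length (e t a) = length (e (replicate (length t) (Tr False)) (Tr False))" for t a
        by (rule len_e) simp
    qed (use e in auto)
  next
    fix i V U assume V: "params_ok i V" and U: "threads_ok i U"
    have st: "stable_above c (G n) V U" if "Suc i \<le> n" for n
      using that
    proof (induction n rule: dec_induct)
      case base
      show ?case using H(3)[OF V U] by (simp only: G(2))
    next
      case (step n)
      show ?case unfolding G using step by (intro stable_comp[OF step.IH V U H(1)]) (auto intro: H(2))
    qed
    show "stable_above c f V U"
      unfolding stable_above_def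
    proof (intro allI impI)
      fix y m assume v: "valid U y m"
      define n where "n = Suc (i + m)"
      have "point_map f ` V = point_map (G n) ` V"
        using V by (rule point_map_cong_params) (rule fG, simp add: n_def)
      moreover have "f ` U = G n ` U"
        using U by (intro image_cong refl fG) (auto simp: threads_ok_def n_def)
      moreover have "f ` (\<lambda>u. u @ y u) ` U = G n ` (\<lambda>u. u @ y u) ` U"
        using U v by (intro image_cong refl fG) (auto simp: threads_ok_def valid_def n_def)
      ultimately show "c (point_map f ` V) (f ` (\<lambda>u. u @ y u) ` U) = c (point_map f ` V) (f ` U)"
        using st[of n] v unfolding stable_above_def n_def by auto
    qed
  qed
qed

section \<open>Chains of words\<close>

definition side_above :: "word \<Rightarrow> word \<Rightarrow> bool"
  where "side_above p q \<longleftrightarrow> (\<exists>y. y \<noteq> [] \<and> q = p @ y)"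

text \<open>Having left \<open>q\<close> on the lower side, \<open>p\<close> stays in the trunk
  until its last letter. That letter is exempt, as it may be an exit that only tells on which side
  of \<open>p\<close> the side cone lies.\<close>

definition trunk_below :: "word \<Rightarrow> word \<Rightarrow> bool"
  where "trunk_below p q \<longleftrightarrow> (\<exists>c a x b y. p = c @ a # x \<and> list_all is_Tr (butlast (a # x)) \<and>
    q = c @ b # y \<and> a < b)"

text \<open>At a point the trunk continues on the side opposite to the side cone, so a last letter
  \<open>Ex (\<not> d)\<close> puts the rest of the trunk in direction \<open>d\<close>.\<close>

definition wcone :: "bool \<Rightarrow> word \<Rightarrow> word \<Rightarrow> bool"
  where "wcone d p q \<longleftrightarrow> (last p = Ex d \<and> side_above p q) \<or> (last p = Ex (\<not> d) \<and> trunk_below p q)"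

definition word_chain :: "word set \<Rightarrow> bool"
  where "word_chain P \<longleftrightarrow> (\<forall>p\<in>P. p \<noteq> []) \<and>
    (\<forall>p\<in>P. \<forall>q\<in>P. p \<noteq> q \<longrightarrow> (\<exists>d. wcone d p q \<or> wcone d q p))"

lemma point_map_append:
  assumes "good f"
  obtains z where "point_map f (c @ a # y) = f c @ a # z" "y = [] \<longleftrightarrow> z = []"
    "list_all is_Tr (butlast (a # y)) \<longrightarrow> list_all is_Tr (butlast (a # z))"
proof (cases y rule: rev_cases)
  case Nil
  then show thesis using that[of "[]"] by (simp add: point_map_def)
next
  case (snoc y' x)
  obtain z where "f (c @ a # y') = f c @ a # z" "list_all is_Tr (a # y') \<longrightarrow> list_all is_Tr z"
    by (rule good_append[OF assms])
  with snoc show thesis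
    by (intro that[of "z @ [x]"]) (auto simp: point_map_def butlast_append)
qed

lemma last_point_map: "p \<noteq> [] \<Longrightarrow> last (point_map f p) = last p"
  by (simp add: point_map_def)

lemma point_map_snoc: "point_map f (u @ [a]) = f u @ [a]"
  by (simp add: point_map_def)

lemma point_map_side_above:
  assumes "good f" "p \<noteq> []" "side_above p q"
  shows "side_above (point_map f p) (point_map f q)"
proof -
  obtain t x where p: "p = t @ [x]" using assms(2) by (cases p rule: rev_cases) auto
  obtain y where y: "y \<noteq> []" "q = p @ y" using assms(3) by (auto simp: side_above_def)
  obtain z where "point_map f (t @ x # y) = f t @ x # z" "y = [] \<longleftrightarrow> z = []"
    using point_map_append[OF assms(1)] by blast
  with y show ?thesis by (auto simp: p point_map_snoc side_above_def)
qed

lemma point_map_trunk_below: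
  assumes "good f" "trunk_below p q"
  shows "trunk_below (point_map f p) (point_map f q)"
proof -
  obtain c a x b y where *: "p = c @ a # x" "list_all is_Tr (butlast (a # x))" "q = c @ b # y" "a < b"
    using assms(2) by (auto simp: trunk_below_def)
  obtain z where "point_map f p = f c @ a # z" "list_all is_Tr (butlast (a # z))"
    using point_map_append[OF assms(1), of c a x] * by metis
  moreover obtain z' where "point_map f q = f c @ b # z'"
    using point_map_append[OF assms(1), of c b y] * by metis
  ultimately show ?thesis using \<open>a < b\<close> unfolding trunk_below_def by blast
qed

lemma point_map_wcone: "good f \<Longrightarrow> p \<noteq> [] \<Longrightarrow> wcone d p q \<Longrightarrow> wcone d (point_map f p) (point_map f q)"
  by (auto simp: wcone_def last_point_map point_map_side_above point_map_trunk_below)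

lemma word_cases:
  fixes p u :: "'b list"
  obtains y where "p = u @ y" | y where "u = p @ y" "y \<noteq> []"
  | c a x b y where "p = c @ a # x" "u = c @ b # y" "a \<noteq> b"
proof -
  have "(\<exists>y. p = u @ y) \<or> (\<exists>y. u = p @ y \<and> y \<noteq> []) \<or>
    (\<exists>c a x b y. p = c @ a # x \<and> u = c @ b # y \<and> a \<noteq> b)"
  proof (induction p arbitrary: u)
    case (Cons a p)
    show ?case
    proof (cases u)
      case (Cons b u')
      show ?thesis
      proof (cases "a = b")
        case True
        with Cons.IH[of u'] \<open>u = b # u'\<close> show ?thesis by (metis append_Cons)
      next
        case False
        with \<open>u = b # u'\<close> show ?thesis by (metis append_Nil)
      qed
    qed simp
  qed auto
  with that show thesis by blast
qed

text \<open>A good map preserves the first difference of two words and inserts padding only behind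
  letters. So a point whose image runs through \<open>f u\<close> runs through \<open>u\<close> and
  leaves it by the same letter.\<close>

lemma point_map_above:
  assumes f: "good f" and p: "p \<noteq> []" and eq: "point_map f p = f u @ a # z"
  obtains y where "p = u @ a # y" "y = [] \<longleftrightarrow> z = []"
proof (cases rule: word_cases[of p u])
  case (1 y)
  show thesis
  proof (cases y)
    case Nil
    obtain t x where "p = t @ [x]" using p by (cases p rule: rev_cases) auto
    moreover obtain z' where "f (t @ x # []) = f t @ x # z'" by (rule good_append[OF f])
    ultimately show thesis using 1 Nil eq by (simp add: point_map_def)
  next
    case (Cons b y')
    obtain z' where "point_map f (u @ b # y') = f u @ b # z'" "y' = [] \<longleftrightarrow> z' = []"
      by (rule point_map_append[OF f])
    with 1 Cons eq show thesis by (intro that[of y']) auto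
  qed
next
  case (2 y)
  obtain t x where t: "p = t @ [x]" using p by (cases p rule: rev_cases) auto
  obtain z' where "f (t @ x # y) = f t @ x # z'" by (rule good_append[OF f])
  then show thesis using 2 t eq by (simp add: point_map_def)
next
  case (3 c b x b' y)
  obtain z' where "point_map f (c @ b # x) = f c @ b # z'" by (rule point_map_append[OF f])
  moreover obtain z'' where "f (c @ b' # y) = f c @ b' # z''" by (rule good_append[OF f])
  ultimately show thesis using 3 eq by simp
qed

lemma point_map_inj:
  assumes "good f" "p \<noteq> []" "q \<noteq> []" "point_map f p = point_map f q"
  shows "p = q"
proof -
  have "point_map f p = f (butlast q) @ last q # []" using assms by (simp add: point_map_def)
  then obtain y where "p = butlast q @ last q # y" "y = []"
    using point_map_above[OF assms(1,2)] by metis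
  with assms(3) show ?thesis by simp
qed

lemma point_map_word_chain:
  assumes "good f" "word_chain P"
  shows "word_chain (point_map f ` P)"
  unfolding word_chain_def
proof (intro conjI ballI impI)
  show "p \<noteq> []" if "p \<in> point_map f ` P" for p using that by (auto simp: point_map_def)
next
  fix p q assume "p \<in> point_map f ` P" "q \<in> point_map f ` P" "p \<noteq> q"
  then obtain p' q' where "p = point_map f p'" "q = point_map f q'" "p' \<in> P" "q' \<in> P" "p' \<noteq> q'" by auto
  then show "\<exists>d. wcone d p q \<or> wcone d q p"
    using assms point_map_wcone[OF assms(1)] unfolding word_chain_def by metis
qed

lemma diverge_unique:
  assumes "c @ a # x = c' @ a' # x'" "c @ b # y = c' @ b' # y'" "a \<noteq> b" "a' \<noteq> b'"
  shows "c = c' \<and> a = a' \<and> b = b' \<and> x = x' \<and> y = y'"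
  using assms
proof (induction c arbitrary: c')
  case Nil
  then show ?case by (cases c') auto
next
  case (Cons k c)
  then show ?case by (cases c') auto
qed

lemma less_wordE:
  assumes "u < v" "length u = length (v :: word)"
  obtains c a x b y where "u = c @ a # x" "v = c @ b # y" "a < b"
  using assms by (auto simp: list_less_def lexord_def)

lemma less_wordI: "a < b \<Longrightarrow> c @ a # x < c @ b # (y :: word)"
  unfolding list_less_def lexord_def by blast

section \<open>Events\<close>

text \<open>Strict prefixes only: the last letter of a point is the way in which a thread stops and
  does not by itself give a thread.\<close>

definition threads :: "nat \<Rightarrow> word set \<Rightarrow> word set"
  where "threads n P = {u. length u = n \<and> (\<exists>y. y \<noteq> [] \<and> u @ y \<in> P)}"

definition finished :: "nat \<Rightarrow> word set \<Rightarrow> word set"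
  where "finished n P = {p \<in> P. length p \<le> n}"

definition stops :: "word set \<Rightarrow> word \<Rightarrow> letter set"
  where "stops P u = {a. u @ [a] \<in> P}"

definition moves :: "word set \<Rightarrow> word \<Rightarrow> letter set"
  where "moves P u = {a. \<exists>y. y \<noteq> [] \<and> u @ a # y \<in> P}"

text \<open>Threads enter only by their rank in the order and not as words. This makes the profile
  invariant under embeddings and leaves finitely many profiles of a given length.\<close>

definition profile :: "nat \<Rightarrow> word set \<Rightarrow> (letter set \<times> letter set) list"
  where "profile n P = map (\<lambda>u. (stops P u, moves P u)) (sorted_list_of_set (threads n P))"

definition enabled :: "word set \<Rightarrow> bool"
  where "enabled U \<longleftrightarrow> free U (Max U)"

text \<open>
  The flag \<open>en\<close> records that the top thread has exited since the last event; from then on further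
  exits of this thread are no events.
\<close>

definition quiet :: "nat \<Rightarrow> bool \<Rightarrow> word set \<Rightarrow> bool"
  where "quiet n en P \<longleftrightarrow> (\<forall>u\<in>threads n P. stops P u = {} \<and>
    (\<exists>a. moves P u = {a} \<and> (is_Tr a \<or> (u = Max (threads n P) \<and> en))))"

text \<open>Neither the quiet levels nor the positions of the events are visible in the list. After
  an event the flag is recomputed from the last letter of the top thread, so an exit made in the
  event itself also permits further exits.\<close>

inductive Scan :: "word set \<Rightarrow> nat \<Rightarrow> bool \<Rightarrow> (letter set \<times> letter set) list list \<Rightarrow> bool" for P
  where
    Done: "threads n P = {} \<Longrightarrow> Scan P n en []"
  | Quiet: "threads n P \<noteq> {} \<Longrightarrow> quiet n en P \<Longrightarrow> Scan P (Suc n) en T \<Longrightarrow> Scan P n en T"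
  | Event: "\<not> quiet n en P \<Longrightarrow> Scan P (Suc n) (enabled (threads (Suc n) P)) T \<Longrightarrow> Scan P n en (profile n P # T)"

section \<open>The threads of a chain\<close>

lemma threads_Suc: "threads (Suc n) P = {u @ [a] | u a. u \<in> threads n P \<and> a \<in> moves P u}"
proof (intro set_eqI iffI)
  fix w assume "w \<in> threads (Suc n) P"
  then obtain y where y: "length w = Suc n" "y \<noteq> []" "w @ y \<in> P" by (auto simp: threads_def)
  then obtain u a where w: "w = u @ [a]" by (cases w rule: rev_cases) auto
  with y have "u @ a # y \<in> P" "length u = n" by auto
  then show "w \<in> {u @ [a] | u a. u \<in> threads n P \<and> a \<in> moves P u}"
    using w y(2) by (auto simp: threads_def moves_def)
qed (auto simp: threads_def moves_def)

lemma finished_Suc: "\<forall>p\<in>P. p \<noteq> [] \<Longrightarrow> finished (Suc n) P = finished n P \<union> {u @ [a] | u a. u \<in> threads n P \<and> a \<in> stops P u}"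
proof (intro set_eqI iffI)
  fix p assume "\<forall>p\<in>P. p \<noteq> []" "p \<in> finished (Suc n) P"
  then have p: "p \<noteq> []" "p \<in> P" "length p \<le> Suc n" by (auto simp: finished_def)
  then obtain u a where "p = u @ [a]" by (cases p rule: rev_cases) auto
  with p show "p \<in> finished n P \<union> {u @ [a] | u a. u \<in> threads n P \<and> a \<in> stops P u}"
    by (cases "length p \<le> n") (auto simp: finished_def threads_def stops_def)
qed (auto simp: finished_def threads_def stops_def)

lemma finite_threads: "finite (threads n P)"
  by (rule finite_subset[OF _ finite_words[of n]]) (auto simp: threads_def)

lemma threads_length: "u \<in> threads n P \<Longrightarrow> length u = n"
  by (simp add: threads_def)

text \<open>Let \<open>u\<close> separate from the top thread \<open>v\<close>, and take points of
  the chain through both. They are related by a cone, and as neither extends the other, the lower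
  one must be in \<open>trunk_below\<close> relation to the upper one. So \<open>u\<close> has
  stayed in the trunk since the separation.\<close>

lemma threads_ok_threads:
  assumes P: "word_chain P"
  shows "threads_ok n (threads n P)"
  unfolding threads_ok_def
proof (intro conjI ballI impI)
  show "threads n P \<subseteq> {u. length u = n}" by (auto simp: threads_def)
next
  fix u assume u: "u \<in> threads n P" and "u \<noteq> Max (threads n P)"
  define v where "v = Max (threads n P)"
  have v: "v \<in> threads n P" unfolding v_def using u by (intro Max_in finite_threads) auto
  have "u < v" using u \<open>u \<noteq> Max (threads n P)\<close> Max_ge[OF finite_threads u] by (simp add: v_def)
  then obtain c a x b x' where *: "u = c @ a # x" "v = c @ b # x'" "a < b"
    using less_wordE threads_length u v by metis
  obtain y y' where y: "y \<noteq> []" "u @ y \<in> P" "y' \<noteq> []" "v @ y' \<in> P" using u v by (auto simp: threads_def)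
  define p q where "p = u @ y" "q = v @ y'"
  have pq: "p = c @ a # x @ y" "q = c @ b # x' @ y'" by (simp_all add: p_q_def *)
  then have "p \<noteq> q" using \<open>a < b\<close> by auto
  then have "\<exists>d. wcone d p q \<or> wcone d q p"
    using P y unfolding word_chain_def p_q_def by blast
  moreover have "\<not> side_above p q" "\<not> side_above q p"
    using \<open>a < b\<close> by (auto simp: side_above_def pq)
  moreover have "\<not> trunk_below q p"
    unfolding trunk_below_def
  proof (intro notI, elim exE conjE)
    fix c' a' z b' z'
    assume **: "q = c' @ a' # z" "p = c' @ b' # z'" "a' < b'"
    then have "a = b' \<and> b = a'" using diverge_unique[of c a "x @ y" c' b' z' b "x' @ y'" a' z] pq \<open>a < b\<close> by auto
    with **(3) \<open>a < b\<close> show False by auto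
  qed
  ultimately have "trunk_below p q" by (auto simp: wcone_def)
  then obtain c' a' z b' z' where **: "p = c' @ a' # z" "list_all is_Tr (butlast (a' # z))"
    "q = c' @ b' # z'" "a' < b'" by (auto simp: trunk_below_def)
  then have "a = a' \<and> z = x @ y" using diverge_unique[of c a "x @ y" c' a' z b "x' @ y'" b' z'] pq \<open>a < b\<close> by auto
  then have "list_all is_Tr (a # x)" using **(2) y(1) by (simp add: butlast_append)
  then show "u \<noteq> []" "is_Tr (last u)" using *(1) by (auto simp: list_all_iff)
qed

lemma Max_strict_mono:
  assumes "finite U" "U \<noteq> {}" "\<And>u v. u \<in> U \<Longrightarrow> v \<in> U \<Longrightarrow> u < v \<Longrightarrow> g u < (g v :: 'b :: linorder)"
  shows "Max (g ` U) = g (Max (U :: 'a :: linorder set))"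
proof (rule Max_eqI)
  fix y assume "y \<in> g ` U"
  then obtain u where "u \<in> U" "y = g u" by auto
  then show "y \<le> g (Max U)"
    using assms Max_ge[OF assms(1) \<open>u \<in> U\<close>] Max_in[OF assms(1,2)]
    by (metis order.order_iff_strict)
qed (use assms in auto)

lemma top_thread_continues:
  assumes "u \<in> threads n P" "a \<in> moves P u" "u @ [a] = Max (threads (Suc n) P)"
    and "\<And>v. v \<in> threads n P \<Longrightarrow> moves P v \<noteq> {}"
  shows "u = Max (threads n P)"
proof (rule ccontr)
  define v where "v = Max (threads n P)"
  assume "u \<noteq> Max (threads n P)"
  then have "u < v" using assms(1) Max_ge[OF finite_threads assms(1)] by (simp add: v_def)
  have v: "v \<in> threads n P" unfolding v_def using assms(1) by (intro Max_in finite_threads) auto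
  then obtain b where "b \<in> moves P v" using assms(4) by blast
  with v have "v @ [b] \<in> threads (Suc n) P" by (auto simp: threads_Suc)
  then have "v @ [b] \<le> u @ [a]" using assms(3) Max_ge[OF finite_threads] by simp
  moreover obtain c a' x b' y where "u = c @ a' # x" "v = c @ b' # y" "a' < b'"
    using less_wordE[OF \<open>u < v\<close>] threads_length[OF assms(1)] threads_length[OF v] by metis
  then have "u @ [a] < v @ [b]" by (simp add: less_wordI)
  ultimately show False by simp
qed

lemma Scan_exists:
  assumes "finite P"
  shows "\<exists>T. Scan P n en T"
proof -
  obtain N where N: "\<forall>p\<in>P. length p \<le> N"
    using finite_nat_set_iff_bounded_le[of "length ` P"] assms by auto
  show ?thesis
  proof (induction "N - n" arbitrary: n en)
    case 0
    have "length (u @ y) \<le> n" if "u @ y \<in> P" for u y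
      using N 0 that by (metis diff_is_0_eq order_trans)
    then have "threads n P = {}" by (fastforce simp: threads_def)
    then show ?case using Done by blast
  next
    case (Suc m)
    then have IH: "\<exists>T. Scan P (Suc n) en T" for en by auto
    show ?case
    proof (cases "threads n P = {}")
      case False
      then show ?thesis using IH Quiet Event by metis
    qed (use Done in blast)
  qed
qed

text \<open>The quiet levels before the next event are collected into one extension \<open>y\<close>
  of the threads. Exits occur in it only on the top thread and only with the flag set; for the flag
  \<open>enabled\<close> this is exactly what \<open>valid\<close> demands.\<close>

lemma first_event:
  assumes "Scan P n en T" "T \<noteq> []" "word_chain P"
  shows "\<exists>n' y T'. n \<le> n' \<and> finished n' P = finished n P \<and> threads n' P = (\<lambda>u. u @ y u) ` threads n P \<and>
    (\<forall>u\<in>threads n P. length (y u) = n' - n \<and> (list_all is_Tr (y u) \<or> (u = Max (threads n P) \<and> en))) \<and>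
    threads n' P \<noteq> {} \<and> T = profile n' P # T' \<and> Scan P (Suc n') (enabled (threads (Suc n') P)) T'"
  using assms
proof (induction rule: Scan.induct)
  case (Quiet n en T)
  then obtain n' y T' where IH: "Suc n \<le> n'" "finished n' P = finished (Suc n) P"
    "threads n' P = (\<lambda>u. u @ y u) ` threads (Suc n) P"
    "\<forall>u\<in>threads (Suc n) P. length (y u) = n' - Suc n \<and> (list_all is_Tr (y u) \<or> (u = Max (threads (Suc n) P) \<and> en))"
    "threads n' P \<noteq> {}" "T = profile n' P # T'" "Scan P (Suc n') (enabled (threads (Suc n') P)) T'"
    by blast
  obtain a where a: "\<And>u. u \<in> threads n P \<Longrightarrow> moves P u = {a u}"
    "\<And>u. u \<in> threads n P \<Longrightarrow> is_Tr (a u) \<or> (u = Max (threads n P) \<and> en)"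
    using Quiet.hyps(2) unfolding quiet_def by metis
  define z where "z u = a u # y (u @ [a u])" for u
  have threads: "threads (Suc n) P = (\<lambda>u. u @ [a u]) ` threads n P" using a(1) by (auto simp: threads_Suc)
  have "finished n' P = finished n P"
    using IH(2) finished_Suc[of P n] Quiet.prems Quiet.hyps(2) by (auto simp: word_chain_def quiet_def)
  moreover have "threads n' P = (\<lambda>u. u @ z u) ` threads n P"
    by (simp add: IH(3) threads image_image z_def)
  moreover have "length (z u) = n' - n \<and> (list_all is_Tr (z u) \<or> (u = Max (threads n P) \<and> en))"
    if u: "u \<in> threads n P" for u
  proof -
    have "u @ [a u] \<in> threads (Suc n) P" using u threads by blast
    then have *: "length (y (u @ [a u])) = n' - Suc n"
      "list_all is_Tr (y (u @ [a u])) \<or> (u @ [a u] = Max (threads (Suc n) P) \<and> en)" using IH(4) by auto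
    have "u = Max (threads n P)" if "u @ [a u] = Max (threads (Suc n) P)"
      using u that a(1) by (intro top_thread_continues[of u n P "a u"]) auto
    then show ?thesis using * a(2)[OF u] IH(1) by (auto simp: z_def)
  qed
  ultimately show ?case using IH(1,5,6,7) by (intro exI[of _ n'] exI[of _ z] exI[of _ T']) auto
next
  case (Event n en T)
  then have "threads n P \<noteq> {}" by (auto simp: quiet_def)
  with Event show ?case by (intro exI[of _ n] exI[of _ "\<lambda>_. []"] exI[of _ T]) auto
qed simp

subsection \<open>The number of events\<close>

definition branch_levels :: "word set \<Rightarrow> nat set"
  where "branch_levels P = {n. \<exists>u\<in>threads n P. stops P u \<noteq> {} \<or> (\<nexists>a. moves P u = {a})}"

lemma card_branch_levels:
  assumes "finite P"
  shows "finite (branch_levels P)" "card (branch_levels P) \<le> card P + card P * card P"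
proof -
  \<comment> \<open>A branch level is the level at which the last letter of a point is read, or the
    first difference of two points.\<close>
  define A where "A = (\<lambda>p. length p - 1) ` P"
  define B where "B = (\<lambda>(p, q). LEAST i. p ! i \<noteq> q ! i) ` (P \<times> P)"
  have "branch_levels P \<subseteq> A \<union> B"
  proof
    fix n assume "n \<in> branch_levels P"
    then obtain u where u: "u \<in> threads n P" "stops P u \<noteq> {} \<or> (\<nexists>a. moves P u = {a})"
      by (auto simp: branch_levels_def)
    then have len: "length u = n" by (simp add: threads_def)
    show "n \<in> A \<union> B"
    proof (cases "stops P u = {}")
      case False
      then obtain a where "u @ [a] \<in> P" by (auto simp: stops_def)
      then show ?thesis using len by (force simp: A_def)
    next
      case True
      obtain y where y: "y \<noteq> []" "u @ y \<in> P" using u(1) by (auto simp: threads_def)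
      then obtain a y' where "y = a # y'" by (cases y) auto
      with True y have "a \<in> moves P u" by (cases y') (auto simp: stops_def moves_def)
      moreover have "moves P u \<noteq> {a}" using True u(2) by blast
      ultimately obtain b where "b \<in> moves P u" "b \<noteq> a" by blast
      with \<open>a \<in> moves P u\<close> obtain y z where *: "u @ a # y \<in> P" "u @ b # z \<in> P" "a \<noteq> b"
        by (auto simp: moves_def)
      have "(LEAST i. (u @ a # y) ! i \<noteq> (u @ b # z) ! i) = n"
        using * len by (intro Least_equality) (auto simp: nth_append split: if_splits)
      then show ?thesis using * by (force simp: B_def)
    qed
  qed
  moreover have "finite (A \<union> B)" using assms by (simp add: A_def B_def)
  ultimately show "finite (branch_levels P)" by (rule finite_subset)
  have "card (branch_levels P) \<le> card (A \<union> B)"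
    by (rule card_mono) fact+
  also have "\<dots> \<le> card A + card B" by (rule card_Un_le)
  also have "\<dots> \<le> card P + card P * card P"
    unfolding A_def B_def using assms card_image_le[of P] card_image_le[of "P \<times> P"]
    by (intro add_mono) (auto simp: card_cartesian_product)
  finally show "card (branch_levels P) \<le> card P + card P * card P" .
qed

text \<open>An event off the branch levels is an exit of the top thread with the flag off. It sets
  the flag, so the next event is at a branch level. Each branch level thus pays for itself and for
  one exit after it; the extra 1 is for an exit before all of them.\<close>

lemma Scan_length:
  assumes "Scan P n en T" "word_chain P" "finite P"
  shows "length T \<le> 2 * card {m \<in> branch_levels P. n \<le> m} + (if en then 0 else 1)"
  using assms(1)
proof (induction rule: Scan.induct)
  case (Quiet n en T)
  have "card {m \<in> branch_levels P. Suc n \<le> m} \<le> card {m \<in> branch_levels P. n \<le> m}"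
    using card_branch_levels(1)[OF assms(3)] by (intro card_mono) auto
  with Quiet show ?case by auto
next
  case (Event n en T)
  have IH: "length T \<le> 2 * card {m \<in> branch_levels P. Suc n \<le> m} +
    (if enabled (threads (Suc n) P) then 0 else 1)" by fact
  show ?case
  proof (cases "n \<in> branch_levels P")
    case True
    then have "{m \<in> branch_levels P. n \<le> m} = insert n {m \<in> branch_levels P. Suc n \<le> m}"
      by auto
    then have "card {m \<in> branch_levels P. n \<le> m} = Suc (card {m \<in> branch_levels P. Suc n \<le> m})"
      using card_branch_levels(1)[OF assms(3)] by simp
    with IH show ?thesis by (auto split: if_splits)
  next
    case False
    then have nb: "\<forall>u\<in>threads n P. stops P u = {} \<and> (\<exists>a. moves P u = {a})"
      by (auto simp: branch_levels_def)
    with Event.hyps(1) obtain u a where u: "u \<in> threads n P" "moves P u = {a}" "\<not> is_Tr a"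
      "\<not> (u = Max (threads n P) \<and> en)" unfolding quiet_def by metis
    then have ua: "u @ [a] \<in> threads (Suc n) P" by (auto simp: threads_Suc)
    then have top: "u @ [a] = Max (threads (Suc n) P)"
      using threads_ok_threads[OF assms(2), of "Suc n"] u(3) by (auto simp: threads_ok_def)
    then have "u = Max (threads n P)"
      using u nb by (intro top_thread_continues[of u n P a]) auto
    with u(4) have "\<not> en" by simp
    moreover have "enabled (threads (Suc n) P)"
      using top u(3) by (auto simp: enabled_def free_def simp flip: top)
    moreover have "{m \<in> branch_levels P. n \<le> m} = {m \<in> branch_levels P. Suc n \<le> m}"
      using False by (auto simp: Suc_le_eq le_less)
    ultimately show ?thesis using IH by simp
  qed
qed simp

lemma Scan_descs:
  assumes "Scan P n en T" "word_chain P" "finite P"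
  shows "T \<in> lists {D. length D \<le> card P}"
  using assms(1)
proof (induction rule: Scan.induct)
  case (Event n en T)
  have "threads n P \<subseteq> take n ` P" by (force simp: threads_def)
  then have "card (threads n P) \<le> card P"
    using assms(3) by (meson card_image_le card_mono finite_imageI order_trans)
  then have "length (profile n P) \<le> card P" by (simp add: profile_def finite_threads)
  then show ?case using Event.IH by simp
qed simp_all

subsection \<open>Events are preserved by embeddings\<close>

definition level :: "(word \<Rightarrow> word) \<Rightarrow> nat \<Rightarrow> nat"
  where "level f n = length (f (replicate n (Tr False)))"

lemma length_good: "good f \<Longrightarrow> length (f u) = level f (length u)"
  unfolding level_def by (rule good_length) auto

lemma level_Suc: "good f \<Longrightarrow> level f n < level f (Suc n)"
proof -
  assume f: "good f"
  define t where "t = replicate n (Tr False)"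
  obtain e where "f (t @ [Tr False]) = f t @ Tr False # e" by (rule good_snocE[OF f])
  then have "length (f t) < length (f (t @ [Tr False]))" by simp
  then show ?thesis by (simp add: length_good[OF f] t_def)
qed

lemma level_mono: "good f \<Longrightarrow> m \<le> n \<Longrightarrow> level f m \<le> level f n"
  using lift_Suc_mono_le[of "level f" m n] level_Suc[of f] by (auto intro: less_imp_le)

locale embedded_chain =
  fixes f :: "word \<Rightarrow> word" and P :: "word set"
  assumes good_f: "good f" and chain: "word_chain P"
begin

abbreviation "P' \<equiv> point_map f ` P"

lemma nonempty: "p \<in> P \<Longrightarrow> p \<noteq> []"
  using chain by (simp add: word_chain_def)

lemma above_image:
  assumes "f u @ a # z \<in> P'"
  obtains y where "u @ a # y \<in> P" "f u @ a # z = point_map f (u @ a # y)" "y = [] \<longleftrightarrow> z = []"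
proof -
  obtain p where p: "p \<in> P" "f u @ a # z = point_map f p" using assms by auto
  then obtain y where "p = u @ a # y" "y = [] \<longleftrightarrow> z = []"
    using point_map_above[OF good_f nonempty[OF p(1)]] by metis
  with p that show thesis by blast
qed

lemma stops_image: "stops P' (f u) = stops P u"
proof (intro set_eqI iffI)
  fix a assume "a \<in> stops P' (f u)"
  then have "f u @ a # [] \<in> P'" by (simp add: stops_def)
  then show "a \<in> stops P u" by (rule above_image) (simp add: stops_def)
next
  fix a assume "a \<in> stops P u"
  then have "point_map f (u @ [a]) \<in> P'" by (auto simp: stops_def)
  then show "a \<in> stops P' (f u)" by (simp add: stops_def point_map_snoc)
qed

lemma moves_image: "moves P' (f u) = moves P u"
proof (intro set_eqI iffI)
  fix a assume "a \<in> moves P' (f u)"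
  then obtain z where "z \<noteq> []" "f u @ a # z \<in> P'" by (auto simp: moves_def)
  then show "a \<in> moves P u" using above_image unfolding moves_def by blast
next
  fix a assume "a \<in> moves P u"
  then obtain y where y: "y \<noteq> []" "u @ a # y \<in> P" by (auto simp: moves_def)
  moreover obtain z where "point_map f (u @ a # y) = f u @ a # z" "y = [] \<longleftrightarrow> z = []"
    by (rule point_map_append[OF good_f])
  ultimately show "a \<in> moves P' (f u)" unfolding moves_def by (metis (mono_tags, lifting) imageI mem_Collect_eq)
qed

lemma threads_between:
  assumes "level f n < m" "m \<le> level f (Suc n)"
  shows "threads m P' = (\<lambda>w. take m (f w)) ` threads (Suc n) P"
proof (intro set_eqI iffI)
  fix u' assume "u' \<in> threads m P'"
  then obtain z p where z: "length u' = m" "z \<noteq> []" "u' @ z = point_map f p" "p \<in> P"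
    by (auto simp: threads_def)
  show "u' \<in> (\<lambda>w. take m (f w)) ` threads (Suc n) P"
  proof -
    have "length p > Suc n"
    proof (rule ccontr)
      assume "\<not> ?thesis"
      then have "level f (length (butlast p)) \<le> level f n" using level_mono[OF good_f] by simp
      then have "length (point_map f p) \<le> Suc (level f n)"
        by (simp add: point_map_def length_good[OF good_f])
      moreover have "length (point_map f p) > m" using z by (metis length_append length_greater_0_conv less_add_same_cancel1)
      ultimately show False using assms(1) by simp
    qed
    define w where "w = take (Suc n) p"
    obtain b y where y: "p = w @ b # y" using \<open>length p > Suc n\<close>
      by (metis append_take_drop_id w_def drop_eq_Nil2 linorder_not_less neq_Nil_conv)
    have lw: "length w = Suc n" using \<open>length p > Suc n\<close> by (simp add: w_def)
    obtain z' where "point_map f p = f w @ b # z'" unfolding y by (rule point_map_append[OF good_f])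
    then have "u' = take m (f w)"
      using z(1,3) assms(2) length_good[OF good_f, of w] lw
      by (metis append_eq_conv_conj take_append take0 append_Nil2 diff_is_0_eq')
    moreover have "w \<in> threads (Suc n) P" using lw y z(4) by (auto simp: threads_def)
    ultimately show ?thesis by blast
  qed
next
  fix u' assume "u' \<in> (\<lambda>w. take m (f w)) ` threads (Suc n) P"
  then obtain w where w: "u' = take m (f w)" "w \<in> threads (Suc n) P" by auto
  then obtain b y where y: "length w = Suc n" "w @ b # y \<in> P"
    unfolding threads_def by (auto simp: neq_Nil_conv)
  obtain z where "point_map f (w @ b # y) = f w @ b # z" by (rule point_map_append[OF good_f])
  then have "u' @ drop m (f w) @ b # z \<in> P'" using y(2) w(1)
    by (metis append.assoc append_take_drop_id imageI)
  then show "u' \<in> threads m P'"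
    unfolding threads_def using w(1) y(1) assms(2) length_good[OF good_f, of w]
    by (auto simp: min_def intro!: exI[of _ "drop m (f w) @ b # z"])
qed

lemma threads_image: "threads (level f n) P' = f ` threads n P"
proof (intro set_eqI iffI)
  fix u' assume "u' \<in> threads (level f n) P'"
  then obtain z p where z: "length u' = level f n" "z \<noteq> []" "u' @ z = point_map f p" "p \<in> P"
    by (auto simp: threads_def)
  have "level f n < length (point_map f p)" using z by (metis length_append length_greater_0_conv less_add_same_cancel1)
  then have "level f n < Suc (level f (length (butlast p)))" by (simp add: point_map_def length_good[OF good_f])
  then have "n \<le> length p - 1"
    using level_mono[OF good_f, of "Suc (length p - 1)" n] level_Suc[OF good_f, of "length p - 1"]
    by (metis Suc_leI leD leI less_Suc_eq_le order_trans length_butlast)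
  then obtain w b y where y: "p = w @ b # y" "length w = n"
    using nonempty[OF z(4)] id_take_nth_drop[of n p] by (metis (no_types, lifting) Suc_pred'
        append_take_drop_id le_imp_less_Suc length_greater_0_conv length_take min.absorb4 Cons_nth_drop_Suc)
  obtain z' where "point_map f p = f w @ b # z'" unfolding y by (rule point_map_append[OF good_f])
  then have "u' = f w" using z(1,3) y(2) length_good[OF good_f, of w] by (metis append_eq_append_conv)
  moreover have "w \<in> threads n P" using y z(4) by (auto simp: threads_def)
  ultimately show "u' \<in> f ` threads n P" by blast
next
  fix u' assume "u' \<in> f ` threads n P"
  then obtain w where w: "u' = f w" "w \<in> threads n P" by auto
  then obtain b y where y: "length w = n" "w @ b # y \<in> P"
    unfolding threads_def by (auto simp: neq_Nil_conv)
  obtain z where "point_map f (w @ b # y) = f w @ b # z" by (rule point_map_append[OF good_f])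
  then have "u' @ b # z \<in> P'" using y(2) w(1) by (metis imageI)
  then show "u' \<in> threads (level f n) P'"
    unfolding threads_def using w(1) y(1) length_good[OF good_f, of w] by auto
qed

lemma finished_image: "finished (level f n) P' = point_map f ` finished n P"
proof -
  have "length (point_map f p) \<le> level f n \<longleftrightarrow> length p \<le> n" if "p \<in> P" for p
  proof -
    obtain t x where p: "p = t @ [x]" using nonempty[OF \<open>p \<in> P\<close>] by (cases p rule: rev_cases) auto
    have "length (point_map f p) = Suc (level f (length t))" by (simp add: p point_map_snoc length_good[OF good_f])
    moreover have "level f (length t) < level f n \<longleftrightarrow> length t < n"
      using level_mono[OF good_f, of n "length t"] level_mono[OF good_f, of "Suc (length t)" n] level_Suc[OF good_f, of "length t"]
      by (meson Suc_leI leD leI order_less_le_trans)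
    ultimately show ?thesis by (simp add: p Suc_le_eq)
  qed
  then show ?thesis by (auto simp: finished_def)
qed

lemma f_strict_mono: "u < v \<Longrightarrow> length u = length v \<Longrightarrow> f u < f v"
proof (erule less_wordE)
  fix c a x b y assume "u = c @ a # x" "v = c @ b # y" "a < b"
  moreover obtain z where "f (c @ a # x) = f c @ a # z" by (rule good_append[OF good_f])
  moreover obtain z' where "f (c @ b # y) = f c @ b # z'" by (rule good_append[OF good_f])
  ultimately show "f u < f v" by (simp add: less_wordI)
qed

lemma take_f_strict_mono:
  assumes "u < v" "length u = Suc n" "length v = Suc n" "level f n < m"
  shows "take m (f u) < take m (f v)"
proof -
  obtain c a x b y where *: "u = c @ a # x" "v = c @ b # y" "a < b"
    using less_wordE[OF assms(1)] assms(2,3) by metis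
  obtain z where z: "f (c @ a # x) = f c @ a # z" by (rule good_append[OF good_f])
  obtain z' where z': "f (c @ b # y) = f c @ b # z'" by (rule good_append[OF good_f])
  have "length c \<le> n" using *(1) assms(2) by simp
  then have "length (f c) < m"
    using level_mono[OF good_f, of "length c" n] assms(4) by (simp add: length_good[OF good_f])
  then obtain j where "m = Suc (length (f c) + j)" using less_iff_Suc_add by auto
  then show ?thesis using z z' *(3) by (simp add: *(1,2) less_wordI)
qed

lemma Max_threads_image: "threads n P \<noteq> {} \<Longrightarrow> Max (threads (level f n) P') = f (Max (threads n P))"
  unfolding threads_image by (rule Max_strict_mono) (auto simp: finite_threads threads_length f_strict_mono)

lemma Max_threads_between:
  assumes "level f n < m" "m \<le> level f (Suc n)" "threads (Suc n) P \<noteq> {}"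
  shows "Max (threads m P') = take m (f (Max (threads (Suc n) P)))"
  unfolding threads_between[OF assms(1,2)]
  by (rule Max_strict_mono) (use assms in \<open>auto simp: finite_threads threads_length take_f_strict_mono\<close>)

lemma f_inj: "u \<in> threads n P \<Longrightarrow> v \<in> threads n P \<Longrightarrow> f u = f v \<longleftrightarrow> u = v"
  using f_strict_mono[of u v] f_strict_mono[of v u] by (cases u v rule: linorder_cases) (auto simp: threads_length)

lemma quiet_image: "quiet (level f n) en P' \<longleftrightarrow> quiet n en P"
proof (cases "threads n P = {}")
  case True
  then show ?thesis by (simp add: quiet_def threads_image)
next
  case False
  then have "f u = Max (threads (level f n) P') \<longleftrightarrow> u = Max (threads n P)" if "u \<in> threads n P" for u
    using that f_inj Max_in[OF finite_threads False] by (simp add: Max_threads_image)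
  then show ?thesis by (simp add: quiet_def threads_image stops_image moves_image)
qed

lemma profile_image: "profile (level f n) P' = profile n P"
proof -
  have "sorted_list_of_set (f ` threads n P) = map f (sorted_list_of_set (threads n P))"
  proof (rule sorted_distinct_set_unique)
    have "sorted_wrt (<) (sorted_list_of_set (threads n P))"
      by (simp add: finite_threads)
    then have "sorted_wrt (\<lambda>u v. f u < f v) (sorted_list_of_set (threads n P))"
      by (rule sorted_wrt_mono_rel[rotated]) (auto simp: finite_threads threads_length f_strict_mono)
    then have "sorted_wrt (<) (map f (sorted_list_of_set (threads n P)))" by (simp add: sorted_wrt_map)
    then show "sorted (map f (sorted_list_of_set (threads n P)))"
      "distinct (map f (sorted_list_of_set (threads n P)))"
      using strict_sorted_iff by auto
  qed (auto simp: finite_threads)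
  then show ?thesis by (simp add: profile_def threads_image stops_image moves_image)
qed

lemma enabled_image: "enabled (threads (Suc (level f n)) P') = enabled (threads (Suc n) P)"
proof (cases "threads (Suc n) P = {}")
  case True
  then show ?thesis using threads_between[of n "Suc (level f n)"] level_Suc[OF good_f, of n] by simp
next
  case False
  define w where "w = Max (threads (Suc n) P)"
  have "length w = Suc n" using Max_in[OF finite_threads False] threads_length by (auto simp: w_def)
  then obtain u a where w: "w = u @ [a]" "length u = n" by (cases w rule: rev_cases) auto
  obtain z where z: "f (u @ [a]) = f u @ a # z" by (rule good_append[OF good_f])
  have "Max (threads (Suc (level f n)) P') = take (Suc (level f n)) (f w)"
    unfolding w_def by (rule Max_threads_between) (use False level_Suc[OF good_f, of n] in auto)
  also have "\<dots> = f u @ [a]" using z w(2) length_good[OF good_f, of u] by (simp add: w(1))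
  finally have "Max (threads (Suc (level f n)) P') = f u @ [a]" .
  then show ?thesis by (simp add: enabled_def free_def w_def[symmetric] w(1))
qed

text \<open>All levels inside the padding are quiet, because the next letter \<open>e ! j\<close> is
  forced there. It is a trunk letter if the padding follows one; otherwise the thread is the top
  one, and the hypothesis on \<open>en\<close> permits exits.\<close>

lemma Scan_between:
  assumes "Scan P' (level f (Suc n)) en T" "level f n < m" "m \<le> level f (Suc n)"
    and en: "\<And>w. w \<in> threads (Suc n) P \<Longrightarrow> is_Tr (last w) \<or> en"
  shows "Scan P' m en T"
  using assms(3,1,2)
proof (induction m rule: inc_induct)
  case (step m)
  then have IH: "Scan P' (Suc m) en T" by simp
  have m: "level f n < m" "m < level f (Suc n)" using step by auto
  have threads: "threads m P' = (\<lambda>w. take m (f w)) ` threads (Suc n) P" using m by (intro threads_between) auto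
  show ?case
  proof (cases "threads m P' = {}")
    case True
    then have "threads (Suc n) P = {}" using threads by simp
    then have "threads (Suc m) P' = {}" using threads_between[of n "Suc m"] m by simp
    with IH have "T = []" by (cases rule: Scan.cases) (auto simp: quiet_def)
    then show ?thesis using Done[OF True] by simp
  next
    case False
    have "quiet m en P'"
      unfolding quiet_def
    proof
      fix u' assume "u' \<in> threads m P'"
      then obtain w where w: "w \<in> threads (Suc n) P" "u' = take m (f w)" using threads by auto
      then obtain u a where ua: "w = u @ [a]" "length u = n"
        using threads_length[OF w(1)] by (cases w rule: rev_cases) auto
      obtain e where e: "f (u @ [a]) = f u @ a # e" "is_Tr a \<longrightarrow> list_all is_Tr e"
        by (rule good_snocE[OF good_f])
      have lu: "length (f u) = level f n" using ua(2) length_good[OF good_f] by simp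
      have le: "level f (Suc n) = Suc (length (f u) + length e)"
        using e(1) length_good[OF good_f, of "u @ [a]"] ua(2) by simp
      define j where "j = m - Suc (level f n)"
      have mj: "m = Suc (length (f u) + j)" using m lu by (simp add: j_def)
      have j: "j < length e" using m(2) le mj by simp
      have u': "u' = f u @ a # take j e" using w(2) ua(1) e(1) mj by simp
      have above: "b = e ! j \<and> z \<noteq> []" if z: "u' @ b # z \<in> P'" for b z
      proof -
        have "f u @ a # (take j e @ b # z) \<in> P'" using z u' by simp
        then obtain y where y: "u @ a # y \<in> P" "f u @ a # (take j e @ b # z) = point_map f (u @ a # y)"
          "y = [] \<longleftrightarrow> take j e @ b # z = []" by (rule above_image)
        then obtain b' y' where "y = b' # y'" by (cases y) auto
        then obtain z' where "point_map f ((u @ [a]) @ b' # y') = f (u @ [a]) @ b' # z'"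
          using point_map_append[OF good_f] by metis
        then have "take j e @ b # z = e @ b' # z'" using y(2) \<open>y = b' # y'\<close> e(1) by simp
        also have "\<dots> = take j e @ e ! j # drop (Suc j) e @ b' # z'"
          using id_take_nth_drop[OF j] by (metis append.assoc append_Cons)
        finally show ?thesis by simp
      qed
      have ex: "\<exists>z. z \<noteq> [] \<and> u' @ e ! j # z \<in> P'"
      proof -
        obtain y where "y \<noteq> []" "u' @ y \<in> P'" using \<open>u' \<in> threads m P'\<close> by (auto simp: threads_def)
        with above show ?thesis by (metis neq_Nil_conv)
      qed
      have "stops P' u' = {}" using above by (fastforce simp: stops_def)
      moreover have "moves P' u' = {e ! j}" using above ex by (auto simp: moves_def)
      moreover have "is_Tr (e ! j) \<or> (u' = Max (threads m P') \<and> en)"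
      proof (cases "is_Tr a")
        case True
        then show ?thesis using e(2) j by (simp add: list_all_length)
      next
        case False
        then have "en" using en[OF w(1)] ua(1) by simp
        have "w = Max (threads (Suc n) P)"
          using threads_ok_threads[OF chain, of "Suc n"] w(1) ua(1) False by (auto simp: threads_ok_def)
        moreover have "threads (Suc n) P \<noteq> {}" using w(1) by blast
        ultimately have "u' = Max (threads m P')"
          using Max_threads_between[of n m] m w(2) by simp
        with \<open>en\<close> show ?thesis by simp
      qed
      ultimately show "stops P' u' = {} \<and> (\<exists>a. moves P' u' = {a} \<and> (is_Tr a \<or> u' = Max (threads m P') \<and> en))"
        by blast
    qed
    then show ?thesis using Quiet[OF False] IH by blast
  qed
qed

text \<open>A thread that has just made an exit is the top one and sets the flag, so the padding
  behind an event creates no new events.\<close>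

lemma Scan_after_event:
  assumes "Scan P' (level f (Suc n)) (enabled (threads (Suc n) P)) T"
  shows "Scan P' (Suc (level f n)) (enabled (threads (Suc (level f n)) P')) T"
  unfolding enabled_image
proof (rule Scan_between[OF assms])
  show "is_Tr (last w) \<or> enabled (threads (Suc n) P)" if w: "w \<in> threads (Suc n) P" for w
    using threads_ok_threads[OF chain, of "Suc n"] w by (auto simp: threads_ok_def enabled_def free_def)
qed (use level_Suc[OF good_f, of n] in auto)

lemma Scan_image: "Scan P n en T \<Longrightarrow> Scan P' (level f n) en T"
proof (induction rule: Scan.induct)
  case (Done n en)
  then show ?case by (simp add: Scan.Done threads_image)
next
  case (Quiet n en T)
  have "is_Tr (last w) \<or> en" if "w \<in> threads (Suc n) P" for w
    using that Quiet.hyps(2) by (auto simp: threads_Suc quiet_def)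
  then have "Scan P' (Suc (level f n)) en T"
    using level_Suc[OF good_f, of n] by (intro Scan_between[OF Quiet.IH]) auto
  from Scan.Quiet[OF _ _ this] show ?case using Quiet.hyps(1,2) by (simp add: threads_image quiet_image)
next
  case (Event n en T)
  have "Scan P' (level f n) en (profile (level f n) P' # T)"
    using Event.hyps(1) by (intro Scan.Event[OF _ Scan_after_event[OF Event.IH]]) (simp add: quiet_image)
  then show ?case by (simp add: profile_image)
qed

lemma card_image: "card P' = card P"
  using point_map_inj[OF good_f] nonempty by (intro Finite_Set.card_image) (auto simp: inj_on_def)

end

section \<open>The Ramsey theorem for chains of words\<close>

text \<open>Only the past up to level \<open>n\<close> and the list of coming events matter, not the
  levels of these events. For \<open>r = 0\<close> nothing is to come, and both chains equal their
  finished part.\<close>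

definition determined :: "nat \<Rightarrow> (word set \<Rightarrow> 'c) \<Rightarrow> (word \<Rightarrow> word) \<Rightarrow> nat \<Rightarrow> bool"
  where "determined k \<chi> f r \<longleftrightarrow> (\<forall>P Q n T.
    word_chain P \<and> finite P \<and> card P = k \<and> Scan P n (enabled (threads n P)) T \<and>
    word_chain Q \<and> finite Q \<and> card Q = k \<and> Scan Q n (enabled (threads n Q)) T \<and>
    threads n P = threads n Q \<and> finished n P = finished n Q \<and> length T \<le> r \<longrightarrow>
    \<chi> (point_map f ` P) = \<chi> (point_map f ` Q))"

lemma profile_eqD:
  assumes "profile n P = profile n Q" "threads n P = threads n Q" "finished n P = finished n Q"
    and "word_chain P" "word_chain Q"
  shows "threads (Suc n) P = threads (Suc n) Q" "finished (Suc n) P = finished (Suc n) Q"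
proof -
  have *: "stops P u = stops Q u \<and> moves P u = moves Q u" if "u \<in> threads n P" for u
    using assms(1,2) that by (auto simp: profile_def finite_threads)
  then show "threads (Suc n) P = threads (Suc n) Q" using assms(2) by (auto simp: threads_Suc)
  have "\<forall>p\<in>P. p \<noteq> []" "\<forall>p\<in>Q. p \<noteq> []" using assms(4,5) by (auto simp: word_chain_def)
  then show "finished (Suc n) P = finished (Suc n) Q"
    using * assms(2,3) finished_Suc[of P n] finished_Suc[of Q n] by auto
qed

lemma Scan_Nil_finished:
  assumes "Scan P n en []" "word_chain P"
  shows "finished n P = P"
  using assms(1)
proof (induction n en "[] :: (letter set \<times> letter set) list list" rule: Scan.induct)
  case (Done n en)
  show ?case
  proof (rule ccontr)
    assume "finished n P \<noteq> P"
    then have "\<not> (\<forall>p\<in>P. length p \<le> n)" by (auto simp: finished_def)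
    then obtain p where p: "p \<in> P" "n < length p" by auto
    then have "take n p \<in> threads n P" by (auto simp: threads_def intro!: exI[of _ "drop n p"])
    with Done show False by simp
  qed
next
  case (Quiet n en)
  then show ?case using finished_Suc[of P n] assms(2) by (auto simp: word_chain_def quiet_def)
qed

text \<open>If the next event takes place at the present level, its profile determines threads and
  finished points at the level after it, and one event fewer remains; so \<open>det\<close> fixes
  the colour. The step theorem removes the dependence on the waiting time before this event.\<close>

lemma determined_Suc:
  fixes \<chi> :: "word set \<Rightarrow> 'c"
  assumes fin: "finite (range \<chi>)" and f: "good f" and det: "determined k \<chi> f r"
  obtains g where "good g" "determined k \<chi> (f \<circ> g) (Suc r)"
proof -
  define TT :: "(letter set \<times> letter set) list list set"
    where "TT = {T. set T \<subseteq> {D. length D \<le> k} \<and> length T \<le> Suc r}"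
  have "finite {D :: (letter set \<times> letter set) list. length D \<le> k}"
    using finite_lists_length_le[of "UNIV :: (letter set \<times> letter set) set" k] by simp
  then have finTT: "finite TT" unfolding TT_def by (rule finite_lists_length_le)
  define pre where "pre P n V U T \<longleftrightarrow> word_chain P \<and> finite P \<and> card P = k \<and> finished n P = V \<and>
    threads n P = U \<and> U \<noteq> {} \<and> (\<exists>T'. T = profile n P # T' \<and> Scan P (Suc n) (enabled (threads (Suc n) P)) T')"
    for P n V U T
  \<comment> \<open>A colour is a whole function of the event list, so that one application of the
    step theorem treats all lists. Outside \<open>TT\<close> its value is a dummy, which leaves
    finitely many such functions.\<close>
  define col where "col V U = (\<lambda>T. if T \<in> TT then \<chi> (point_map f ` (SOME P. \<exists>n. pre P n V U T)) else \<chi> {})"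
    for V U
  have col: "col V U T = \<chi> (point_map f ` P)" if P: "pre P n V U T" "T \<in> TT" for P n V U T
  proof -
    define Q where "Q = (SOME P. \<exists>n. pre P n V U T)"
    have "\<exists>n. pre Q n V U T" unfolding Q_def by (rule someI_ex) (use P in blast)
    then obtain m where Q: "pre Q m V U T" by blast
    \<comment> \<open>The threads in the nonempty set \<open>U\<close> have the level as their
      length.\<close>
    have "m = n" using P Q by (auto simp: pre_def threads_def)
    obtain T' where T': "T = profile n P # T'" "Scan P (Suc n) (enabled (threads (Suc n) P)) T'"
      using P(1) by (auto simp: pre_def)
    have T'': "T = profile n Q # T'" "Scan Q (Suc n) (enabled (threads (Suc n) Q)) T'"
      using Q T' by (auto simp: pre_def \<open>m = n\<close>)
    have "threads (Suc n) P = threads (Suc n) Q" "finished (Suc n) P = finished (Suc n) Q"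
      using profile_eqD[of n P Q] T' T'' P Q by (auto simp: pre_def \<open>m = n\<close>)
    moreover have "length T' \<le> r" using P(2) T' by (simp add: TT_def)
    ultimately have "\<chi> (point_map f ` P) = \<chi> (point_map f ` Q)"
      using det[unfolded determined_def, rule_format, of P "Suc n" T' Q] T' T'' P Q
      by (auto simp: pre_def)
    then show ?thesis using P(2) by (simp add: col_def Q_def)
  qed
  have "range (\<lambda>(V, U). col V U) \<subseteq> {h. \<forall>T. (T \<in> TT \<longrightarrow> h T \<in> range \<chi>) \<and> (T \<notin> TT \<longrightarrow> h T = \<chi> {})}"
    by (auto simp: col_def)
  then have "finite (range (\<lambda>(V, U). col V U))"
    by (rule finite_subset) (rule finite_set_of_finite_funs[OF finTT fin])
  then obtain g where g: "good g"
    and st: "\<And>i V U. params_ok i V \<Longrightarrow> threads_ok i U \<Longrightarrow> stable_above col g V U"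
    by (rule step_theorem) blast
  have key: "\<chi> (point_map (f \<circ> g) ` P) = col (point_map g ` finished n P) (g ` threads n P) T"
    if P: "word_chain P" "finite P" "card P = k" "Scan P n (enabled (threads n P)) T"
      "length T \<le> Suc r" "T \<noteq> []" for P n T
  proof -
    interpret embedded_chain g P by unfold_locales fact+
    obtain n' y T' where y: "n \<le> n'" "finished n' P = finished n P" "threads n' P = (\<lambda>u. u @ y u) ` threads n P"
      "\<forall>u\<in>threads n P. length (y u) = n' - n \<and> (list_all is_Tr (y u) \<or> (u = Max (threads n P) \<and> enabled (threads n P)))"
      "threads n' P \<noteq> {}" "T = profile n' P # T'" "Scan P (Suc n') (enabled (threads (Suc n') P)) T'"
      using first_event[OF P(4,6,1)] by blast
    have "T \<in> TT" using Scan_descs[OF P(4,1,2)] P(3,5) by (auto simp: TT_def)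
    moreover have "pre P' (level g n') (point_map g ` finished n P) (g ` threads n' P) T"
      unfolding pre_def
      using P(1-3) y(5,6) point_map_word_chain[OF g P(1)] card_image Scan_after_event[OF Scan_image[OF y(7)]]
      by (auto simp: finished_image threads_image profile_image y(2))
    ultimately have "col (point_map g ` finished n P) (g ` threads n' P) T = \<chi> (point_map f ` P')"
      by (intro col) auto
    moreover have "stable_above col g (finished n P) (threads n P)"
      using P(1) threads_ok_threads[OF P(1)] by (intro st[of n]) (auto simp: params_ok_def finished_def word_chain_def)
    moreover have "valid (threads n P) y (n' - n)"
      using y(4) by (auto simp: valid_def enabled_def free_def)
    ultimately have "col (point_map g ` finished n P) (g ` threads n P) T = \<chi> (point_map f ` P')"
      unfolding stable_above_def y(3) by metis
    then show ?thesis by (simp add: image_image point_map_comp)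
  qed
  show thesis
  proof (rule that[OF g])
    show "determined k \<chi> (f \<circ> g) (Suc r)"
      unfolding determined_def
    proof (intro allI impI, elim conjE)
      fix P Q n T
      assume *: "word_chain P" "finite P" "card P = k" "Scan P n (enabled (threads n P)) T"
        "word_chain Q" "finite Q" "card Q = k" "Scan Q n (enabled (threads n Q)) T"
        "threads n P = threads n Q" "finished n P = finished n Q" "length T \<le> Suc r"
      show "\<chi> (point_map (f \<circ> g) ` P) = \<chi> (point_map (f \<circ> g) ` Q)"
      proof (cases "T = []")
        case True
        then have "P = Q" using * Scan_Nil_finished by metis
        then show ?thesis by simp
      next
        case False
        show ?thesis using key[OF *(1-4,11) False] key[OF *(5-8,11) False] *(9,10) by simp
      qed
    qed
  qed
qed

theorem word_chain_Ramsey: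
  "\<exists>N. \<forall>\<chi> :: word set \<Rightarrow> 'c. finite (range \<chi>) \<longrightarrow> (\<exists>f. good f \<and>
    card ((\<lambda>P. \<chi> (point_map f ` P)) ` {P. word_chain P \<and> finite P \<and> card P = k}) \<le> N)"
proof -
  \<comment> \<open>The bound of \<open>Scan_length\<close> for at most \<open>k + k * k\<close>
    branch levels, with the flag possibly off.\<close>
  define B where "B = 2 * (k + k * k) + 1"
  define TT :: "(letter set \<times> letter set) list list set"
    where "TT = {T. set T \<subseteq> {D. length D \<le> k} \<and> length T \<le> B}"
  have "finite {D :: (letter set \<times> letter set) list. length D \<le> k}"
    using finite_lists_length_le[of "UNIV :: (letter set \<times> letter set) set" k] by simp
  then have finTT: "finite TT" unfolding TT_def by (rule finite_lists_length_le)
  have "\<exists>f. good f \<and> card ((\<lambda>P. \<chi> (point_map f ` P)) ` {P. word_chain P \<and> finite P \<and> card P = k}) \<le> card TT"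
    if fin: "finite (range \<chi>)" for \<chi> :: "word set \<Rightarrow> 'c"
  proof -
    have "\<exists>f. good f \<and> determined k \<chi> f r" for r
    proof (induction r)
      case 0
      have "determined k \<chi> id 0"
        unfolding determined_def using Scan_Nil_finished by (metis le_zero_eq length_0_conv)
      then show ?case using good_id by blast
    next
      case (Suc r)
      then obtain f where "good f" "determined k \<chi> f r" by blast
      then show ?case using determined_Suc[OF fin] good_comp by metis
    qed
    then obtain f where f: "good f" "determined k \<chi> f B" by blast
    define ty where "ty P = (SOME T. Scan P 0 (enabled (threads 0 P)) T)" for P
    define C where "C = {P. word_chain P \<and> finite P \<and> card P = k}"
    have ty: "Scan P 0 (enabled (threads 0 P)) (ty P)" if "P \<in> C" for P
      unfolding ty_def by (rule someI_ex) (use Scan_exists that in \<open>auto simp: C_def\<close>)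
    have tyTT: "ty P \<in> TT" if P: "P \<in> C" for P
    proof -
      have "card {m \<in> branch_levels P. 0 \<le> m} \<le> k + k * k"
        using card_branch_levels(2)[of P] P by (simp add: C_def)
      then have "length (ty P) \<le> B"
        using Scan_length[OF ty[OF P]] P by (auto simp: B_def C_def split: if_splits)
      moreover have "set (ty P) \<subseteq> {D. length D \<le> k}"
        using Scan_descs[OF ty[OF P]] P by (auto simp: C_def)
      ultimately show ?thesis by (simp add: TT_def)
    qed
    have eq: "\<chi> (point_map f ` P) = \<chi> (point_map f ` Q)" if "P \<in> C" "Q \<in> C" "ty P = ty Q" for P Q
    proof -
      \<comment> \<open>At level 0 any two chains of \<open>k\<close> words look alike: the empty
        word is the only thread, or there is none if \<open>k = 0\<close>. So
        \<open>determined\<close> compares any two of them.\<close>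
      have thr0: "threads 0 P = (if P = {} then {} else {[]})" if "P \<in> C" for P
      proof (cases "P = {}")
        case False
        then obtain p where "p \<in> P" by blast
        then have "[] \<in> threads 0 P"
          using \<open>P \<in> C\<close> by (auto simp: threads_def C_def word_chain_def)
        then show ?thesis using False by (auto simp: threads_def)
      qed (simp add: threads_def)
      have finp0: "finished 0 P = {}" if "P \<in> C" for P
        using that by (auto simp: finished_def C_def word_chain_def)
      have "length (ty P) \<le> B" using tyTT[OF that(1)] by (simp add: TT_def)
      moreover have "threads 0 P = threads 0 Q" using that thr0 by (auto simp: C_def)
      moreover have "Scan Q 0 (enabled (threads 0 Q)) (ty P)" using ty[OF that(2)] that(3) by simp
      ultimately show ?thesis
        using f(2)[unfolded determined_def, rule_format, of P 0 "ty P" Q] ty[OF that(1)] that finp0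
        by (simp add: C_def)
    qed
    define h where "h x = \<chi> (point_map f ` (SOME P. P \<in> C \<and> ty P = x))" for x
    have "(\<lambda>P. \<chi> (point_map f ` P)) ` C \<subseteq> h ` TT"
    proof
      fix c assume "c \<in> (\<lambda>P. \<chi> (point_map f ` P)) ` C"
      then obtain P where P: "P \<in> C" "c = \<chi> (point_map f ` P)" by auto
      define Q where "Q = (SOME Q. Q \<in> C \<and> ty Q = ty P)"
      have "Q \<in> C \<and> ty Q = ty P" unfolding Q_def by (rule someI[of _ P]) (use P in simp)
      then have "h (ty P) = c" unfolding h_def Q_def[symmetric] P(2) using P(1) by (intro eq) auto
      with tyTT[OF P(1)] show "c \<in> h ` TT" by blast
    qed
    then have "card ((\<lambda>P. \<chi> (point_map f ` P)) ` C) \<le> card (h ` TT)"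
      using finTT by (intro card_mono) auto
    also have "\<dots> \<le> card TT" using finTT by (rule card_image_le)
    finally show ?thesis using f(1) by (auto simp: C_def)
  qed
  then show ?thesis by blast
qed

section \<open>Cones in two-branching pseudotrees\<close>

locale branching =
  fixes S :: "'a pstruct" (structure)
  assumes lex_tree: "lex_pseudotree S"
    and cover: "finite F \<Longrightarrow> F \<subseteq> points S \<Longrightarrow> \<exists>Q. rooted_subtree Q S \<and> F \<subseteq> Q"
begin

abbreviation "X \<equiv> points S"

lemma irrefl: "p \<in> X \<Longrightarrow> \<not> p \<prec> p"
  and trans: "p \<in> X \<Longrightarrow> q \<in> X \<Longrightarrow> r \<in> X \<Longrightarrow> p \<prec> q \<Longrightarrow> q \<prec> r \<Longrightarrow> p \<prec> r"
  and chain: "p \<in> X \<Longrightarrow> is_chain S {q \<in> X. q \<prec> p}"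
  and meet_in: "p \<in> X \<Longrightarrow> q \<in> X \<Longrightarrow> p \<sqinter> q \<in> X"
  and meet_le: "p \<in> X \<Longrightarrow> q \<in> X \<Longrightarrow> p \<sqinter> q \<preceq> p" "p \<in> X \<Longrightarrow> q \<in> X \<Longrightarrow> p \<sqinter> q \<preceq> q"
  and le_meet: "p \<in> X \<Longrightarrow> q \<in> X \<Longrightarrow> r \<in> X \<Longrightarrow> r \<preceq> p \<Longrightarrow> r \<preceq> q \<Longrightarrow> r \<preceq> p \<sqinter> q"
  and lex_incomparable: "p \<in> X \<Longrightarrow> q \<in> X \<Longrightarrow> p \<lhd> q \<Longrightarrow> incomparable S p q"
  and lex_asym: "p \<in> X \<Longrightarrow> q \<in> X \<Longrightarrow> p \<lhd> q \<Longrightarrow> \<not> q \<lhd> p"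
  and lex_total: "p \<in> X \<Longrightarrow> q \<in> X \<Longrightarrow> incomparable S p q \<Longrightarrow> p \<lhd> q \<or> q \<lhd> p"
  and lex_up: "p \<in> X \<Longrightarrow> q \<in> X \<Longrightarrow> p' \<in> X \<Longrightarrow> q' \<in> X \<Longrightarrow> p \<lhd> q \<Longrightarrow> p \<preceq> p' \<Longrightarrow> q \<preceq> q' \<Longrightarrow> p' \<lhd> q'"
  using lex_tree unfolding lex_pseudotree_def by blast+

lemma le_refl [simp]: "p \<preceq> p"
  by (simp add: preceq_def)

lemma lt_le: "p \<prec> q \<Longrightarrow> p \<preceq> q"
  by (simp add: preceq_def)

lemma le_trans: "p \<in> X \<Longrightarrow> q \<in> X \<Longrightarrow> r \<in> X \<Longrightarrow> p \<preceq> q \<Longrightarrow> q \<preceq> r \<Longrightarrow> p \<preceq> r"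
  unfolding preceq_def using trans by blast

lemma lt_le_trans: "p \<in> X \<Longrightarrow> q \<in> X \<Longrightarrow> r \<in> X \<Longrightarrow> p \<prec> q \<Longrightarrow> q \<preceq> r \<Longrightarrow> p \<prec> r"
  unfolding preceq_def using trans by blast

lemma le_lt_trans: "p \<in> X \<Longrightarrow> q \<in> X \<Longrightarrow> r \<in> X \<Longrightarrow> p \<preceq> q \<Longrightarrow> q \<prec> r \<Longrightarrow> p \<prec> r"
  unfolding preceq_def using trans by blast

lemma le_antisym: "p \<in> X \<Longrightarrow> q \<in> X \<Longrightarrow> p \<preceq> q \<Longrightarrow> q \<preceq> p \<Longrightarrow> p = q"
  unfolding preceq_def using trans irrefl by blast

lemma lt_not_le: "p \<in> X \<Longrightarrow> q \<in> X \<Longrightarrow> p \<prec> q \<Longrightarrow> \<not> q \<preceq> p"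
  unfolding preceq_def using trans irrefl by blast

lemma lower_comparable:
  assumes "p \<in> X" "q \<in> X" "r \<in> X" "p \<preceq> r" "q \<preceq> r"
  shows "p \<preceq> q \<or> q \<preceq> p"
  using assms chain[OF assms(3)] unfolding is_chain_def incomparable_def preceq_def by blast

lemma meet_eq: "p \<in> X \<Longrightarrow> q \<in> X \<Longrightarrow> p \<preceq> q \<Longrightarrow> p \<sqinter> q = p" "p \<in> X \<Longrightarrow> q \<in> X \<Longrightarrow> p \<preceq> q \<Longrightarrow> q \<sqinter> p = p"
  by (rule le_antisym; auto intro: le_meet meet_in meet_le)+

lemma meet_commute: "p \<in> X \<Longrightarrow> q \<in> X \<Longrightarrow> p \<sqinter> q = q \<sqinter> p"
  by (rule le_antisym) (auto intro: le_meet meet_in meet_le)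

lemma incomparable_up:
  assumes X: "p \<in> X" "q \<in> X" "p' \<in> X" and inc: "incomparable S p q" and le: "p \<preceq> p'"
  shows "incomparable S p' q" "p' \<sqinter> q = p \<sqinter> q"
proof -
  show inc': "incomparable S p' q"
    using assms le_trans[of p p' q] lower_comparable[of p q p'] unfolding incomparable_def by blast
  define m where "m = p' \<sqinter> q"
  have m: "m \<in> X" "m \<preceq> p'" "m \<preceq> q" using X meet_in meet_le by (auto simp: m_def)
  have "m \<preceq> p"
    using lower_comparable[of m p p'] le_trans[of p m q] m X le inc by (auto simp: incomparable_def)
  then have "m \<preceq> p \<sqinter> q" using m X by (intro le_meet)
  moreover have "p \<sqinter> q \<preceq> p'" using X le meet_in meet_le(1)[of p q] le_trans[of "p \<sqinter> q" p p'] by blast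
  then have "p \<sqinter> q \<preceq> m" unfolding m_def using X meet_in meet_le by (intro le_meet)
  ultimately show "p' \<sqinter> q = p \<sqinter> q" using le_antisym meet_in X m by (metis m_def)
qed

text \<open>\<open>cone d s q\<close>: the point \<open>q\<close> lies above \<open>s\<close>, on the right if \<open>d\<close> and on the left otherwise.\<close>

definition cone :: "bool \<Rightarrow> 'a \<Rightarrow> 'a \<Rightarrow> bool"
  where "cone d s q \<longleftrightarrow> s \<prec> q \<and> (\<exists>r\<in>X. q \<sqinter> r = s \<and> (if d then r \<lhd> q else q \<lhd> r))"

lemma cone_lt: "cone d s q \<Longrightarrow> s \<prec> q"
  by (simp add: cone_def)

lemma immediate_succ_below:
  assumes "Q \<subseteq> X" "finite Q" "s \<in> Q" "q \<in> Q" "s \<prec> q"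
  obtains a where "a \<in> immediate_succs (induced S Q) s" "a \<preceq> q"
proof -
  define A where "A = {t \<in> Q. s \<prec> t \<and> t \<preceq> q}"
  have "finite A" "A \<noteq> {}" using assms by (auto simp: A_def)
  moreover have "A \<subseteq> X" using assms(1) by (auto simp: A_def)
  then have "asymp_on A (\<prec>)" "transp_on A (\<prec>)"
    unfolding asymp_on_def transp_on_def using irrefl trans by (meson subsetD)+
  ultimately obtain a where a: "a \<in> A" "\<And>b. b \<in> A \<Longrightarrow> \<not> b \<prec> a"
    using Finite_Set.bex_min_element[of A "(\<prec>)"] irrefl \<open>A \<subseteq> X\<close> by (metis subsetD)
  have "\<not> u \<prec> a" if "u \<in> Q" "s \<prec> u" for u
  proof
    assume "u \<prec> a"
    then have "u \<preceq> q" using that a(1) assms lt_le le_trans[of u a q] by (auto simp: A_def)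
    then show False using a(2)[of u] \<open>u \<prec> a\<close> that by (auto simp: A_def)
  qed
  then show thesis using a(1) by (intro that[of a]) (auto simp: A_def immediate_succs_def induced_def)
qed

lemma immediate_succs_meet:
  assumes Q: "substructure Q S" and s: "s \<in> Q" and a: "a \<in> immediate_succs (induced S Q) s"
    and b: "b \<in> immediate_succs (induced S Q) s" and "a \<noteq> b"
  shows "incomparable S a b" "a \<sqinter> b = s"
proof -
  have *: "a \<in> Q" "b \<in> Q" "s \<prec> a" "s \<prec> b" "\<And>u. u \<in> Q \<Longrightarrow> s \<prec> u \<Longrightarrow> \<not> u \<prec> a \<and> \<not> u \<prec> b"
    using a b by (auto simp: immediate_succs_def induced_def)
  have X: "Q \<subseteq> X" and m: "a \<sqinter> b \<in> Q" using Q * by (auto simp: substructure_def)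
  then have X': "a \<in> X" "b \<in> X" "s \<in> X" using * s by auto
  show inc: "incomparable S a b" using * \<open>a \<noteq> b\<close> by (auto simp: incomparable_def preceq_def)
  have "s \<preceq> a \<sqinter> b" using X' * lt_le by (intro le_meet) auto
  moreover have "\<not> s \<prec> a \<sqinter> b"
    using *(5)[OF m] meet_le[OF X'(1,2)] inc by (auto simp: preceq_def incomparable_def)
  ultimately show "a \<sqinter> b = s" by (simp add: preceq_def)
qed

text \<open>In a finite two-branching subtree through \<open>s\<close> and \<open>q\<close> the node
  \<open>s\<close> is not a leaf. Beside the successor below \<open>q\<close> it has a second one,
  and comparing \<open>q\<close> with it yields the direction.\<close>

lemma cone_exists:
  assumes X: "s \<in> X" "q \<in> X" and "s \<prec> q"
  obtains d where "cone d s q"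
proof -
  obtain Q where Q: "rooted_subtree Q S" "{s, q} \<subseteq> Q" using cover[of "{s, q}"] X by auto
  then have sub: "substructure Q S" and tree: "finite_two_branching_tree (induced S Q)"
    by (auto simp: rooted_subtree_def)
  have QX: "Q \<subseteq> X" "finite Q"
    using sub tree by (auto simp: substructure_def finite_two_branching_tree_def induced_def)
  obtain a where a: "a \<in> immediate_succs (induced S Q) s" "a \<preceq> q"
    using immediate_succ_below[OF QX, of s q] Q(2) assms by auto
  then have "card (immediate_succs (induced S Q) s) = 2"
    using tree Q(2) by (auto simp: finite_two_branching_tree_def induced_def)
  then obtain b where b: "b \<in> immediate_succs (induced S Q) s" "b \<noteq> a"
    using a(1) by (auto simp: card_2_iff)
  have ab: "incomparable S a b" "a \<sqinter> b = s"
    using immediate_succs_meet[OF sub _ a(1) b(1)] b(2) Q(2) by auto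
  have abX: "a \<in> X" "b \<in> X" using a b QX by (auto simp: immediate_succs_def induced_def)
  have "incomparable S q b" "q \<sqinter> b = s" using incomparable_up[OF abX X(2) ab(1) a(2)] ab(2) by auto
  then have "cone False s q \<or> cone True s q"
    using lex_total[OF X(2) abX(2)] \<open>s \<prec> q\<close> abX by (auto simp: cone_def)
  then show thesis using that by blast
qed

text \<open>Witnesses \<open>r\<close> to the right and \<open>r'\<close> to the left of
  \<open>q\<close> would both lie above the only other successor \<open>b\<close> of
  \<open>s\<close> in a finite two-branching subtree. Both inherit the order between
  \<open>b\<close> and \<open>q\<close>, a contradiction.\<close>

lemma cone_unique:
  assumes X: "s \<in> X" "q \<in> X" and c: "cone d s q" "cone e s q"
  shows "d = e"
proof (rule ccontr)
  assume "d \<noteq> e"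
  with c have "cone False s q" "cone True s q" by (cases d; cases e; simp)+
  then obtain r r' where r: "s \<prec> q" "r \<in> X" "q \<sqinter> r = s" "q \<lhd> r" "r' \<in> X" "q \<sqinter> r' = s" "r' \<lhd> q"
    by (auto simp: cone_def)
  obtain Q where Q: "rooted_subtree Q S" "{s, q, r, r'} \<subseteq> Q" using cover[of "{s, q, r, r'}"] X r by auto
  then have sub: "substructure Q S" and tree: "finite_two_branching_tree (induced S Q)"
    by (auto simp: rooted_subtree_def)
  have QX: "Q \<subseteq> X" "finite Q"
    using sub tree by (auto simp: substructure_def finite_two_branching_tree_def induced_def)
  have inc: "incomparable S q r" "incomparable S r' q" using lex_incomparable X r by auto
  have sr: "s \<prec> r" "s \<prec> r'"
    using meet_le[OF X(2) r(2)] meet_le[OF X(2) r(5)] r inc by (auto simp: incomparable_def preceq_def)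
  obtain a where a: "a \<in> immediate_succs (induced S Q) s" "a \<preceq> q"
    using immediate_succ_below[OF QX, of s q] Q(2) r by auto
  obtain b where b: "b \<in> immediate_succs (induced S Q) s" "b \<preceq> r"
    using immediate_succ_below[OF QX, of s r] Q(2) sr by auto
  obtain b' where b': "b' \<in> immediate_succs (induced S Q) s" "b' \<preceq> r'"
    using immediate_succ_below[OF QX, of s r'] Q(2) sr by auto
  have abX: "a \<in> X" "b \<in> X" "b' \<in> X" "s \<prec> a" "s \<prec> b" "s \<prec> b'"
    using a b b' QX by (auto simp: immediate_succs_def induced_def)
  have "b \<noteq> a" "b' \<noteq> a"
    using le_meet[OF X(2) r(2), of a] le_meet[OF X(2) r(5), of a] a(2) b(2) b'(2) r abX X lt_not_le
    by auto
  moreover have "card (immediate_succs (induced S Q) s) = 2"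
    using tree Q(2) a by (auto simp: finite_two_branching_tree_def induced_def)
  ultimately have "b' = b" using a(1) b(1) b'(1) by (auto simp: card_2_iff)
  have "incomparable S b q"
    using le_meet[OF X(2) r(2), of b] le_trans[of q b r] b(2) r abX X lt_not_le inc
    by (auto simp: incomparable_def)
  then have "b \<lhd> q \<or> q \<lhd> b" using lex_total abX X by blast
  then show False
  proof
    assume "b \<lhd> q"
    then have "r \<lhd> q" using lex_up[OF abX(2) X(2) r(2) X(2) _ b(2) le_refl] by simp
    then show False using lex_asym[OF r(2) X(2)] r(4) by simp
  next
    assume "q \<lhd> b"
    then have "q \<lhd> r'" using lex_up[OF X(2) abX(2) X(2) r(5) _ le_refl] b'(2) \<open>b' = b\<close> by simp
    then show False using lex_asym[OF X(2) r(5)] r(7) by simp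
  qed
qed

lemma cone_up:
  assumes X: "s \<in> X" "q \<in> X" "q' \<in> X" and c: "cone d s q" "q \<preceq> q'"
  shows "cone d s q'"
proof -
  obtain r where r: "r \<in> X" "q \<sqinter> r = s" "if d then r \<lhd> q else q \<lhd> r" using c(1) by (auto simp: cone_def)
  then have "incomparable S q r" using lex_incomparable X by (auto simp: incomparable_def split: if_splits)
  then have "q' \<sqinter> r = s" using incomparable_up[OF X(2) r(1) X(3) _ c(2)] r(2) by simp
  moreover have "if d then r \<lhd> q' else q' \<lhd> r"
    using r(3) lex_up[OF r(1) X(2) r(1) X(3)] lex_up[OF X(2) r(1) X(3) r(1)] c(2) by auto
  moreover have "s \<prec> q'" using cone_lt[OF c(1)] c(2) X lt_le_trans by blast
  ultimately show ?thesis using r(1) by (auto simp: cone_def)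
qed

lemma cone_down:
  assumes X: "s \<in> X" "q \<in> X" "q' \<in> X" and c: "cone d s q'" "s \<prec> q" "q \<preceq> q'"
  shows "cone d s q"
proof -
  obtain e where e: "cone e s q" using cone_exists[OF X(1,2) c(2)] .
  then have "cone e s q'" using cone_up X c(3) by blast
  then show ?thesis using e cone_unique X c(1) by blast
qed

lemma lex_cone:
  assumes "p \<in> X" "q \<in> X" "p \<lhd> q"
  shows "cone False (p \<sqinter> q) p" "cone True (p \<sqinter> q) q"
proof -
  have "incomparable S p q" using lex_incomparable assms by blast
  then have "p \<sqinter> q \<prec> p" "p \<sqinter> q \<prec> q"
    using meet_le[OF assms(1,2)] by (auto simp: incomparable_def preceq_def)
  then show "cone False (p \<sqinter> q) p" "cone True (p \<sqinter> q) q"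
    using assms meet_commute by (auto simp: cone_def)
qed

lemma incomparable_cone:
  assumes "p \<in> X" "q \<in> X" "incomparable S p q"
  obtains d where "cone d (p \<sqinter> q) p" "cone (\<not> d) (p \<sqinter> q) q" "d \<longleftrightarrow> q \<lhd> p"
proof -
  consider "p \<lhd> q" | "q \<lhd> p" using lex_total assms by blast
  then show thesis
  proof cases
    case 1
    then show thesis using lex_cone[OF assms(1,2)] lex_asym assms by (intro that[of False]) auto
  next
    case 2
    then show thesis using lex_cone[OF assms(2,1)] meet_commute assms by (intro that[of True]) auto
  qed
qed

lemma opposite_cones:
  assumes X: "s \<in> X" "p \<in> X" "q \<in> X" and c: "cone d s p" "cone (\<not> d) s q"
  shows "incomparable S p q" "p \<sqinter> q = s" "q \<lhd> p \<longleftrightarrow> d" "p \<lhd> q \<longleftrightarrow> \<not> d"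
proof -
  have no: "\<not> (u \<preceq> p \<and> u \<preceq> q \<and> s \<prec> u)" if "u \<in> X" for u
    using cone_down[OF X(1) that X(2) c(1)] cone_down[OF X(1) that X(3) c(2)] cone_unique[OF X(1) that]
    by auto
  show inc: "incomparable S p q"
    using no[OF X(2)] no[OF X(3)] cone_lt c by (auto simp: incomparable_def)
  have "s \<preceq> p \<sqinter> q" using X c cone_lt lt_le by (intro le_meet) auto
  then show m: "p \<sqinter> q = s"
    using no[OF meet_in[OF X(2,3)]] meet_le[OF X(2,3)] by (auto simp: preceq_def[of S s])
  have "q \<lhd> p \<Longrightarrow> d" "p \<lhd> q \<Longrightarrow> \<not> d"
    using lex_cone[OF X(3,2)] lex_cone[OF X(2,3)] m meet_commute[OF X(2,3)] cone_unique[OF X(1,2)] c(1)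
    by fastforce+
  then show "q \<lhd> p \<longleftrightarrow> d" "p \<lhd> q \<longleftrightarrow> \<not> d" using lex_total[OF X(2,3) inc] by auto
qed

lemma cone_meet:
  assumes X: "s \<in> X" "p \<in> X" "q \<in> X" and c: "cone d s p" "cone d s q"
  shows "cone d s (p \<sqinter> q)"
proof -
  have "s \<preceq> p \<sqinter> q" using X c cone_lt lt_le by (intro le_meet) auto
  moreover have "p \<sqinter> q \<noteq> s"
  proof
    assume m: "p \<sqinter> q = s"
    have "incomparable S p q"
      using m meet_eq[of p q] meet_eq[of q p] X irrefl[OF X(1)] cone_lt[OF c(1)] cone_lt[OF c(2)]
      by (auto simp: incomparable_def)
    then obtain e where "cone e s p" "cone (\<not> e) s q" using incomparable_cone[OF X(2,3)] m by metis
    then show False using cone_unique X c by blast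
  qed
  ultimately have "s \<prec> p \<sqinter> q" by (auto simp: preceq_def)
  then show ?thesis using cone_down[OF X(1) meet_in[OF X(2,3)] X(2) c(1)] meet_le X by blast
qed

text \<open>The structure is determined by its cones, so preserving them is enough for an embedding.\<close>

lemma cone_preserving_embedding:
  assumes j: "\<And>p. p \<in> X \<Longrightarrow> j p \<in> X"
    and c: "\<And>d p q. p \<in> X \<Longrightarrow> q \<in> X \<Longrightarrow> cone d p q \<Longrightarrow> cone d (j p) (j q)"
  shows "substructure (j ` X) S" "is_iso j S (induced S (j ` X))"
proof -
  have lt: "j p \<prec> j q" if "p \<in> X" "q \<in> X" "p \<prec> q" for p q
    using cone_exists[OF that] c that cone_lt by metis
  have inc: "incomparable S (j p) (j q)" "j (p \<sqinter> q) = j p \<sqinter> j q" "j p \<lhd> j q \<longleftrightarrow> p \<lhd> q"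
    if pq: "p \<in> X" "q \<in> X" "incomparable S p q" for p q
  proof -
    obtain d where "cone d (p \<sqinter> q) p" "cone (\<not> d) (p \<sqinter> q) q" "d \<longleftrightarrow> q \<lhd> p"
      using incomparable_cone[OF pq] .
    then have "cone d (j (p \<sqinter> q)) (j p)" "cone (\<not> d) (j (p \<sqinter> q)) (j q)" "p \<lhd> q \<longleftrightarrow> \<not> d"
      using c meet_in lex_total[OF pq] lex_asym pq by blast+
    then show "incomparable S (j p) (j q)" "j (p \<sqinter> q) = j p \<sqinter> j q" "j p \<lhd> j q \<longleftrightarrow> p \<lhd> q"
      using opposite_cones[of "j (p \<sqinter> q)" "j p" "j q" d] j meet_in pq by auto
  qed
  have cases: "p = q \<or> p \<prec> q \<or> q \<prec> p \<or> incomparable S p q" for p q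
    by (auto simp: incomparable_def preceq_def)
  have lt_iff: "j p \<prec> j q \<longleftrightarrow> p \<prec> q" if "p \<in> X" "q \<in> X" for p q
    using cases[of p q] that lt lt[of q p] inc(1)[of p q] j irrefl lt_not_le[of "j p" "j q"]
    by (auto simp: incomparable_def preceq_def)
  have inj: "p = q" if "p \<in> X" "q \<in> X" "j p = j q" for p q
    using cases[of p q] that lt[of p q] lt[of q p] inc(1)[of p q] j irrefl
    by (auto simp: incomparable_def)
  have lex_iff: "j p \<lhd> j q \<longleftrightarrow> p \<lhd> q" if pq: "p \<in> X" "q \<in> X" for p q
  proof (cases "incomparable S p q")
    case False
    then have "p \<preceq> q \<or> q \<preceq> p" by (auto simp: incomparable_def)
    then have "j p \<preceq> j q \<or> j q \<preceq> j p" using lt pq by (auto simp: preceq_def)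
    then show ?thesis using False lex_incomparable pq j by (auto simp: incomparable_def)
  qed (use inc pq in blast)
  have meet: "j (p \<sqinter> q) = j p \<sqinter> j q" if pq: "p \<in> X" "q \<in> X" for p q
  proof (cases "incomparable S p q")
    case False
    then consider "p \<preceq> q" | "q \<preceq> p" by (auto simp: incomparable_def)
    then show ?thesis
    proof cases
      case 1
      then have "j p \<preceq> j q" using lt pq by (auto simp: preceq_def)
      then show ?thesis using 1 meet_eq pq j by metis
    next
      case 2
      then have "j q \<preceq> j p" using lt pq by (auto simp: preceq_def)
      then show ?thesis using 2 meet_eq pq j by metis
    qed
  qed (use inc pq in blast)
  show "substructure (j ` X) S"
    unfolding substructure_def using j meet meet_in by (auto simp flip: meet)
  show "is_iso j S (induced S (j ` X))"
    unfolding is_iso_def using inj lt_iff lex_iff meet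
    by (auto simp: induced_def bij_betw_def inj_on_def)
qed

end

section \<open>Coding points by words\<close>

text \<open>
  A region is a set of points with an optional top \<open>h\<close>, its trunk being the part below \<open>h\<close>. The
  first trunk point \<open>z\<close> in a fixed enumeration (the first point of all, if there is no top) splits
  the region into \<open>z\<close> itself, the points branching off below \<open>z\<close>, and the two cones above \<open>z\<close>.
\<close>

type_synonym 'a region = "'a set \<times> 'a option"

locale countable_branching = branching +
  assumes countable: "countable (points S)"
begin

definition idx :: "'a \<Rightarrow> nat"
  where "idx = to_nat_on X"

lemma idx_inj: "x \<in> X \<Longrightarrow> y \<in> X \<Longrightarrow> idx x = idx y \<Longrightarrow> x = y"
  using inj_on_to_nat_on[OF countable] by (auto simp: idx_def inj_on_def)

definition trunk :: "'a region \<Rightarrow> 'a set"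
  where "trunk R = (case snd R of None \<Rightarrow> fst R | Some h \<Rightarrow> {x \<in> fst R. x \<prec> h})"

definition fst_pt :: "'a region \<Rightarrow> 'a"
  where "fst_pt R = (ARG_MIN idx x. x \<in> trunk R)"

text \<open>The side cone is the one away from the top, so that the trunk leads on towards the top.
  Without a top the choice of the left is arbitrary.\<close>

definition side :: "'a region \<Rightarrow> bool"
  where "side R = (case snd R of None \<Rightarrow> False | Some h \<Rightarrow> cone False (fst_pt R) h)"

text \<open>Of the two exits only the one in direction \<open>side R\<close> is inhabited; the other
  cone above the first point is reached by \<open>Tr True\<close>. A side cone starts without a top
  and thus with a new trunk.\<close>

fun child :: "'a region \<Rightarrow> letter \<Rightarrow> 'a region"
  where
    "child R (Tr b) = (if b then ({x \<in> fst R. cone (\<not> side R) (fst_pt R) x}, snd R)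
      else ({x \<in> fst R. \<not> fst_pt R \<preceq> x}, Some (fst_pt R)))"
  | "child R (Ex d) = (if d = side R then {x \<in> fst R. cone d (fst_pt R) x} else {}, None)"

definition region :: "word \<Rightarrow> 'a region"
  where "region t = foldl child (X, None) t"

text \<open>The condition on the top says that \<open>x \<sqinter> h\<close> projects the region to
  its trunk; so a nonempty region has a nonempty trunk and its first point exists.\<close>

definition proper :: "'a region \<Rightarrow> bool"
  where "proper R \<longleftrightarrow> fst R \<subseteq> X \<and> (\<forall>x\<in>fst R. \<forall>y\<in>fst R. x \<sqinter> y \<in> fst R) \<and>
    (\<forall>h. snd R = Some h \<longrightarrow> fst R \<noteq> {} \<longrightarrow> h \<in> X \<and> (\<forall>x\<in>fst R. x \<sqinter> h \<in> fst R \<and> x \<sqinter> h \<prec> h))"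

lemma region_snoc: "region (t @ [a]) = child (region t) a"
  by (simp add: region_def)

lemma fst_pt:
  assumes "proper R" "fst R \<noteq> {}"
  shows "fst_pt R \<in> fst R" "fst_pt R \<in> X" "\<And>x. x \<in> trunk R \<Longrightarrow> idx (fst_pt R) \<le> idx x"
    "\<And>h. snd R = Some h \<Longrightarrow> fst_pt R \<prec> h \<and> h \<in> X"
proof -
  obtain x0 where x0: "x0 \<in> fst R" using assms(2) by blast
  have "trunk R \<noteq> {}"
  proof (cases "snd R")
    case (Some h)
    then have "x0 \<sqinter> h \<in> trunk R" using assms x0 by (auto simp: trunk_def proper_def)
    then show ?thesis by blast
  qed (use x0 in \<open>auto simp: trunk_def\<close>)
  then obtain x where "x \<in> trunk R" by blast
  then have *: "fst_pt R \<in> trunk R \<and> (\<forall>y. y \<in> trunk R \<longrightarrow> idx (fst_pt R) \<le> idx y)"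
    unfolding fst_pt_def by (rule arg_min_nat_lemma)
  then show "fst_pt R \<in> fst R" "\<And>x. x \<in> trunk R \<Longrightarrow> idx (fst_pt R) \<le> idx x"
    by (auto simp: trunk_def split: option.splits)
  then show "fst_pt R \<in> X" using assms(1) by (auto simp: proper_def)
  show "fst_pt R \<prec> h \<and> h \<in> X" if "snd R = Some h" for h
    using * that assms by (auto simp: trunk_def proper_def)
qed

lemma child_subset: "fst (child R a) \<subseteq> fst R"
  by (cases a) auto

lemma not_fst_pt_child:
  assumes "proper R" "fst R \<noteq> {}"
  shows "fst_pt R \<notin> fst (child R a)"
  using fst_pt(2)[OF assms] irrefl cone_lt by (cases a) auto

text \<open>A point branching off below the first point meets \<open>h\<close> below that point, so
  its projection to the trunk is unchanged when the first point becomes the new top.\<close>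

lemma child_meet_below:
  assumes R: "proper R" "snd R = Some h" and x: "x \<in> fst R" "\<not> fst_pt R \<preceq> x"
  shows "x \<sqinter> fst_pt R = x \<sqinter> h"
proof -
  define z where "z = fst_pt R"
  have ne: "fst R \<noteq> {}" using x by blast
  have z: "z \<in> X" "z \<prec> h" "h \<in> X" using fst_pt[OF R(1) ne] R(2) by (auto simp: z_def)
  have X: "x \<in> X" using x R(1) by (auto simp: proper_def)
  have xh: "x \<sqinter> h \<in> X" using X z meet_in by blast
  have "x \<sqinter> h \<preceq> z"
    using lower_comparable[OF xh z(1,3)] meet_le[OF X z(3)] lt_le[OF z(2)]
      le_trans[OF z(1) xh X] x(2) by (auto simp: z_def)
  then have "x \<sqinter> h \<preceq> x \<sqinter> z" using le_meet[OF X z(1) xh] meet_le X z by blast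
  moreover have "x \<sqinter> z \<preceq> h"
    using le_trans[OF meet_in[OF X z(1)] z(1,3)] meet_le[OF X z(1)] lt_le[OF z(2)] by blast
  then have "x \<sqinter> z \<preceq> x \<sqinter> h" using le_meet[OF X z(3) meet_in[OF X z(1)]] meet_le[OF X z(1)] by blast
  ultimately show ?thesis using le_antisym[OF xh meet_in[OF X z(1)]] by (simp add: z_def)
qed

lemma proper_child:
  assumes R: "proper R"
  shows "proper (child R a)"
proof (cases "fst R = {}")
  case True
  then have "fst (child R a) = {}" using child_subset[of R a] by blast
  then show ?thesis by (simp add: proper_def)
next
  case ne: False
  define z where "z = fst_pt R"
  have z: "z \<in> fst R" "z \<in> X" using fst_pt[OF R ne] by (auto simp: z_def)
  have AX: "fst R \<subseteq> X" and meet: "\<And>x y. x \<in> fst R \<Longrightarrow> y \<in> fst R \<Longrightarrow> x \<sqinter> y \<in> fst R"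
    using R by (auto simp: proper_def)
  have cone_meet': "cone d z (x \<sqinter> y)" if "x \<in> fst R" "y \<in> fst R" "cone d z x" "cone d z y" for d x y
    using that AX cone_meet z(2) by blast
  show ?thesis
  proof (cases a)
    case (Ex d)
    then show ?thesis using AX meet cone_meet' by (auto simp: proper_def simp flip: z_def)
  next
    case (Tr b)
    show ?thesis
    proof (cases b)
      case True
      have "x \<sqinter> h \<in> fst R \<and> cone (\<not> side R) z (x \<sqinter> h) \<and> x \<sqinter> h \<prec> h \<and> h \<in> X"
        if "snd R = Some h" "x \<in> fst R" "cone (\<not> side R) z x" for h x
      proof -
        have h: "z \<prec> h" "h \<in> X" using fst_pt(4)[OF R ne] that(1) by (auto simp: z_def)
        obtain e where e: "cone e z h" using cone_exists[OF z(2) h(2,1)] .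
        then have "side R = (\<not> e)"
          using cone_unique[OF z(2) h(2), of e False] that(1) by (cases e) (auto simp: side_def z_def)
        then have "cone (\<not> side R) z h" using e by simp
        then show ?thesis
          using that R ne cone_meet[OF z(2) _ h(2) that(3)] AX h(2) by (auto simp: proper_def)
      qed
      then show ?thesis
        using AX meet cone_meet' Tr True by (auto simp: proper_def simp flip: z_def)
    next
      case False
      have "\<not> z \<preceq> x \<sqinter> y" if "x \<in> fst R" "y \<in> fst R" "\<not> z \<preceq> x" for x y
        using that le_trans[OF z(2) meet_in[of x y], of x] meet_le(1)[of x y] AX by blast
      moreover have "x \<sqinter> z \<in> fst R \<and> \<not> z \<preceq> x \<sqinter> z \<and> x \<sqinter> z \<prec> z" if x: "x \<in> fst R" "\<not> z \<preceq> x" for x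
      proof -
        have X: "x \<in> X" "x \<sqinter> z \<in> X" using x AX z meet_in by auto
        have "\<not> z \<preceq> x \<sqinter> z" using le_trans[OF z(2) X(2) X(1)] meet_le[OF X(1) z(2)] x(2) by blast
        moreover have "x \<sqinter> z \<preceq> z" using meet_le[OF X(1) z(2)] by blast
        ultimately show ?thesis using meet[OF x(1) z(1)] by (auto simp: preceq_def)
      qed
      ultimately show ?thesis
        using AX meet Tr False z(2) by (auto simp: proper_def simp flip: z_def)
    qed
  qed
qed

lemma proper_region: "proper (region t)"
proof (induction t rule: rev_induct)
  case Nil
  then show ?case by (auto simp: region_def proper_def meet_in)
qed (simp add: region_snoc proper_child)

lemma child_exists:
  assumes R: "proper R" and x: "x \<in> fst R" "x \<noteq> fst_pt R"
  shows "\<exists>a. x \<in> fst (child R a)"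
proof (cases "fst_pt R \<preceq> x")
  case False
  then have "x \<in> fst (child R (Tr False))" using x by simp
  then show ?thesis by blast
next
  case True
  have X: "fst_pt R \<in> X" "x \<in> X" using fst_pt(2)[OF R] R x by (auto simp: proper_def)
  have "fst_pt R \<prec> x" using True x(2) by (auto simp: preceq_def)
  then obtain d where d: "cone d (fst_pt R) x" using cone_exists X by blast
  show ?thesis
  proof (cases "d = side R")
    case True
    then have "x \<in> fst (child R (Ex d))" using d x by simp
    then show ?thesis by blast
  next
    case False
    then have "x \<in> fst (child R (Tr True))" using d x by simp
    then show ?thesis by blast
  qed
qed

lemma child_disjoint:
  assumes R: "proper R" and x: "x \<in> fst (child R a)" "x \<in> fst (child R b)"
  shows "a = b"
proof -
  have X: "fst_pt R \<in> X" "x \<in> X" using fst_pt(2)[OF R] R x child_subset[of R a] by (auto simp: proper_def)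
  have "d = e" if "cone d (fst_pt R) x" "cone e (fst_pt R) x" for d e
    using that cone_unique X by blast
  moreover have "fst_pt R \<preceq> x" if "cone d (fst_pt R) x" for d
    using that cone_lt lt_le by blast
  ultimately show ?thesis
    using x by (cases a; cases b) (auto split: if_splits)
qed

text \<open>Lexicographic descent. The first count never grows, and it drops if there is no top,
  since then the first point comes no later than \<open>p\<close>. With a top, a trunk step keeps
  the projection of \<open>p\<close> and removes a point enumerated no later than it, so the second
  count drops; an exit discards the top and sets this count to 0.\<close>

lemma point_reached:
  assumes "proper R" "p \<in> fst R"
  shows "\<exists>t. p \<in> fst (foldl child R t) \<and> fst_pt (foldl child R t) = p"
  using assms
proof (induction R rule: wf_induct_rule[OF wf_inv_image[OF wf_lex_prod[OF wf_less_than wf_less_than],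
    of "\<lambda>R. (card {x \<in> fst R. idx x \<le> idx p},
      case snd R of None \<Rightarrow> 0 | Some h \<Rightarrow> card {x \<in> fst R. idx x \<le> idx (p \<sqinter> h)})"]])
  case (1 R)
  show ?case
  proof (cases "p = fst_pt R")
    case True
    then show ?thesis using 1 by (intro exI[of _ "[]"]) auto
  next
    case False
    then obtain a where a: "p \<in> fst (child R a)" using child_exists 1 by blast
    define z where "z = fst_pt R"
    have ne: "fst R \<noteq> {}" using 1 by blast
    have AX: "fst R \<subseteq> X" using 1 by (auto simp: proper_def)
    have z: "z \<in> fst R" using fst_pt[OF 1(2) ne] by (simp add: z_def)
    have zc: "z \<notin> fst (child R a)" using not_fst_pt_child[OF 1(2) ne] by (simp add: z_def)
    have sub: "fst (child R a) \<subseteq> fst R" by (rule child_subset)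
    have fin: "finite {x \<in> fst R. idx x \<le> n}" for n
      using AX idx_inj by (intro inj_on_finite[of idx _ "{..n}"]) (auto simp: inj_on_def)
    have le: "card {x \<in> fst (child R a). idx x \<le> n} \<le> card {x \<in> fst R. idx x \<le> n}" for n
      using sub by (intro card_mono fin) auto
    have less: "card {x \<in> fst (child R a). idx x \<le> n} < card {x \<in> fst R. idx x \<le> n}" if "idx z \<le> n" for n
      using sub z zc that by (intro psubset_card_mono fin) auto
    have "\<exists>t. p \<in> fst (foldl child (child R a) t) \<and> fst_pt (foldl child (child R a) t) = p"
    proof (rule 1(1))
      show "proper (child R a)" "p \<in> fst (child R a)" using 1 a proper_child by auto
      show "(child R a, R) \<in> inv_image (less_than <*lex*> less_than)
        (\<lambda>R. (card {x \<in> fst R. idx x \<le> idx p},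
          case snd R of None \<Rightarrow> 0 | Some h \<Rightarrow> card {x \<in> fst R. idx x \<le> idx (p \<sqinter> h)}))"
      proof (cases "snd R")
        case None
        then have "idx z \<le> idx p" using fst_pt(3)[OF 1(2) ne, of p] 1(3) by (simp add: trunk_def z_def)
        from less[OF this] show ?thesis by simp
      next
        case (Some h)
        have "p \<sqinter> h \<in> trunk R" using Some 1 ne by (auto simp: trunk_def proper_def)
        then have zw: "idx z \<le> idx (p \<sqinter> h)" using fst_pt(3)[OF 1(2) ne] by (simp add: z_def)
        have "(case snd (child R a) of None \<Rightarrow> 0 | Some h' \<Rightarrow> card {x \<in> fst (child R a). idx x \<le> idx (p \<sqinter> h')})
          < card {x \<in> fst R. idx x \<le> idx (p \<sqinter> h)}"
        proof (cases a)
          case (Ex d)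
          have "0 < card {x \<in> fst R. idx x \<le> idx (p \<sqinter> h)}"
            using z zw fin by (auto simp: card_gt_0_iff)
          then show ?thesis using Ex by simp
        next
          case (Tr b)
          have "snd (child R a) = Some (if b then h else z)" using Tr Some by (simp add: z_def)
          moreover have "p \<sqinter> (if b then h else z) = p \<sqinter> h"
            using child_meet_below[OF 1(2) Some 1(3)] a Tr by (auto simp: z_def)
          ultimately show ?thesis using less[OF zw] by simp
        qed
        then show ?thesis using Some le[of "idx p"] by auto
      qed
    qed
    then obtain t where "p \<in> fst (foldl child (child R a) t)" "fst_pt (foldl child (child R a) t) = p" by blast
    then show ?thesis by (intro exI[of _ "a # t"]) simp
  qed
qed

definition path :: "'a \<Rightarrow> word"
  where "path p = (SOME t. p \<in> fst (region t) \<and> fst_pt (region t) = p)"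

text \<open>The last letter stands for the point itself, by the direction of its side cone; within a
  longer word the same letter leads into that cone.\<close>

definition code :: "'a \<Rightarrow> word"
  where "code p = path p @ [Ex (side (region (path p)))]"

lemma path:
  assumes "p \<in> X"
  shows "p \<in> fst (region (path p))" "fst_pt (region (path p)) = p"
proof -
  have "proper (X, None)" "p \<in> fst (X, None)" using proper_region[of "[]"] assms by (simp_all add: region_def)
  then have "\<exists>t. p \<in> fst (region t) \<and> fst_pt (region t) = p"
    unfolding region_def by (rule point_reached)
  then have "p \<in> fst (region (path p)) \<and> fst_pt (region (path p)) = p"
    unfolding path_def by (rule someI_ex)
  then show "p \<in> fst (region (path p))" "fst_pt (region (path p)) = p" by auto
qed

lemma region_mono: "fst (region (t @ y)) \<subseteq> fst (region t)"
proof (induction y rule: rev_induct)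
  case (snoc a y)
  then show ?case using child_subset region_snoc[of "t @ y" a] by fastforce
qed simp

lemma in_child: "x \<in> fst (region (t @ a # y)) \<Longrightarrow> x \<in> fst (child (region t) a)"
  using region_mono[of "t @ [a]" y] by (auto simp: region_snoc)

text \<open>A point below the top needs no exit: it lies below the current first point, or above it
  on the side of \<open>h\<close>. Lowering the top to a first point above \<open>p\<close> does not
  change the side of \<open>p\<close> on which it lies.\<close>

lemma path_trunk:
  assumes p: "p \<in> X" "path p = c @ y" "snd (region c) = Some h" "p \<prec> h"
  shows "list_all is_Tr y \<and> cone (\<not> side (region (path p))) p h"
  using p(2-4)
proof (induction y arbitrary: c h)
  case Nil
  define R where "R = region c"
  have R: "proper R" "fst R \<noteq> {}" "fst_pt R = p" "snd R = Some h"
    using path[OF p(1)] Nil by (auto simp: R_def proper_region)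
  then have h: "h \<in> X" using fst_pt(4) by blast
  obtain e where e: "cone e p h" using cone_exists[OF p(1) h] Nil by blast
  then have "side R = (\<not> e)"
    using cone_unique[OF p(1) h, of e False] R by (cases e) (auto simp: side_def)
  with e show ?case using Nil by (simp add: R_def)
next
  case (Cons a y)
  define R where "R = region c"
  define z where "z = fst_pt R"
  have pa: "p \<in> fst (child R a)"
    using path(1)[OF p(1)] in_child Cons.prems(1) by (simp add: R_def)
  then have R: "proper R" "fst R \<noteq> {}" "snd R = Some h"
    using child_subset[of R a] Cons.prems by (auto simp: R_def proper_region)
  have pz: "p \<noteq> z" using not_fst_pt_child[OF R(1,2)] pa by (auto simp: z_def)
  have h: "z \<prec> h" "h \<in> X" "z \<in> X" using fst_pt[OF R(1,2)] R(3) by (auto simp: z_def)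
  have pR: "p \<in> fst R" using pa child_subset by blast
  have Rc: "region (c @ [a]) = child R a" by (simp add: region_snoc R_def)
  show ?case
  proof (cases "z \<preceq> p")
    case False
    then have "p \<prec> z"
      using lower_comparable[OF p(1) h(3,2)] Cons.prems(3) h(1) pz lt_le by (auto simp: preceq_def)
    have "p \<in> fst (child R (Tr False))" using False pR by (simp add: z_def)
    then have a: "a = Tr False" using child_disjoint[OF R(1) pa] by blast
    then have "snd (region (c @ [a])) = Some z" using Rc by (simp add: z_def)
    from Cons.IH[OF _ this \<open>p \<prec> z\<close>] Cons.prems(1)
    have "list_all is_Tr y" "cone (\<not> side (region (path p))) p z" by auto
    then show ?thesis using a cone_up[OF p(1) h(3,2)] lt_le[OF h(1)] by auto
  next
    case True
    then have "z \<prec> p" using pz by (auto simp: preceq_def)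
    then obtain e where e: "cone e z p" using cone_exists[OF h(3) p(1)] by blast
    then have eh: "cone e z h" using cone_up[OF h(3) p(1) h(2)] Cons.prems(3) lt_le by blast
    then have "side R = (\<not> e)"
      using cone_unique[OF h(3,2), of e False] R by (cases e) (auto simp: side_def z_def)
    then have "p \<in> fst (child R (Tr True))" using e pR by (simp add: z_def)
    then have a: "a = Tr True" using child_disjoint[OF R(1) pa] by blast
    then have "snd (region (c @ [a])) = Some h" using Rc R(3) by simp
    from Cons.IH[OF _ this Cons.prems(3)] Cons.prems(1) a show ?thesis by auto
  qed
qed

text \<open>If the path of \<open>q\<close> extends that of \<open>p\<close>, the next letter is the
  exit or \<open>Tr True\<close>, according to the side of \<open>p\<close>. Otherwise
  \<open>p\<close> lies below \<open>q\<close>, or below the first point at which the paths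
  separate; its path goes \<open>Tr False\<close> there and stays in the trunk by
  \<open>path_trunk\<close>.\<close>

lemma code_wcone:
  assumes X: "p \<in> X" "q \<in> X" and c: "cone e p q"
  shows "wcone e (code p) (code q)"
proof (cases rule: word_cases[of "path q" "path p"])
  case (1 y)
  define R where "R = region (path p)"
  have R: "proper R" "fst R \<noteq> {}" "fst_pt R = p" using path[OF X(1)] by (auto simp: R_def proper_region)
  have "p \<noteq> q" using cone_lt[OF c] irrefl X by blast
  then have "path p \<noteq> path q" using path(2)[OF X(1)] path(2)[OF X(2)] by metis
  then obtain a y' where y: "y = a # y'" using 1 by (cases y) auto
  have qa: "q \<in> fst (child R a)" using path(1)[OF X(2)] in_child 1 y by (simp add: R_def)
  have qR: "q \<in> fst R" using qa child_subset by blast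
  show ?thesis
  proof (cases "e = side R")
    case True
    then have "q \<in> fst (child R (Ex e))" using c R(3) qR by simp
    then have "a = Ex e" using child_disjoint[OF R(1) qa] by blast
    then have "side_above (code p) (code q)"
      using 1 y True by (auto simp: side_above_def code_def R_def)
    then show ?thesis using True by (simp add: wcone_def code_def R_def)
  next
    case False
    then have "q \<in> fst (child R (Tr True))" using c R(3) qR by simp
    then have a: "a = Tr True" using child_disjoint[OF R(1) qa] by blast
    have "code p = path p @ Ex (side R) # []" "code q = path p @ Tr True # y' @ [Ex (side (region (path q)))]"
      using 1 y a by (simp_all add: code_def R_def)
    moreover have "Ex (side R) < Tr True" by (simp add: less_letter_def)
    moreover have "list_all is_Tr (butlast (Ex (side R) # []))" by simp
    ultimately have "trunk_below (code p) (code q)" unfolding trunk_below_def by metis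
    then show ?thesis using False by (auto simp: wcone_def code_def R_def)
  qed
next
  case (2 y)
  define R where "R = region (path q)"
  have R: "proper R" "fst R \<noteq> {}" "fst_pt R = q" using path[OF X(2)] by (auto simp: R_def proper_region)
  obtain a y' where y: "y = a # y'" using 2 by (cases y) auto
  have pa: "p \<in> fst (child R a)" using path(1)[OF X(1)] in_child 2 y by (simp add: R_def)
  have "\<not> q \<preceq> p" using lt_not_le[OF X cone_lt[OF c]] .
  then have "p \<in> fst (child R (Tr False))" using pa child_subset[of R a] R(3) by auto
  then have a: "a = Tr False" using child_disjoint[OF R(1) pa] by blast
  have "snd (region (path q @ [a])) = Some q" using a R by (simp add: region_snoc R_def)
  then have t: "list_all is_Tr y'" "cone (\<not> side (region (path p))) p q"
    using path_trunk[OF X(1), of "path q @ [a]" y' q] 2 y cone_lt[OF c] by auto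
  then have e: "e = (\<not> side (region (path p)))" using cone_unique X c by blast
  have "code p = path q @ Tr False # y' @ [Ex (side (region (path p)))]" "code q = path q @ Ex (side R) # []"
    using 2 y a by (simp_all add: code_def R_def)
  moreover have "Tr False < Ex (side R)" by (simp add: less_letter_def)
  moreover have "list_all is_Tr (butlast (Tr False # y' @ [Ex (side (region (path p)))]))"
    using t(1) by (simp add: butlast_append)
  ultimately have "trunk_below (code p) (code q)" unfolding trunk_below_def by metis
  then show ?thesis using e by (simp add: wcone_def code_def)
next
  case (3 k b y a x)
  define R where "R = region k"
  define z where "z = fst_pt R"
  have pa: "p \<in> fst (child R a)" using path(1)[OF X(1)] in_child 3 by (simp add: R_def)
  have qb: "q \<in> fst (child R b)" using path(1)[OF X(2)] in_child 3 by (simp add: R_def)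
  have R: "proper R" "fst R \<noteq> {}" using child_subset[of R a] pa by (auto simp: R_def proper_region)
  have zX: "z \<in> X" using fst_pt[OF R] by (simp add: z_def)
  have qR: "q \<in> fst R" and pR: "p \<in> fst R" using qb pa child_subset by blast+
  have a: "a = Tr False"
  proof (rule ccontr)
    assume "a \<noteq> Tr False"
    then obtain f where f: "cone f z p" "fst (child R a) = {x \<in> fst R. cone f z x}"
      using pa by (cases a) (auto simp: z_def split: if_splits)
    then have "q \<in> fst (child R a)"
      using cone_up[OF zX X] lt_le[OF cone_lt[OF c]] qR by auto
    then show False using child_disjoint[OF R(1) qb] 3 by blast
  qed
  have pz: "\<not> z \<preceq> p" using pa a by (simp add: z_def)
  have zq: "z \<preceq> q"
    using qb 3 a cone_lt lt_le by (cases b) (auto simp: z_def split: if_splits)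
  then have "p \<prec> z"
    using lower_comparable[OF X(1) zX X(2)] lt_le[OF cone_lt[OF c]] pz by (auto simp: preceq_def)
  have "snd (region (k @ [a])) = Some z" using a by (simp add: region_snoc R_def z_def)
  then have t: "list_all is_Tr x" "cone (\<not> side (region (path p))) p z"
    using path_trunk[OF X(1), of "k @ [a]" x z] 3 \<open>p \<prec> z\<close> by auto
  then have e: "e = (\<not> side (region (path p)))" using cone_unique cone_up[OF X(1) zX X(2)] zq X c by blast
  have "code p = k @ Tr False # x @ [Ex (side (region (path p)))]"
    "code q = k @ b # y @ [Ex (side (region (path q)))]"
    using 3 a by (simp_all add: code_def)
  moreover have "Tr False < b" using 3 a by (cases b) (auto simp: less_letter_def)
  moreover have "list_all is_Tr (butlast (Tr False # x @ [Ex (side (region (path p)))]))"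
    using t(1) by (simp add: butlast_append)
  ultimately have "trunk_below (code p) (code q)" unfolding trunk_below_def by metis
  then show ?thesis using e by (simp add: wcone_def code_def)
qed

end

section \<open>Both directions are dense\<close>

lemma is_iso_sym:
  assumes f: "is_iso f S T" and closed: "\<And>p q. p \<in> points S \<Longrightarrow> q \<in> points S \<Longrightarrow> pmeet S p q \<in> points S"
  shows "is_iso (inv_into (points S) f) T S"
proof -
  define g where "g = inv_into (points S) f"
  have bij: "bij_betw f (points S) (points T)" using f by (simp add: is_iso_def)
  have g: "g x \<in> points S" "f (g x) = x" if "x \<in> points T" for x
    using that bij by (auto simp: g_def bij_betw_def inv_into_into f_inv_into_f)
  have gf: "g (f x) = x" if "x \<in> points S" for x
    using that bij by (simp add: g_def bij_betw_def)
  have iso: "prec S (g x) (g y) = prec T x y" "plex S (g x) (g y) = plex T x y"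
    "g (pmeet T x y) = pmeet S (g x) (g y)" if x: "x \<in> points T" "y \<in> points T" for x y
  proof -
    have "prec T (f (g x)) (f (g y)) = prec S (g x) (g y)" "plex T (f (g x)) (f (g y)) = plex S (g x) (g y)"
      "f (pmeet S (g x) (g y)) = pmeet T (f (g x)) (f (g y))"
      using f g(1) x by (simp_all add: is_iso_def)
    then show "prec S (g x) (g y) = prec T x y" "plex S (g x) (g y) = plex T x y"
      "g (pmeet T x y) = pmeet S (g x) (g y)"
      using g[OF x(1)] g[OF x(2)] gf[OF closed, of "g x" "g y"] by simp_all
  qed
  have "bij_betw g (points T) (points S)" unfolding g_def by (rule bij_betw_inv_into[OF bij])
  with iso show ?thesis unfolding g_def[symmetric] is_iso_def by simp
qed

lemma is_iso_trans:
  assumes "is_iso f S T" "is_iso g T U"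
  shows "is_iso (g \<circ> f) S U"
proof -
  have "f p \<in> points T" if "p \<in> points S" for p
    using assms(1) that by (auto simp: is_iso_def bij_betw_def)
  then show ?thesis using assms unfolding is_iso_def by (auto intro: bij_betw_trans)
qed

lemma finite_two_branching_tree_iso:
  assumes f: "is_iso f S T" and S: "finite_two_branching_tree S"
  shows "finite_two_branching_tree T"
proof -
  have lex: "lex_pseudotree S" using S by (simp add: finite_two_branching_tree_def)
  have T: "points T = f ` points S" and inj: "inj_on f (points S)"
    using f by (auto simp: is_iso_def bij_betw_def)
  have iso: "prec T (f p) (f q) = prec S p q" "plex T (f p) (f q) = plex S p q"
    "pmeet T (f p) (f q) = f (pmeet S p q)" "preceq T (f p) (f q) = preceq S p q"
    "incomparable T (f p) (f q) = incomparable S p q"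
    if "p \<in> points S" "q \<in> points S" for p q
    using f that inj by (auto simp: is_iso_def preceq_def incomparable_def inj_on_eq_iff)
  have root: "is_root T (f r)" if "is_root S r" for r
    using that by (auto simp: is_root_def T iso)
  have chain: "is_chain T {q \<in> points T. prec T q (f p)}"
    if "p \<in> points S" "is_chain S {q \<in> points S. prec S q p}" for p
    using that by (auto simp: is_chain_def T iso)
  have meet_in: "pmeet S p q \<in> points S" if "p \<in> points S" "q \<in> points S" for p q
    using that lex by (simp add: lex_pseudotree_def)
  have "lex_pseudotree T"
  proof -
    note lex' = lex[unfolded lex_pseudotree_def]
    note L1 = lex'[THEN conjunct2]
    note L2 = L1[THEN conjunct2]
    note L3 = L2[THEN conjunct2]
    note L4 = L3[THEN conjunct2]
    note L5 = L4[THEN conjunct2]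
    note L6 = L5[THEN conjunct2]
    note L7 = L6[THEN conjunct2]
    note L8 = L7[THEN conjunct2]
    have "\<forall>p\<in>points T. \<not> prec T p p" using lex' by (simp add: T iso)
    moreover have "\<forall>p\<in>points T. \<forall>q\<in>points T. \<forall>r\<in>points T. prec T p q \<longrightarrow> prec T q r \<longrightarrow> prec T p r"
      by (simp add: T iso meet_in) (use L1[THEN conjunct1] in blast)
    moreover have "\<forall>p\<in>points T. is_chain T {q \<in> points T. prec T q p}"
      using L2[THEN conjunct1] chain by (auto simp: T)
    moreover have "\<exists>r. is_root T r"
      using L3[THEN conjunct1] root by blast
    moreover have "\<forall>p\<in>points T. \<forall>q\<in>points T. pmeet T p q \<in> points T \<and>
        preceq T (pmeet T p q) p \<and> preceq T (pmeet T p q) q \<and>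
        (\<forall>r\<in>points T. preceq T r p \<longrightarrow> preceq T r q \<longrightarrow> preceq T r (pmeet T p q))"
      by (simp add: T iso meet_in) (use L4[THEN conjunct1] in blast)
    moreover have "\<forall>p\<in>points T. \<forall>q\<in>points T. plex T p q \<longrightarrow> incomparable T p q \<and> \<not> plex T q p"
      by (simp add: T iso meet_in) (use L5[THEN conjunct1] in blast)
    moreover have "\<forall>p\<in>points T. \<forall>q\<in>points T. incomparable T p q \<longrightarrow> plex T p q \<or> plex T q p"
      by (simp add: T iso meet_in) (use L6[THEN conjunct1] in blast)
    moreover have "\<forall>p\<in>points T. \<forall>q\<in>points T. \<forall>r\<in>points T. plex T p q \<longrightarrow> plex T q r \<longrightarrow> plex T p r"
      by (simp add: T iso meet_in) (use L7[THEN conjunct1] in blast)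
    moreover have "\<forall>p\<in>points T. \<forall>q\<in>points T. \<forall>p'\<in>points T. \<forall>q'\<in>points T.
        plex T p q \<longrightarrow> preceq T p p' \<longrightarrow> preceq T q q' \<longrightarrow> plex T p' q'"
      by (simp add: T iso meet_in) (use L8 in blast)
    ultimately show ?thesis unfolding lex_pseudotree_def by blast
  qed
  moreover have "immediate_succs T s = {} \<or> card (immediate_succs T s) = 2" if s: "s \<in> points T" for s
  proof -
    obtain s' where s': "s' \<in> points S" "s = f s'" using s T by auto
    have "immediate_succs T s = f ` immediate_succs S s'"
      using s' by (auto simp: immediate_succs_def T iso)
    moreover have "inj_on f (immediate_succs S s')"
      by (rule inj_on_subset[OF inj]) (auto simp: immediate_succs_def)
    ultimately show ?thesis using S s'(1) by (auto simp: finite_two_branching_tree_def card_image)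
  qed
  ultimately show ?thesis using S T by (simp add: finite_two_branching_tree_def)
qed

text \<open>
  The comb with spine \<open>0, 2, \<dots>, 2n\<close>, in which the odd number \<open>a\<close> is a leaf attached to \<open>a - 1\<close>,
  on the right if \<open>D a\<close> holds and on the left otherwise.
\<close>

definition comb :: "nat \<Rightarrow> (nat \<Rightarrow> bool) \<Rightarrow> nat pstruct"
  where "comb n D = \<lparr>points = {..2 * n}, prec = (\<lambda>a b. even a \<and> a < b),
    pmeet = (\<lambda>a b. if a = b \<or> even (min a b) then min a b else min a b - 1),
    plex = (\<lambda>a b. odd a \<and> a < b \<and> \<not> D a \<or> odd b \<and> b < a \<and> D b)\<rparr>"

lemma comb_simps [simp]:
  "points (comb n D) = {..2 * n}" "prec (comb n D) a b \<longleftrightarrow> even a \<and> a < b"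
  "pmeet (comb n D) a b = (if a = b \<or> even (min a b) then min a b else min a b - 1)"
  "plex (comb n D) a b \<longleftrightarrow> odd a \<and> a < b \<and> \<not> D a \<or> odd b \<and> b < a \<and> D b"
  by (simp_all add: comb_def)

lemma lex_pseudotree_comb: "lex_pseudotree (comb n D)"
proof -
  have le: "preceq (comb n D) a b \<longleftrightarrow> even a \<and> a \<le> b \<or> a = b" for a b
    by (auto simp: preceq_def)
  have inc: "incomparable (comb n D) a b \<longleftrightarrow> odd a \<and> a < b \<or> odd b \<and> b < a" for a b
    by (auto simp: incomparable_def le)
  have root: "is_root (comb n D) 0" by (auto simp: is_root_def le)
  show ?thesis
    unfolding lex_pseudotree_def
  proof (intro conjI)
    show "\<exists>r. is_root (comb n D) r" using root by blast
    show "\<forall>p\<in>points (comb n D). is_chain (comb n D) {q \<in> points (comb n D). prec (comb n D) q p}"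
      by (auto simp: is_chain_def inc)
    show "\<forall>p\<in>points (comb n D). \<forall>q\<in>points (comb n D).
      pmeet (comb n D) p q \<in> points (comb n D) \<and> preceq (comb n D) (pmeet (comb n D) p q) p \<and>
      preceq (comb n D) (pmeet (comb n D) p q) q \<and>
      (\<forall>r\<in>points (comb n D). preceq (comb n D) r p \<longrightarrow> preceq (comb n D) r q \<longrightarrow>
        preceq (comb n D) r (pmeet (comb n D) p q))"
    proof (intro ballI conjI impI)
      fix p q r assume "preceq (comb n D) r p" "preceq (comb n D) r q"
      then show "preceq (comb n D) r (pmeet (comb n D) p q)"
        unfolding le comb_simps by (auto simp: min_def) presburger+
    qed (auto simp: le min_def)
    show "\<forall>p\<in>points (comb n D). \<forall>q\<in>points (comb n D). \<forall>r\<in>points (comb n D).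
      plex (comb n D) p q \<longrightarrow> plex (comb n D) q r \<longrightarrow> plex (comb n D) p r"
      unfolding comb_simps by (metis less_trans linorder_neqE_nat)
  qed (auto simp: le inc)
qed

lemma comb_meet_closed:
  "p \<in> points (comb n D) \<Longrightarrow> q \<in> points (comb n D) \<Longrightarrow> pmeet (comb n D) p q \<in> points (comb n D)"
  using lex_pseudotree_comb[of n D] unfolding lex_pseudotree_def by blast

lemma finite_two_branching_tree_comb: "finite_two_branching_tree (comb n D)"
proof -
  have "immediate_succs (comb n D) s = {} \<or> card (immediate_succs (comb n D) s) = 2" if "s \<le> 2 * n" for s
  proof (cases "even s \<and> s < 2 * n")
    case True
    then have "Suc (Suc s) \<le> 2 * n" by (auto elim!: evenE)
    then have "immediate_succs (comb n D) s = {Suc s, Suc (Suc s)}"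
      unfolding immediate_succs_def
    proof (intro set_eqI iffI)
      fix t assume t: "t \<in> {t \<in> points (comb n D). prec (comb n D) s t \<and>
        \<not> (\<exists>u\<in>points (comb n D). prec (comb n D) s u \<and> prec (comb n D) u t)}"
      then have "\<not> Suc (Suc s) < t" using True \<open>Suc (Suc s) \<le> 2 * n\<close> by auto
      moreover have "s < t" using t by simp
      ultimately have "t = Suc s \<or> t = Suc (Suc s)" by linarith
      then show "t \<in> {Suc s, Suc (Suc s)}" by blast
    next
      fix t assume "t \<in> {Suc s, Suc (Suc s)}"
      have "\<not> (s < u \<and> even u \<and> u < Suc (Suc s))" for u using True by presburger
      then have "\<not> (s < u \<and> even u \<and> u < t)" for u using \<open>t \<in> {Suc s, Suc (Suc s)}\<close> True
        by (metis empty_iff insert_iff less_SucI less_antisym)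
      moreover have "s < t" "t \<le> 2 * n"
        using \<open>t \<in> {Suc s, Suc (Suc s)}\<close> \<open>Suc (Suc s) \<le> 2 * n\<close> by auto
      ultimately show "t \<in> {t \<in> points (comb n D). prec (comb n D) s t \<and>
        \<not> (\<exists>u\<in>points (comb n D). prec (comb n D) s u \<and> prec (comb n D) u t)}"
        using True unfolding comb_simps by blast
    qed
    then show ?thesis by simp
  next
    case False
    then have "\<not> prec (comb n D) s t" if "t \<in> points (comb n D)" for t using that by auto
    then have "immediate_succs (comb n D) s = {}" unfolding immediate_succs_def by blast
    then show ?thesis by simp
  qed
  then show ?thesis by (simp add: finite_two_branching_tree_def lex_pseudotree_comb)
qed

context branching
begin

text \<open>A comb described by cones: a spine point sees its tooth in the prescribed direction and
  the rest of the comb in the other one. Copies of the comb have this form, and conversely such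
  points form a copy if the lowest one is the root.\<close>

definition comb_at :: "nat \<Rightarrow> (nat \<Rightarrow> bool) \<Rightarrow> (nat \<Rightarrow> 'a) \<Rightarrow> bool"
  where "comb_at n D \<phi> \<longleftrightarrow> (\<forall>a\<le>2 * n. \<phi> a \<in> X) \<and>
    (\<forall>a b. even a \<longrightarrow> a < b \<longrightarrow> b \<le> 2 * n \<longrightarrow>
      cone (if b = Suc a then D b else \<not> D (Suc a)) (\<phi> a) (\<phi> b))"

lemma comb_at_if_iso:
  assumes iso: "is_iso \<psi> (comb n D) (induced S Q)" and Q: "Q \<subseteq> X"
  shows "comb_at n D \<psi>"
proof -
  have im: "\<psi> a \<in> Q" if "a \<le> 2 * n" for a
    using iso that by (auto simp: is_iso_def induced_def bij_betw_def)
  have *: "\<psi> a \<prec> \<psi> b \<longleftrightarrow> even a \<and> a < b" "\<psi> a \<lhd> \<psi> b \<longleftrightarrow> plex (comb n D) a b"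
    "\<psi> a \<sqinter> \<psi> b = \<psi> (pmeet (comb n D) a b)" if "a \<le> 2 * n" "b \<le> 2 * n" for a b
    using iso that unfolding is_iso_def induced_def by auto
  show ?thesis
    unfolding comb_at_def
  proof (intro conjI allI impI)
    show "\<psi> a \<in> X" if "a \<le> 2 * n" for a using im that Q by blast
    fix a b assume ab: "even a" "a < b" "b \<le> 2 * n"
    define c where "c = (if b = Suc a then Suc (Suc a) else Suc a)"
    have c: "c \<le> 2 * n" using ab unfolding c_def by presburger
    have "\<psi> a \<prec> \<psi> b" using ab * by auto
    moreover have "\<psi> b \<sqinter> \<psi> c = \<psi> a" using ab c by (subst *(3)) (auto simp: c_def min_def)
    moreover have "if (if b = Suc a then D b else \<not> D (Suc a)) then \<psi> c \<lhd> \<psi> b else \<psi> b \<lhd> \<psi> c"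
      using ab c * by (auto simp: c_def)
    ultimately show "cone (if b = Suc a then D b else \<not> D (Suc a)) (\<psi> a) (\<psi> b)"
      unfolding cone_def using im[OF c] Q by blast
  qed
qed

lemma comb_iso:
  assumes \<phi>: "comb_at n D \<phi>" and root: "is_root S (\<phi> 0)"
  shows "is_iso \<phi> (comb n D) (induced S (\<phi> ` {..2 * n}))" "rooted_subtree (\<phi> ` {..2 * n}) S"
proof -
  have X: "\<phi> a \<in> X" if "a \<le> 2 * n" for a using \<phi> that by (auto simp: comb_at_def)
  have c: "cone (if b = Suc a then D b else \<not> D (Suc a)) (\<phi> a) (\<phi> b)"
    if "even a" "a < b" "b \<le> 2 * n" for a b using \<phi> that by (auto simp: comb_at_def)
  have even: "\<phi> a \<prec> \<phi> b" if "even a" "a < b" "b \<le> 2 * n" for a b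
    using c[OF that] cone_lt by blast
  have odd: "incomparable S (\<phi> a) (\<phi> b)" "\<phi> a \<sqinter> \<phi> b = \<phi> (a - 1)" "\<phi> b \<lhd> \<phi> a \<longleftrightarrow> D a" "\<phi> a \<lhd> \<phi> b \<longleftrightarrow> \<not> D a"
    if ab: "odd a" "a < b" "b \<le> 2 * n" for a b
  proof -
    obtain e where e: "a = Suc e" "even e" using ab(1) by (cases a) auto
    have "cone (D a) (\<phi> e) (\<phi> a)" "cone (\<not> D a) (\<phi> e) (\<phi> b)"
      using c[of e a] c[of e b] e ab by auto
    from opposite_cones[OF _ _ _ this] X e ab
    show "incomparable S (\<phi> a) (\<phi> b)" "\<phi> a \<sqinter> \<phi> b = \<phi> (a - 1)" "\<phi> b \<lhd> \<phi> a \<longleftrightarrow> D a" "\<phi> a \<lhd> \<phi> b \<longleftrightarrow> \<not> D a"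
      by auto
  qed
  have less: "(\<phi> a \<prec> \<phi> b \<longleftrightarrow> even a) \<and> \<not> \<phi> b \<prec> \<phi> a \<and> \<phi> a \<noteq> \<phi> b \<and>
    (\<phi> a \<lhd> \<phi> b \<longleftrightarrow> odd a \<and> \<not> D a) \<and> (\<phi> b \<lhd> \<phi> a \<longleftrightarrow> odd a \<and> D a) \<and>
    \<phi> a \<sqinter> \<phi> b = \<phi> (pmeet (comb n D) a b) \<and> \<phi> b \<sqinter> \<phi> a = \<phi> (pmeet (comb n D) b a)"
    if ab: "a < b" "b \<le> 2 * n" for a b
  proof (cases "even a")
    case True
    have lt: "\<phi> a \<prec> \<phi> b" using even True ab by blast
    have abX: "\<phi> a \<in> X" "\<phi> b \<in> X" using X ab by auto
    have "\<not> \<phi> b \<prec> \<phi> a" "\<phi> a \<noteq> \<phi> b" using lt lt_not_le[OF abX lt] lt_le by auto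
    moreover have "\<not> \<phi> a \<lhd> \<phi> b" "\<not> \<phi> b \<lhd> \<phi> a"
      using lex_incomparable[OF abX] lex_incomparable[OF abX(2,1)] lt_le[OF lt] by (auto simp: incomparable_def)
    moreover have "\<phi> a \<sqinter> \<phi> b = \<phi> a" "\<phi> b \<sqinter> \<phi> a = \<phi> a" using meet_eq[OF abX lt_le[OF lt]] by auto
    ultimately show ?thesis using True lt ab by (auto simp: min_def)
  next
    case False
    have abX: "\<phi> a \<in> X" "\<phi> b \<in> X" using X ab by auto
    have "\<not> \<phi> a \<prec> \<phi> b" "\<not> \<phi> b \<prec> \<phi> a" "\<phi> a \<noteq> \<phi> b"
      using odd(1)[OF False ab] by (auto simp: incomparable_def preceq_def)
    then show ?thesis using False odd(2-4)[OF False ab] meet_commute[OF abX] ab by (auto simp: min_def)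
  qed
  have inj: "inj_on \<phi> {..2 * n}"
    using less by (intro linorder_inj_onI) auto
  have refl: "\<phi> a \<sqinter> \<phi> a = \<phi> a" "\<not> \<phi> a \<prec> \<phi> a" "\<not> \<phi> a \<lhd> \<phi> a" if "a \<le> 2 * n" for a
    using meet_eq[OF X[OF that] X[OF that]] irrefl[OF X[OF that]] lex_asym[OF X[OF that] X[OF that]] by auto
  have pair: "(\<phi> a \<prec> \<phi> b \<longleftrightarrow> even a \<and> a < b) \<and> (\<phi> a \<lhd> \<phi> b \<longleftrightarrow> plex (comb n D) a b) \<and>
    \<phi> (pmeet (comb n D) a b) = \<phi> a \<sqinter> \<phi> b" if "a \<le> 2 * n" "b \<le> 2 * n" for a b
  proof (cases a b rule: linorder_cases)
    case less
    then show ?thesis using \<open>\<And>b a. a < b \<Longrightarrow> b \<le> 2 * n \<Longrightarrow> _ \<and> _\<close>[of a b] that by auto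
  next
    case equal
    then show ?thesis using refl that by simp
  next
    case greater
    then show ?thesis using \<open>\<And>b a. a < b \<Longrightarrow> b \<le> 2 * n \<Longrightarrow> _ \<and> _\<close>[of b a] that by auto
  qed
  show iso: "is_iso \<phi> (comb n D) (induced S (\<phi> ` {..2 * n}))"
    unfolding is_iso_def induced_def using inj pair by (auto simp: bij_betw_def simp del: comb_simps(3,4))
  have "pmeet (comb n D) a b \<le> 2 * n" if "a \<le> 2 * n" "b \<le> 2 * n" for a b
    using that by (auto simp: min_def)
  then have "substructure (\<phi> ` {..2 * n}) S"
    using X pair unfolding substructure_def by (auto simp del: comb_simps(3) simp flip: pair)
  moreover have "r = \<phi> 0" if "is_root S r" for r
    using that root le_antisym by (auto simp: is_root_def)
  ultimately show "rooted_subtree (\<phi> ` {..2 * n}) S"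
    using finite_two_branching_tree_iso[OF iso finite_two_branching_tree_comb] by (auto simp: rooted_subtree_def)
qed

lemma iso_cone:
  assumes g: "is_iso g S S" and X: "p \<in> X" "q \<in> X" and c: "cone d p q"
  shows "cone d (g p) (g q)"
proof -
  obtain r where r: "p \<prec> q" "r \<in> X" "q \<sqinter> r = p" "if d then r \<lhd> q else q \<lhd> r" using c by (auto simp: cone_def)
  have "g r \<in> X" using g r(2) by (auto simp: is_iso_def bij_betw_def)
  moreover have "g p \<prec> g q" "g q \<sqinter> g r = g p" "if d then g r \<lhd> g q else g q \<lhd> g r"
    using g X r unfolding is_iso_def by (auto split: if_splits)
  ultimately show ?thesis by (auto simp: cone_def)
qed

end

locale ultrahomogeneous =
  fixes S :: "'a pstruct" (structure)
  assumes ultrahomogeneous: "two_branching_ultrahomogeneous_pseudotree S"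

sublocale ultrahomogeneous \<subseteq> countable_branching
  using ultrahomogeneous
  by unfold_locales (auto simp: two_branching_ultrahomogeneous_pseudotree_def is_Fraisse_limit_def)

context ultrahomogeneous
begin

lemma Fraisse: "is_Fraisse_limit S"
  using ultrahomogeneous by (simp add: two_branching_ultrahomogeneous_pseudotree_def)

lemma root_exists: "\<exists>r. is_root S r"
  using lex_tree unfolding lex_pseudotree_def by (elim conjE)

lemma dense_below:
  "is_root S r \<Longrightarrow> p \<in> X \<Longrightarrow> r \<prec> p \<Longrightarrow> dense_without_endpoints S {q \<in> X. r \<prec> q \<and> q \<prec> p}"
  using ultrahomogeneous unfolding two_branching_ultrahomogeneous_pseudotree_def by (elim conjE) blast

lemma universal:
  "finite_two_branching_tree (T :: nat pstruct) \<Longrightarrow> \<exists>Q. rooted_subtree Q S \<and> isomorphic T (induced S Q)"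
  using Fraisse[unfolded is_Fraisse_limit_def, THEN conjunct2, THEN conjunct2, THEN conjunct1] by blast

lemma homogeneous:
  "rooted_subtree Q S \<Longrightarrow> rooted_subtree R S \<Longrightarrow> is_iso f (induced S Q) (induced S R) \<Longrightarrow>
    \<exists>g. is_iso g S S \<and> (\<forall>q\<in>Q. g q = f q)"
  using Fraisse[unfolded is_Fraisse_limit_def, THEN conjunct2, THEN conjunct2, THEN conjunct2] by blast

lemma cone_nonempty:
  assumes "s \<in> X"
  obtains q where "q \<in> X" "cone d s q"
proof -
  obtain p q where "p \<in> X" "q \<in> X" "p \<lhd> q" "s = p \<sqinter> q"
    using ultrahomogeneous assms unfolding two_branching_ultrahomogeneous_pseudotree_def by blast
  then have "cone False s p" "cone True s q" using lex_cone by auto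
  with \<open>p \<in> X\<close> \<open>q \<in> X\<close> show thesis by (cases d) (auto intro: that)
qed

text \<open>
  A comb with three teeth contains the comb with two teeth spanned by the root, \<open>s\<close> and \<open>t\<close>;
  homogeneity moves its additional spine point between \<open>s\<close> and \<open>t\<close>.
\<close>

lemma directions_dense_above_root:
  assumes X: "s \<in> X" "t \<in> X" and r: "is_root S r" "r \<prec> s" and "s \<prec> t"
  obtains z where "z \<in> X" "s \<prec> z" "z \<prec> t" "cone d z t"
proof -
  have rX: "r \<in> X" using r by (simp add: is_root_def)
  obtain d0 where d0: "cone d0 r s" using cone_exists[OF rX X(1) r(2)] .
  obtain d1 where d1: "cone d1 s t" using cone_exists[OF X \<open>s \<prec> t\<close>] .
  obtain y0 where y0: "y0 \<in> X" "cone (\<not> d0) r y0" using cone_nonempty[OF rX] .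
  obtain y1 where y1: "y1 \<in> X" "cone (\<not> d1) s y1" using cone_nonempty[OF X(1)] .
  \<comment> \<open>Teeth 1 and 3 lie opposite to \<open>s\<close> as seen from \<open>r\<close> and
    to \<open>t\<close> as seen from \<open>s\<close>. Tooth 5 is put on the side
    \<open>\<not> d\<close>, so that the spine point 4 sees 6 in direction \<open>d\<close>.\<close>
  define D where "D a = (if a = 1 then \<not> d0 else if a = 3 then \<not> d1 else \<not> d)" for a :: nat
  define \<phi> where "\<phi> a = [r, y0, s, y1, t] ! a" for a
  have le4: "a = 0 \<or> a = 1 \<or> a = 2 \<or> a = 3 \<or> a = 4" if "a \<le> 4" for a :: nat using that by arith
  have "cone d0 r t" "cone d0 r y1"
    using cone_up[OF rX X(1)] X y1 d0 \<open>s \<prec> t\<close> lt_le cone_lt by blast+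
  then have \<phi>: "comb_at 2 D \<phi>"
    using d0 d1 y0 y1 rX X unfolding comb_at_def
    by (auto simp: D_def \<phi>_def dest!: le4)
  obtain Q \<psi> where Q: "rooted_subtree Q S" and \<psi>: "is_iso \<psi> (comb 3 D) (induced S Q)"
    using universal[OF finite_two_branching_tree_comb] unfolding isomorphic_def by blast
  have QX: "Q \<subseteq> X" using Q by (simp add: rooted_subtree_def substructure_def)
  have \<psi>c: "comb_at 3 D \<psi>" using comb_at_if_iso[OF \<psi> QX] .
  \<comment> \<open>Omitting the spine point 4 with its tooth 5 leaves a comb with two teeth in the
    same directions.\<close>
  define \<phi>' where "\<phi>' a = \<psi> (if a = 4 then 6 else a)" for a
  have \<phi>': "comb_at 2 D \<phi>'"
    unfolding comb_at_def
  proof (intro conjI allI impI)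
    show "\<phi>' a \<in> X" if "a \<le> 2 * 2" for a using \<psi>c that by (auto simp: comb_at_def \<phi>'_def)
    fix a b :: nat assume ab: "even a" "a < b" "b \<le> 2 * 2"
    define b' where "b' = (if b = 4 then 6 else b)"
    have "a < b'" "b' \<le> 2 * 3" "a \<noteq> 4" "b' = Suc a \<longleftrightarrow> b = Suc a"
      using ab by (auto simp: b'_def)
    moreover have "cone (if b' = Suc a then D b' else \<not> D (Suc a)) (\<psi> a) (\<psi> b')"
      using \<psi>c ab(1) calculation(1,2) unfolding comb_at_def by blast
    ultimately show "cone (if b = Suc a then D b else \<not> D (Suc a)) (\<phi>' a) (\<phi>' b)"
      by (auto simp: \<phi>'_def b'_def split: if_splits)
  qed
  \<comment> \<open>Homogeneity concerns subtrees containing the root, so the bottom of the comb has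
    to be the root; it is, as the root occurs among the points of the comb.\<close>
  have root': "is_root S (\<phi>' 0)"
  proof -
    have "r \<in> Q" using Q r(1) by (auto simp: rooted_subtree_def)
    then obtain i where i: "i \<le> 6" "r = \<psi> i"
      using \<psi> by (auto simp: is_iso_def bij_betw_def induced_def)
    have "\<psi> 0 \<in> X" using \<psi>c by (auto simp: comb_at_def)
    have "i = 0"
    proof (rule ccontr)
      assume "i \<noteq> 0"
      then have "\<psi> 0 \<prec> \<psi> i" using \<psi>c i(1) unfolding comb_at_def by (auto intro!: cone_lt)
      then show False using lt_not_le[OF \<open>\<psi> 0 \<in> X\<close> rX] r(1) \<open>\<psi> 0 \<in> X\<close> i(2) by (auto simp: is_root_def)
    qed
    then show ?thesis using r(1) i(2) by (simp add: \<phi>'_def)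
  qed
  have root: "is_root S (\<phi> 0)" using r by (simp add: \<phi>_def)
  define f where "f = \<phi> \<circ> inv_into {..4} \<phi>'"
  have "is_iso (inv_into {..4} \<phi>') (induced S (\<phi>' ` {..4})) (comb 2 D)"
    using is_iso_sym[OF comb_iso(1)[OF \<phi>' root'] comb_meet_closed] by simp
  then have "is_iso f (induced S (\<phi>' ` {..4})) (induced S (\<phi> ` {..4}))"
    unfolding f_def using is_iso_trans[OF _ comb_iso(1)[OF \<phi> root]] by simp
  moreover have "rooted_subtree (\<phi>' ` {..4}) S" "rooted_subtree (\<phi> ` {..4}) S"
    using comb_iso(2)[OF \<phi>' root'] comb_iso(2)[OF \<phi> root] by simp_all
  ultimately obtain g where g: "is_iso g S S" "\<forall>q\<in>\<phi>' ` {..4}. g q = f q"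
    using homogeneous by blast
  have "inj_on \<phi>' {..4}" using comb_iso(1)[OF \<phi>' root'] by (simp add: is_iso_def bij_betw_def)
  then have g\<phi>: "g (\<phi>' a) = \<phi> a" if "a \<le> 4" for a using g(2) that by (simp add: f_def)
  have \<psi>X: "\<psi> a \<in> X" if "a \<le> 6" for a using \<psi>c that by (simp add: comb_at_def)
  have "cone (\<not> D 3) (\<psi> 2) (\<psi> 4)" "cone (\<not> D 5) (\<psi> 4) (\<psi> 6)"
    using \<psi>c[unfolded comb_at_def, THEN conjunct2, rule_format, of 2 4]
      \<psi>c[unfolded comb_at_def, THEN conjunct2, rule_format, of 4 6] by simp_all
  then have "cone (\<not> D 3) (g (\<psi> 2)) (g (\<psi> 4))" "cone (\<not> D 5) (g (\<psi> 4)) (g (\<psi> 6))"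
    using iso_cone[OF g(1)] \<psi>X by auto
  moreover have "g (\<psi> 2) = s" "g (\<psi> 6) = t"
    using g\<phi>[of 2] g\<phi>[of 4] by (simp_all add: \<phi>'_def \<phi>_def)
  moreover have "g (\<psi> 4) \<in> X" using g(1) \<psi>X[of 4] by (auto simp: is_iso_def bij_betw_def)
  ultimately show thesis using cone_lt by (intro that[of "g (\<psi> 4)"]) (auto simp: D_def)
qed

lemma directions_dense:
  assumes X: "s \<in> X" "t \<in> X" and "s \<prec> t"
  obtains z where "z \<in> X" "s \<prec> z" "z \<prec> t" "cone d z t"
proof -
  obtain r where r: "is_root S r" using root_exists by blast
  have rX: "r \<in> X" using r by (simp add: is_root_def)
  \<comment> \<open>If \<open>s\<close> is the root, density supplies a point above it to start
    from.\<close>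
  obtain s' where s': "s' \<in> X" "s \<preceq> s'" "r \<prec> s'" "s' \<prec> t"
  proof (cases "r = s")
    case False
    then have "r \<prec> s" using r X by (auto simp: is_root_def preceq_def)
    then show thesis using that X \<open>s \<prec> t\<close> by auto
  next
    case True
    then have "dense_without_endpoints S {q \<in> X. r \<prec> q \<and> q \<prec> t}"
      using dense_below[OF r X(2)] \<open>s \<prec> t\<close> by simp
    then have "{q \<in> X. r \<prec> q \<and> q \<prec> t} \<noteq> {}" unfolding dense_without_endpoints_def by (elim conjE)
    then obtain s' where "s' \<in> X" "r \<prec> s'" "s' \<prec> t" by blast
    then show thesis using that True lt_le by simp
  qed
  obtain z where "z \<in> X" "s' \<prec> z" "z \<prec> t" "cone d z t"
    using directions_dense_above_root[OF s'(1) X(2) r s'(3,4)] .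
  then show thesis using that le_lt_trans[OF X(1) s'(1)] s'(2) by blast
qed

end

section \<open>Realizing words by points\<close>

context ultrahomogeneous
begin

definition between :: "bool \<Rightarrow> 'a \<Rightarrow> 'a \<Rightarrow> 'a"
  where "between d s t = (SOME z. z \<in> X \<and> s \<prec> z \<and> z \<prec> t \<and> cone d z t)"

definition above :: "bool \<Rightarrow> 'a \<Rightarrow> 'a"
  where "above d s = (SOME q. q \<in> X \<and> cone d s q)"

lemma between:
  assumes "s \<in> X" "t \<in> X" "s \<prec> t"
  shows "between d s t \<in> X" "s \<prec> between d s t" "between d s t \<prec> t" "cone d (between d s t) t"
proof -
  have "\<exists>z. z \<in> X \<and> s \<prec> z \<and> z \<prec> t \<and> cone d z t" using directions_dense[OF assms] by metis
  then have "between d s t \<in> X \<and> s \<prec> between d s t \<and> between d s t \<prec> t \<and> cone d (between d s t) t"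
    unfolding between_def by (rule someI_ex)
  then show "between d s t \<in> X" "s \<prec> between d s t" "between d s t \<prec> t" "cone d (between d s t) t"
    by blast+
qed

lemma above:
  assumes "s \<in> X"
  shows "above d s \<in> X" "cone d s (above d s)"
proof -
  have "\<exists>q. q \<in> X \<and> cone d s q" using cone_nonempty[OF assms] by metis
  then have "above d s \<in> X \<and> cone d s (above d s)" unfolding above_def by (rule someI_ex)
  then show "above d s \<in> X" "cone d s (above d s)" by blast+
qed

text \<open>
  Every word denotes a trunk segment between two points \<open>lo\<close> and \<open>hi\<close>. It contains the points
  \<open>split False\<close> and \<open>split True\<close>, in this order, with side cones in the given directions.
\<close>

fun split :: "bool \<Rightarrow> 'a \<times> 'a \<Rightarrow> 'a"
  where
    "split False (lo, hi) = between True lo hi"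
  | "split True (lo, hi) = between False (between True lo hi) hi"

text \<open>Unlike a region, a segment offers both exits; this is why it needs two split points, one
  for each direction.\<close>

fun segment_step :: "'a \<times> 'a \<Rightarrow> letter \<Rightarrow> 'a \<times> 'a"
  where
    "segment_step R (Tr b) = (if b then (split True R, snd R) else (fst R, split False R))"
  | "segment_step R (Ex d) = (split d R, above d (split d R))"

definition segment :: "'a \<times> 'a \<Rightarrow> bool"
  where "segment R \<longleftrightarrow> fst R \<in> X \<and> snd R \<in> X \<and> fst R \<prec> snd R"

definition realize :: "'a \<times> 'a \<Rightarrow> word \<Rightarrow> 'a"
  where "realize R p = fst (foldl segment_step R p)"

lemma split:
  assumes "segment R"
  shows "split d R \<in> X" "fst R \<prec> split d R" "split d R \<prec> snd R" "cone (\<not> d) (split d R) (snd R)"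
    "split False R \<prec> split True R"
proof -
  obtain lo hi where R: "R = (lo, hi)" by (cases R)
  have lh: "lo \<in> X" "hi \<in> X" "lo \<prec> hi" using assms by (auto simp: segment_def R)
  note 0 = between[OF lh, of True]
  note 1 = between[OF 0(1) lh(2) 0(3), of False]
  have "lo \<prec> between False (between True lo hi) hi" using trans[OF lh(1) 0(1) 1(1) 0(2) 1(2)] .
  with 0 1 show "split d R \<in> X" "fst R \<prec> split d R" "split d R \<prec> snd R" "cone (\<not> d) (split d R) (snd R)"
    "split False R \<prec> split True R"
    by (cases d; simp add: R)+
qed

lemma segment_step: "segment R \<Longrightarrow> segment (segment_step R a)"
  using split[of R] above(1) cone_lt[OF above(2)] by (cases a) (auto simp: segment_def)

lemma realize_Cons: "realize R (a # p) = realize (segment_step R a) p"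
  by (simp add: realize_def)

definition is_point :: "word \<Rightarrow> bool"
  where "is_point p \<longleftrightarrow> p \<noteq> [] \<and> \<not> is_Tr (last p)"

lemma is_point_Cons: "is_point (a # p) \<longleftrightarrow> (if p = [] then \<not> is_Tr a else is_point p)"
  by (simp add: is_point_def)

lemma realize_Ex: "realize R [Ex d] = split d R"
  by (simp add: realize_def)

text \<open>Split points lie between \<open>lo\<close> and \<open>hi\<close>, hence on the side of
  \<open>hi\<close> as seen from \<open>lo\<close>, and whatever lies above them inherits this
  side.\<close>

lemma realize_lower:
  assumes "segment R" "is_point p"
  shows "realize R p \<in> X" "fst R \<prec> realize R p" "cone e (fst R) (snd R) \<Longrightarrow> cone e (fst R) (realize R p)"
proof -
  have "realize R p \<in> X \<and> fst R \<prec> realize R p \<and>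
    (cone e (fst R) (snd R) \<longrightarrow> cone e (fst R) (realize R p))"
    using assms
  proof (induction p arbitrary: R)
    case (Cons a p)
    have R: "fst R \<in> X" "snd R \<in> X" using Cons.prems(1) by (auto simp: segment_def)
    have cs: "cone e (fst R) (split d R)" if "cone e (fst R) (snd R)" for d
      using cone_down[OF R(1) split(1)[OF Cons.prems(1)] R(2) that] split(2,3)[OF Cons.prems(1)] lt_le by blast
    show ?case
    proof (cases "p = []")
      case True
      then obtain d where "a = Ex d" using Cons.prems(2) by (cases a) (auto simp: is_point_Cons)
      then show ?thesis using True cs split(1,2)[OF Cons.prems(1)] by (simp add: realize_Ex)
    next
      case False
      define R' where "R' = segment_step R a"
      have R': "segment R'" using segment_step Cons.prems(1) by (simp add: R'_def)
      have pp: "is_point p" using Cons.prems(2) False by (simp add: is_point_Cons)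
      note IH = Cons.IH[OF R' pp]
      show ?thesis
      proof (cases "fst R' = fst R")
        case True
        have "a = Tr False"
        proof (rule ccontr)
          assume "a \<noteq> Tr False"
          then obtain d where "fst R' = split d R" by (cases a) (auto simp: R'_def)
          then have "fst R \<prec> fst R" using split(2)[OF Cons.prems(1), of d] True by simp
          then show False using irrefl[OF R(1)] by simp
        qed
        then have "snd R' = split False R" by (simp add: R'_def)
        then show ?thesis using IH True cs by (auto simp: realize_Cons R'_def[symmetric])
      next
        case False
        then have "a \<noteq> Tr False" by (auto simp: R'_def)
        then obtain d where d: "fst R' = split d R" by (cases a) (auto simp: R'_def)
        have q: "realize R' p \<in> X" "split d R \<prec> realize R' p" using IH d by auto
        have "fst R \<prec> realize R' p"
          using trans[OF R(1) split(1)[OF Cons.prems(1)] q(1) split(2)[OF Cons.prems(1)] q(2)] .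
        moreover have "cone e (fst R) (realize R' p)" if "cone e (fst R) (snd R)"
          using cone_up[OF R(1) split(1)[OF Cons.prems(1)] q(1) cs[OF that] lt_le[OF q(2)]] .
        ultimately show ?thesis using q(1) by (simp add: realize_Cons R'_def[symmetric])
      qed
    qed
  qed (simp add: is_point_def)
  then show "realize R p \<in> X" "fst R \<prec> realize R p"
    "cone e (fst R) (snd R) \<Longrightarrow> cone e (fst R) (realize R p)" by blast+
qed

text \<open>Trunk letters only shrink the segment, so the final split point is below the original
  top and sees it opposite to its own exit.\<close>

lemma realize_trunk:
  assumes "segment R" "list_all is_Tr (butlast p)" "p \<noteq> []" "last p = Ex (\<not> d)"
  shows "realize R p \<prec> snd R \<and> cone d (realize R p) (snd R)"
  using assms
proof (induction p arbitrary: R)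
  case (Cons a p)
  show ?case
  proof (cases "p = []")
    case True
    then show ?thesis using Cons.prems split(3,4)[OF Cons.prems(1), of "\<not> d"] by (simp add: realize_Ex)
  next
    case False
    then obtain b where a: "a = Tr b" using Cons.prems(2) by (cases a) auto
    define R' where "R' = segment_step R a"
    have R': "segment R'" using segment_step Cons.prems(1) by (simp add: R'_def)
    have IH: "realize R' p \<prec> snd R' \<and> cone d (realize R' p) (snd R')"
      using Cons.IH[OF R'] Cons.prems False a by simp
    have X: "snd R \<in> X" "snd R' \<in> X" using Cons.prems(1) R' by (auto simp: segment_def)
    have q: "realize R' p \<in> X"
      using realize_lower(1)[OF R'] Cons.prems(4) False by (auto simp: is_point_def)
    have le: "snd R' \<preceq> snd R"
      using a split(3)[OF Cons.prems(1)] lt_le by (auto simp: R'_def)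
    show ?thesis
      using cone_up[OF q X(2,1) _ le] lt_le_trans[OF q X(2,1) _ le] IH
      by (simp add: realize_Cons R'_def[symmetric])
  qed
qed simp

lemma realize_wcone:
  assumes R: "segment R" and p: "is_point p" and q: "is_point q" and c: "wcone d p q"
  shows "cone d (realize R p) (realize R q)"
  using c unfolding wcone_def
proof (elim disjE conjE)
  assume d: "last p = Ex d" and "side_above p q"
  then obtain y where y: "y \<noteq> []" "q = p @ y" by (auto simp: side_above_def)
  obtain t where t: "p = t @ [Ex d]" using p d by (cases p rule: rev_cases) (auto simp: is_point_def)
  define R' where "R' = foldl segment_step R t"
  have R': "segment R'" unfolding R'_def using R by (induction t arbitrary: R) (auto simp: segment_step)
  have "is_point y" using q y by (simp add: is_point_def)
  have "cone d (fst (segment_step R' (Ex d))) (snd (segment_step R' (Ex d)))"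
    using above(2)[OF split(1)[OF R']] by simp
  from realize_lower(3)[OF segment_step[OF R'] \<open>is_point y\<close> this]
  show ?thesis by (simp add: realize_def y t R'_def)
next
  assume d: "last p = Ex (\<not> d)" and "trunk_below p q"
  then obtain k a x b y where *: "p = k @ a # x" "list_all is_Tr (butlast (a # x))" "q = k @ b # y" "a < b"
    by (auto simp: trunk_below_def)
  define R' where "R' = foldl segment_step R k"
  have R': "segment R'" unfolding R'_def using R by (induction k arbitrary: R) (auto simp: segment_step)
  have RX: "fst R' \<in> X" "snd R' \<in> X" using R' by (auto simp: segment_def)
  note sp = split[OF R']
  have eq: "realize R p = realize (segment_step R' a) x" "realize R q = realize (segment_step R' b) y"
    by (simp_all add: realize_def * R'_def)
  have yq: "y \<noteq> [] \<Longrightarrow> is_point y" "y = [] \<Longrightarrow> \<not> is_Tr b" using q * by (auto simp: is_point_def)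
  have above_split: "split e R' \<preceq> realize R q \<and> realize R q \<in> X" if "fst (segment_step R' b) = split e R'" for e
  proof (cases "y = []")
    case True
    then show ?thesis using that sp(1) unfolding eq(2) True by (simp add: realize_def)
  next
    case False
    have "realize R q \<in> X" "split e R' \<prec> realize R q"
      using realize_lower(1,2)[OF segment_step[OF R', of b] yq(1)[OF False]] that by (simp_all add: eq)
    then show ?thesis using lt_le by simp
  qed
  have low: "split False R' \<preceq> realize R q \<and> realize R q \<in> X" if "b \<noteq> Tr False"
  proof -
    have "\<exists>e. fst (segment_step R' b) = split e R'"
    proof (cases b)
      case (Tr b')
      then show ?thesis using that by (intro exI[of _ True]) simp
    next
      case (Ex e)
      then show ?thesis by (intro exI[of _ e]) simp
    qed
    then obtain e where e: "fst (segment_step R' b) = split e R'" ..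
    have "split False R' \<preceq> split e R'" using sp(5) lt_le by (cases e) auto
    then show ?thesis using above_split[OF e] le_trans[OF sp(1) sp(1)] by blast
  qed
  show ?thesis
  proof (cases "x = []")
    case False
    \<comment> \<open>If \<open>p\<close> goes on after the separation, \<open>a\<close> is a trunk
      letter, and being smaller than \<open>b\<close> it is \<open>Tr False\<close>. So
      \<open>p\<close> lies below \<open>split False\<close> of the common segment, and
      \<open>q\<close> at or above this point.\<close>
    then obtain b' where b': "a = Tr b'" using *(2) by (cases a) auto
    have "\<not> Tr True < b" by (cases b) (auto simp: less_letter_def)
    then have a: "a = Tr False" using b' \<open>a < b\<close> by (cases b') auto
    then have b: "b \<noteq> Tr False" using \<open>a < b\<close> by auto
    have "realize (segment_step R' a) x \<prec> snd (segment_step R' a) \<and>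
      cone d (realize (segment_step R' a) x) (snd (segment_step R' a))"
      using *(2) False d * a by (intro realize_trunk segment_step R') auto
    then have c: "cone d (realize R p) (split False R')" by (simp add: eq a)
    have "realize R p \<in> X" using realize_lower(1)[OF R p] .
    then show ?thesis using cone_up[OF _ sp(1) _ c] low[OF b] by blast
  next
    case True
    \<comment> \<open>Now \<open>p\<close> is itself a split point. For \<open>d\<close> true it is
      the lower one, and \<open>q\<close> may leave through the upper one or stay on the trunk above
      it; for \<open>d\<close> false only the trunk remains for \<open>q\<close>.\<close>
    then have a: "a = Ex (\<not> d)" using d * by simp
    then have rp: "realize R p = split (\<not> d) R'" unfolding eq(1) True by (simp add: realize_def)
    show ?thesis
    proof (cases d)
      case True
      then have "Ex False < b" using \<open>a < b\<close> a by simp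
      then have "b = Ex True \<or> b = Tr True" by (cases b) (auto simp: less_letter_def split: if_splits)
      then have u: "split True R' \<preceq> realize R q \<and> realize R q \<in> X" using above_split[of True] by auto
      have "cone True (split False R') (split True R')"
        using cone_down[OF sp(1) sp(1) RX(2) _ sp(5) lt_le[OF sp(3)]] sp(4)[of False] by simp
      then show ?thesis using cone_up[OF sp(1) sp(1)] u True rp by simp
    next
      case False
      then have "Ex True < b" using \<open>a < b\<close> a by simp
      then have b: "b = Tr True" by (cases b) (auto simp: less_letter_def split: if_splits)
      then have "is_point y" using yq by (cases "y = []") auto
      have "cone False (fst (segment_step R' b)) (snd (segment_step R' b))" using sp(4)[of True] b by simp
      from realize_lower(3)[OF segment_step[OF R'] \<open>is_point y\<close> this] show ?thesis
        using False rp b by (simp add: eq)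
    qed
  qed
qed

section \<open>Big Ramsey degrees of chains\<close>

text \<open>The colouring is pulled back to sets of words along \<open>realize\<close>. Composing
  \<open>code\<close>, \<open>point_map f\<close> and \<open>realize\<close> embeds \<open>S\<close>
  into itself, and every copy in the image comes from a chain of words moved by
  \<open>point_map f\<close>.\<close>

lemma chain_Ramsey_bound:
  assumes "substructure A S" "finite A" "is_chain S A"
  shows "\<exists>N. Ramsey_bound (induced S A) S N"
proof -
  define k where "k = card A"
  obtain N where N: "\<forall>\<chi> :: word set \<Rightarrow> nat. finite (range \<chi>) \<longrightarrow> (\<exists>f. good f \<and>
    card ((\<lambda>P. \<chi> (point_map f ` P)) ` {P. word_chain P \<and> finite P \<and> card P = k}) \<le> N)"
    using word_chain_Ramsey by (rule exE)
  obtain r where r: "r \<in> X" using root_exists unfolding is_root_def by blast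
  define R where "R = (r, above False r)"
  have R: "segment R" using above[OF r, of False] cone_lt r by (auto simp: segment_def R_def)
  have "Ramsey_bound (induced S A) S N"
    unfolding Ramsey_bound_def
  proof (intro allI impI)
    fix \<chi> :: "'a set \<Rightarrow> nat" assume fin: "finite (\<chi> ` copies (induced S A) S)"
    \<comment> \<open>The default 0 is for sets of words that do not realize a copy; it keeps the
      range finite.\<close>
    define \<kappa> where "\<kappa> P = (if realize R ` P \<in> copies (induced S A) S then \<chi> (realize R ` P) else 0)"
      for P :: "word set"
    have "range \<kappa> \<subseteq> insert 0 (\<chi> ` copies (induced S A) S)" by (auto simp: \<kappa>_def)
    then have "finite (range \<kappa>)" by (rule finite_subset) (use fin in simp)
    then obtain f where f: "good f"
      and le: "card ((\<lambda>P. \<kappa> (point_map f ` P)) ` {P. word_chain P \<and> finite P \<and> card P = k}) \<le> N"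
      using N by blast
    \<comment> \<open>All three factors preserve cones, hence so does \<open>j\<close>, and by
      \<open>cone_preserving_embedding\<close> its image is a substructure isomorphic to
      \<open>S\<close>.\<close>
    define j where "j p = realize R (point_map f (code p))" for p
    have code: "is_point (code p)" for p by (simp add: code_def is_point_def)
    have pm: "is_point (point_map f (code p))" for p using code[of p] by (simp add: is_point_def point_map_def)
    have jX: "j p \<in> X" for p unfolding j_def by (rule realize_lower(1)[OF R pm])
    have jc: "cone d (j p) (j q)" if "p \<in> X" "q \<in> X" "cone d p q" for d p q
      unfolding j_def using code[of p]
      by (intro realize_wcone[OF R pm pm] point_map_wcone[OF f] code_wcone that) (simp add: is_point_def)
    define Q where "Q = j ` X"
    have Q: "substructure Q S" "is_iso j S (induced S Q)"
      unfolding Q_def using cone_preserving_embedding[of j] jX jc by auto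
    have QX: "Q \<subseteq> X" using jX by (auto simp: Q_def)
    have inj: "inj_on j X" using Q(2) by (simp add: is_iso_def bij_betw_def)
    have codes: "code p \<noteq> code q" if "p \<in> X" "q \<in> X" "p \<noteq> q" for p q
      using that inj by (auto simp: j_def inj_on_def)
    have "\<chi> ` copies (induced S A) (induced S Q) \<subseteq>
      (\<lambda>P. \<kappa> (point_map f ` P)) ` {P. word_chain P \<and> finite P \<and> card P = k}"
    proof
      fix c assume "c \<in> \<chi> ` copies (induced S A) (induced S Q)"
      then obtain B where c: "c = \<chi> B" and B: "B \<in> copies (induced S A) (induced S Q)" by blast
      then have BQ: "B \<subseteq> Q" and Bm: "\<forall>p\<in>B. \<forall>q\<in>B. p \<sqinter> q \<in> B"
        and "isomorphic (induced S A) (induced S B)"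
        by (auto simp: copies_def substructure_def induced_def)
      then obtain g where g: "is_iso g (induced S A) (induced S B)" by (auto simp: isomorphic_def)
      have copy: "B \<in> copies (induced S A) S"
        using BQ QX Bm g by (auto simp: copies_def substructure_def isomorphic_def)
      have bij: "bij_betw g A B" using g by (simp add: is_iso_def induced_def)
      have gle: "g a \<preceq> g b" if "a \<in> A" "b \<in> A" "a \<preceq> b" for a b
        using g that by (auto simp: is_iso_def induced_def preceq_def)
      have Bcomp: "p \<preceq> q \<or> q \<preceq> p" if pq: "p \<in> B" "q \<in> B" for p q
      proof -
        obtain a b where "a \<in> A" "b \<in> A" "p = g a" "q = g b" using pq bij by (auto simp: bij_betw_def)
        moreover have "a \<preceq> b \<or> b \<preceq> a"
          using assms(3) calculation(1,2) by (auto simp: is_chain_def incomparable_def)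
        ultimately show ?thesis using gle by blast
      qed
      define C where "C = {p \<in> X. j p \<in> B}"
      have jC: "j ` C = B" using BQ by (auto simp: C_def Q_def)
      have Ccomp: "p \<prec> q \<or> q \<prec> p" if "p \<in> C" "q \<in> C" "p \<noteq> q" for p q
      proof -
        have pq: "p \<in> X" "q \<in> X" "j p \<in> B" "j q \<in> B" using that by (auto simp: C_def)
        then have "j p \<noteq> j q" using inj that(3) by (auto simp: inj_on_def)
        then have "j p \<prec> j q \<or> j q \<prec> j p" using Bcomp[OF pq(3,4)] by (auto simp: preceq_def)
        then show ?thesis using Q(2) pq(1,2) unfolding is_iso_def induced_def by auto
      qed
      have "inj_on j C" using inj by (rule inj_on_subset) (auto simp: C_def)
      then have "card C = card B" using jC card_image by metis
      also have "\<dots> = k" using bij_betw_same_card[OF bij] by (simp add: k_def)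
      finally have cardC: "card C = k" .
      have finC: "finite C"
        using \<open>inj_on j C\<close> jC bij_betw_finite[OF bij] assms(2) finite_imageD by metis
      define P where "P = code ` C"
      have injc: "inj_on code C" using codes by (auto simp: inj_on_def C_def)
      have "word_chain P"
        unfolding word_chain_def
      proof (intro conjI ballI impI)
        show "p \<noteq> []" if "p \<in> P" for p using that by (auto simp: P_def code_def)
        fix x y assume "x \<in> P" "y \<in> P" "x \<noteq> y"
        then obtain p q where pq: "x = code p" "y = code q" "p \<in> C" "q \<in> C" "p \<noteq> q" by (auto simp: P_def)
        then have X: "p \<in> X" "q \<in> X" by (auto simp: C_def)
        consider "p \<prec> q" | "q \<prec> p" using Ccomp pq by blast
        then show "\<exists>d. wcone d x y \<or> wcone d y x"
        proof cases
          case 1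
          then obtain d where "cone d p q" using cone_exists X by blast
          then show ?thesis using code_wcone X pq by blast
        next
          case 2
          then obtain d where "cone d q p" using cone_exists X by blast
          then show ?thesis using code_wcone X pq by blast
        qed
      qed
      moreover have "finite P" "card P = k"
        using finC cardC card_image[OF injc] by (simp_all add: P_def)
      moreover have "realize R ` point_map f ` P = B"
        using jC by (simp add: P_def image_image j_def)
      then have "\<kappa> (point_map f ` P) = c" using copy c by (simp add: \<kappa>_def)
      ultimately show "c \<in> (\<lambda>P. \<kappa> (point_map f ` P)) ` {P. word_chain P \<and> finite P \<and> card P = k}" by blast
    qed
    moreover have "finite ((\<lambda>P. \<kappa> (point_map f ` P)) ` {P. word_chain P \<and> finite P \<and> card P = k})"
      using \<open>finite (range \<kappa>)\<close> by (rule finite_subset[rotated]) auto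
    ultimately have "card (\<chi> ` copies (induced S A) (induced S Q)) \<le>
      card ((\<lambda>P. \<kappa> (point_map f ` P)) ` {P. word_chain P \<and> finite P \<and> card P = k})"
      by (intro card_mono)
    also note le
    finally have "card (\<chi> ` copies (induced S A) (induced S Q)) \<le> N" .
    then show "\<exists>Q. substructure Q S \<and> isomorphic S (induced S Q) \<and>
      card (\<chi> ` copies (induced S A) (induced S Q)) \<le> N"
      using Q by (auto simp: isomorphic_def)
  qed
  then show ?thesis ..
qed

end

theorem mainTheorem1:
  fixes \<Psi> :: "'a pstruct" and A :: "'a set"
  assumes "two_branching_ultrahomogeneous_pseudotree \<Psi>"
    and "substructure A \<Psi>" and "finite A" and "is_chain \<Psi> A"
  shows "big_Ramsey_degree (induced \<Psi> A) \<Psi> < \<infinity>"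
proof -
  interpret ultrahomogeneous \<Psi> by unfold_locales (rule assms(1))
  obtain N where "Ramsey_bound (induced \<Psi> A) \<Psi> N"
    using chain_Ramsey_bound[OF assms(2-4)] by blast
  \<comment> \<open>The degree is defined as a bound that is at least 1, whereas \<open>N\<close>
    might be 0.\<close>
  then have "Ramsey_bound (induced \<Psi> A) \<Psi> (Suc N)"
    unfolding Ramsey_bound_def by (meson le_SucI)
  then have "\<exists>n\<ge>1. Ramsey_bound (induced \<Psi> A) \<Psi> n" by (intro exI[of _ "Suc N"]) simp
  then show ?thesis by (simp add: big_Ramsey_degree_def)
qed

end
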